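(* Let $u$ be the solution of the transport problem $u_t+a u_x+bu=f(x,t;\varepsilon)$ in $\Omega=(0,L]\times(0,T]$, $u(0,t)=\psi(t)$, $u(x,0)=\phi(x)$, whose data satisfy the conditions in the context (forcing term with a layer at the outflow $x=L$). Let $U$ be the solution of $$L_F^{N,M}U(x_i,t_j)=f(x_i,t_j),\ 1\le i\le N,\ 1\le j\le M;\quad U(0,t_j)=u(0,t_j),\ t_j\ge0;\quad U(x_i,0)=u(x_i,0),\ 0\le x_i\le L,$$ on the piecewise-uniform mesh $\bar\Omega_S^N$, where the mesh and the fitted operator $L_F^{N,M}$ are defined in the context, and let $\bar U$ be the piecewise bilinear interpolant of $U$ on $\bar\Omega$. Then there is a constant $C$, independent of $\varepsilon$, $N$ and $M$, such that $$\|\bar U-u\|\le C\,(N^{-1}\ln N+M^{-1}\ln M).$$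
   Context: $L,T>0$, $0<\varepsilon\le1$, $\bar\Omega=[0,L]\times[0,T]$; $\|\cdot\|$ is the $L_\infty$ norm on $\bar\Omega$. $N,M$ are even positive integers. Data: $a\ge\alpha>0$, $b\ge0$ on $\bar\Omega$, $\psi\in C^2([0,T])$, $\phi\in C^2([0,L])$, $a,b,f\in C^2(\bar\Omega)$; $a,b,\psi,\phi$ do not depend on $\varepsilon$. The compatibility conditions (guaranteeing $u\in C^2(\bar\Omega)$) are assumed: $$\phi(0)=\psi(0),\qquad \psi'(0)+a(0,0)\phi'(0)+b(0,0)\psi(0)=f(0,0),$$ $$[f_t-b_t\psi(0)-b\psi'(0)-\psi''(0)]+\phi'(0)[a(b+a_x)-a_t]+a^2\phi''(0)=a[f_x-b_x\psi(0)],$$ where in the last line $a,b,f$ and their derivatives are evaluated at $(0,0)$. In addition, with a constant $C_1$ independent of $\varepsilon$, $$\left|\frac{\partial^{i+j}f}{\partial x^i\partial t^j}(x,t;\varepsilon)\right|\le\frac{C_1}{\varepsilon^{1+i}}e^{\frac{x-L}{\varepsilon}},\ 0\le i+j\le2,\qquad \frac{\partial^{i+j}f}{\partial x^i\partial t^j}(0,0)=0,\ 0\le i+j\le 1.$$ Mesh $\bar\Omega_S^N$: put $\sigma=\min\{L/2,\varepsilon\ln N\}$ and $\tau=\min\{T/2,C_2\varepsilon\ln M\}$ with a constant $C_2>\alpha^{-1}$. Each of $[0,L-\sigma]$ and $[L-\sigma,L]$ is divided into $N/2$ equal subintervals, of lengths $H=2(L-\sigma)/N$ and $h=2\sigma/N$,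 giving $0=x_0<\dots<x_N=L$; each of $[0,\tau]$ and $[\tau,T]$ is divided into $M/2$ equal subintervals, giving $0=t_0<\dots<t_M=T$. The mesh is the tensor product. Operators: with $h_i=x_i-x_{i-1}$, $k_j=t_j-t_{j-1}$, $$D_t^-Y(x_i,t_j)=\frac{Y(x_i,t_j)-Y(x_i,t_{j-1})}{k_j},\quad D_x^-Y(x_i,t_j)=\frac{Y(x_i,t_j)-Y(x_{i-1},t_j)}{h_i},$$ $$L^{N,M}Y(x_i,t_j)=\bigl(D_t^-+a(x_i,t_j)D_x^-+b(x_i,t_j)I\bigr)Y(x_i,t_j),$$ and, with $\rho:=H/\varepsilon$, $$L_F^{N,M}Y(x_i,t_j)=\begin{cases}L^{N,M}Y(x_i,t_j),& x_i\ne L-\sigma,\\ \Bigl(L^{N,M}+a(x_i,t_j)\bigl(\tfrac{\rho}{1-e^{-\rho}}-1\bigr)D_x^-\Bigr)Y(x_i,t_j),& x_i=L-\sigma.\end{cases}$$ $\bar U$ is the function on $\bar\Omega$ that is bilinear on each mesh cell $[x_{i-1},x_i]\times[t_{j-1},t_j]$ and equals $U$ at all mesh points. The constant $C$ may depend on $a,b,\phi,\psi,C_1,C_2,L,T,\alpha$. *)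

theory Defs
  imports "HOL-Analysis.Analysis"
begin

text \<open>
  Derivatives on a closed interval are taken within that interval, hence one-sided at its
  endpoints; on a closed rectangle the partial derivatives are likewise taken within its sides.
\<close>

definition deriv_on :: "real set \<Rightarrow> (real \<Rightarrow> real) \<Rightarrow> real \<Rightarrow> real" where
  "deriv_on S g x = vector_derivative g (at x within S)"

definition dx :: "real \<Rightarrow> (real \<Rightarrow> real \<Rightarrow> real) \<Rightarrow> real \<Rightarrow> real \<Rightarrow> real" where
  "dx L g x t = deriv_on {0..L} (\<lambda>y. g y t) x"

definition dt :: "real \<Rightarrow> (real \<Rightarrow> real \<Rightarrow> real) \<Rightarrow> real \<Rightarrow> real \<Rightarrow> real" where
  "dt T g x t = deriv_on {0..T} (\<lambda>s. g x s) t"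

definition dxt :: "real \<Rightarrow> real \<Rightarrow> nat \<Rightarrow> nat \<Rightarrow> (real \<Rightarrow> real \<Rightarrow> real) \<Rightarrow> real \<Rightarrow> real \<Rightarrow> real" where
  "dxt L T i j g = (dx L ^^ i) ((dt T ^^ j) g)"

primrec Ck_on :: "nat \<Rightarrow> real set \<Rightarrow> (real \<Rightarrow> real) \<Rightarrow> bool" where
  "Ck_on 0 S g \<longleftrightarrow> continuous_on S g"
| "Ck_on (Suc k) S g \<longleftrightarrow>
     continuous_on S g \<and> (\<forall>x\<in>S. g differentiable (at x within S)) \<and> Ck_on k S (deriv_on S g)"

primrec Ck_rect :: "nat \<Rightarrow> real \<Rightarrow> real \<Rightarrow> (real \<Rightarrow> real \<Rightarrow> real) \<Rightarrow> bool" where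
  "Ck_rect 0 L T g \<longleftrightarrow> continuous_on ({0..L} \<times> {0..T}) (\<lambda>(x, t). g x t)"
| "Ck_rect (Suc k) L T g \<longleftrightarrow>
     continuous_on ({0..L} \<times> {0..T}) (\<lambda>(x, t). g x t) \<and>
     (\<forall>x\<in>{0..L}. \<forall>t\<in>{0..T}.
        (\<lambda>y. g y t) differentiable (at x within {0..L}) \<and>
        (\<lambda>s. g x s) differentiable (at t within {0..T})) \<and>
     Ck_rect k L T (dx L g) \<and> Ck_rect k L T (dt T g)"

text \<open>
  On functions that are bounded on the rectangle (in particular continuous ones) this is the
  supremum norm; for unbounded functions the real-valued supremum is unspecified.
\<close>

definition sup_norm_rect :: "real \<Rightarrow> real \<Rightarrow> (real \<Rightarrow> real \<Rightarrow> real) \<Rightarrow> real" where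
  "sup_norm_rect L T g = (SUP (x, t)\<in>{0..L} \<times> {0..T}. \<bar>g x t\<bar>)"

definition compatible ::
  "real \<Rightarrow> real \<Rightarrow> (real \<Rightarrow> real \<Rightarrow> real) \<Rightarrow> (real \<Rightarrow> real \<Rightarrow> real) \<Rightarrow> (real \<Rightarrow> real \<Rightarrow> real) \<Rightarrow>
   (real \<Rightarrow> real) \<Rightarrow> (real \<Rightarrow> real) \<Rightarrow> bool" where
  "compatible L T a b f \<phi> \<psi> \<longleftrightarrow>
     (let \<phi>' = deriv_on {0..L} \<phi>; \<phi>'' = deriv_on {0..L} \<phi>';
          \<psi>' = deriv_on {0..T} \<psi>; \<psi>'' = deriv_on {0..T} \<psi>' in
      \<phi> 0 = \<psi> 0 \<and>
      \<psi>' 0 + a 0 0 * \<phi>' 0 + b 0 0 * \<psi> 0 = f 0 0 \<and>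
      (dt T f 0 0 - dt T b 0 0 * \<psi> 0 - b 0 0 * \<psi>' 0 - \<psi>'' 0)
        + \<phi>' 0 * (a 0 0 * (b 0 0 + dx L a 0 0) - dt T a 0 0) + (a 0 0)\<^sup>2 * \<phi>'' 0
      = a 0 0 * (dx L f 0 0 - dx L b 0 0 * \<psi> 0))"

definition layer_forcing ::
  "real \<Rightarrow> real \<Rightarrow> real \<Rightarrow> real \<Rightarrow> (real \<Rightarrow> real \<Rightarrow> real) \<Rightarrow> bool" where
  "layer_forcing L T C\<^sub>1 \<epsilon> f \<longleftrightarrow>
     (\<forall>i j. i + j \<le> 2 \<longrightarrow> (\<forall>x\<in>{0..L}. \<forall>t\<in>{0..T}.
        \<bar>dxt L T i j f x t\<bar> \<le> C\<^sub>1 / \<epsilon> ^ (1 + i) * exp ((x - L) / \<epsilon>))) \<and>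
     (\<forall>i j. i + j \<le> 1 \<longrightarrow> dxt L T i j f 0 0 = 0)"

text \<open>
  A classical solution: continuous up to the boundary, with the equation holding pointwise
  in \<open>(0,L] \<times> (0,T]\<close>. No further regularity of \<open>u\<close> is assumed.
\<close>

definition transport_solution ::
  "real \<Rightarrow> real \<Rightarrow> (real \<Rightarrow> real \<Rightarrow> real) \<Rightarrow> (real \<Rightarrow> real \<Rightarrow> real) \<Rightarrow> (real \<Rightarrow> real \<Rightarrow> real) \<Rightarrow>
   (real \<Rightarrow> real) \<Rightarrow> (real \<Rightarrow> real) \<Rightarrow> (real \<Rightarrow> real \<Rightarrow> real) \<Rightarrow> bool" where
  "transport_solution L T a b f \<phi> \<psi> u \<longleftrightarrow>
     continuous_on ({0..L} \<times> {0..T}) (\<lambda>(x, t). u x t) \<and>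
     (\<forall>x\<in>{0<..L}. \<forall>t\<in>{0<..T}.
        (\<lambda>y. u y t) differentiable (at x within {0..L}) \<and>
        (\<lambda>s. u x s) differentiable (at t within {0..T}) \<and>
        dt T u x t + a x t * dx L u x t + b x t * u x t = f x t) \<and>
     (\<forall>t\<in>{0..T}. u 0 t = \<psi> t) \<and> (\<forall>x\<in>{0..L}. u x 0 = \<phi> x)"

text \<open>
  The \<open>i\<close>-th point (\<open>i \<le> n\<close>, \<open>n\<close> even) of the mesh that splits each of \<open>[0,p]\<close> and \<open>[p,R]\<close>
  into \<open>n/2\<close> equal subintervals.
\<close>

definition pw_mesh :: "real \<Rightarrow> real \<Rightarrow> nat \<Rightarrow> nat \<Rightarrow> real" where
  "pw_mesh p R n i =
     (if i \<le> n div 2 then real i * (2 * p / real n)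
      else p + (real i - real n / 2) * (2 * (R - p) / real n))"

definition mesh_sigma :: "real \<Rightarrow> real \<Rightarrow> nat \<Rightarrow> real" where
  "mesh_sigma L \<epsilon> N = min (L / 2) (\<epsilon> * ln (real N))"

definition mesh_tau :: "real \<Rightarrow> real \<Rightarrow> real \<Rightarrow> nat \<Rightarrow> real" where
  "mesh_tau T C\<^sub>2 \<epsilon> M = min (T / 2) (C\<^sub>2 * \<epsilon> * ln (real M))"

definition mesh_x :: "real \<Rightarrow> real \<Rightarrow> nat \<Rightarrow> nat \<Rightarrow> real" where
  "mesh_x L \<epsilon> N = pw_mesh (L - mesh_sigma L \<epsilon> N) L N"

definition mesh_t :: "real \<Rightarrow> real \<Rightarrow> real \<Rightarrow> nat \<Rightarrow> nat \<Rightarrow> real" where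
  "mesh_t T C\<^sub>2 \<epsilon> M = pw_mesh (mesh_tau T C\<^sub>2 \<epsilon> M) T M"

text \<open>
  Mesh functions are indexed by \<open>(i,j)\<close>, standing for the mesh point \<open>(xs i, ts j)\<close>; the
  operators below are used for \<open>i, j \<ge> 1\<close> only.
\<close>

definition Dx_back :: "(nat \<Rightarrow> real) \<Rightarrow> (nat \<Rightarrow> nat \<Rightarrow> real) \<Rightarrow> nat \<Rightarrow> nat \<Rightarrow> real" where
  "Dx_back xs Y i j = (Y i j - Y (i - 1) j) / (xs i - xs (i - 1))"

definition Dt_back :: "(nat \<Rightarrow> real) \<Rightarrow> (nat \<Rightarrow> nat \<Rightarrow> real) \<Rightarrow> nat \<Rightarrow> nat \<Rightarrow> real" where
  "Dt_back ts Y i j = (Y i j - Y i (j - 1)) / (ts j - ts (j - 1))"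

definition upwind_op ::
  "(real \<Rightarrow> real \<Rightarrow> real) \<Rightarrow> (real \<Rightarrow> real \<Rightarrow> real) \<Rightarrow> (nat \<Rightarrow> real) \<Rightarrow> (nat \<Rightarrow> real) \<Rightarrow>
   (nat \<Rightarrow> nat \<Rightarrow> real) \<Rightarrow> nat \<Rightarrow> nat \<Rightarrow> real" where
  "upwind_op a b xs ts Y i j =
     Dt_back ts Y i j + a (xs i) (ts j) * Dx_back xs Y i j + b (xs i) (ts j) * Y i j"

definition fitted_op ::
  "real \<Rightarrow> real \<Rightarrow> real \<Rightarrow> real \<Rightarrow> (real \<Rightarrow> real \<Rightarrow> real) \<Rightarrow> (real \<Rightarrow> real \<Rightarrow> real) \<Rightarrow> nat \<Rightarrow> nat \<Rightarrow>
   (nat \<Rightarrow> nat \<Rightarrow> real) \<Rightarrow> nat \<Rightarrow> nat \<Rightarrow> real" where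
  "fitted_op L T C\<^sub>2 \<epsilon> a b N M Y i j =
     (let xs = mesh_x L \<epsilon> N; ts = mesh_t T C\<^sub>2 \<epsilon> M; \<sigma> = mesh_sigma L \<epsilon> N;
          H = 2 * (L - \<sigma>) / real N; \<rho> = H / \<epsilon> in
      if xs i \<noteq> L - \<sigma> then upwind_op a b xs ts Y i j
      else upwind_op a b xs ts Y i j
             + a (xs i) (ts j) * (\<rho> / (1 - exp (- \<rho>)) - 1) * Dx_back xs Y i j)"

definition discrete_solution ::
  "real \<Rightarrow> real \<Rightarrow> real \<Rightarrow> real \<Rightarrow> (real \<Rightarrow> real \<Rightarrow> real) \<Rightarrow> (real \<Rightarrow> real \<Rightarrow> real) \<Rightarrow>
   (real \<Rightarrow> real \<Rightarrow> real) \<Rightarrow> (real \<Rightarrow> real \<Rightarrow> real) \<Rightarrow> nat \<Rightarrow> nat \<Rightarrow> (nat \<Rightarrow> nat \<Rightarrow> real) \<Rightarrow> bool" where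
  "discrete_solution L T C\<^sub>2 \<epsilon> a b f u N M U \<longleftrightarrow>
     (let xs = mesh_x L \<epsilon> N; ts = mesh_t T C\<^sub>2 \<epsilon> M in
      (\<forall>i\<in>{1..N}. \<forall>j\<in>{1..M}. fitted_op L T C\<^sub>2 \<epsilon> a b N M U i j = f (xs i) (ts j)) \<and>
      (\<forall>j\<le>M. U 0 j = u 0 (ts j)) \<and>
      (\<forall>i\<le>N. U i 0 = u (xs i) 0))"

definition bilinear_interpolant ::
  "(nat \<Rightarrow> real) \<Rightarrow> (nat \<Rightarrow> real) \<Rightarrow> nat \<Rightarrow> nat \<Rightarrow> (nat \<Rightarrow> nat \<Rightarrow> real) \<Rightarrow> (real \<Rightarrow> real \<Rightarrow> real) \<Rightarrow> bool" where
  "bilinear_interpolant xs ts N M U V \<longleftrightarrow>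
     (\<forall>i\<in>{1..N}. \<forall>j\<in>{1..M}. \<exists>c0 c1 c2 c3. \<forall>x\<in>{xs (i - 1)..xs i}. \<forall>t\<in>{ts (j - 1)..ts j}.
        V x t = c0 + c1 * x + c2 * t + c3 * x * t) \<and>
     (\<forall>i\<le>N. \<forall>j\<le>M. V (xs i) (ts j) = U i j)"

end

theory Submission
  imports Defs
begin


text \<open>
  The numerical solution is compared with \<open>u\<close> through the residual that a piecewise bilinear
  interpolant leaves in the differential equation. The comparison principle for
  \<open>z\<^sub>t + a z\<^sub>x + b z\<close> (\<open>transport_comparison\<close>) asks only for derivatives from the left, so it
  applies to such interpolants in spite of their kinks along the mesh lines, and about \<open>u\<close> it uses
  continuity and the equation at each point. On a mesh cell the residual is controlled by the first
  difference quotients of the mesh function and by the mixed quotient \<open>D\<^sub>x D\<^sub>t\<close>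
  (\<open>bilinear_residual\<close>). For a solution \<open>W\<close> of the upwind scheme with zero data these quotients
  solve upwind schemes themselves, so that the discrete comparison principle bounds them
  (locale \<open>zero_data_scheme\<close>): if the forcing and its difference quotients have the size of a layer
  \<open>e E\<close>, where \<open>e = 1/\<epsilon>\<close> and the weight \<open>E\<close> increases in \<open>x\<close>, then the first quotients are
  \<open>O(e E)\<close> and the mixed one is \<open>O(e\<^sup>2 E)\<close>. When \<open>E\<close> is an exponential with rate \<open>e\<close>, the latter
  improves to \<open>O(e E + e\<^sup>2 E \<Theta>)\<close>, where \<open>\<Theta>\<close> is a discrete version of \<open>exp (-\<beta> e t)\<close>: the
  layer at the outflow boundary is swept in along characteristics that start near \<open>(L,0)\<close>, and this
  leaves an initial layer in time. It is what the fine time mesh resolves: the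
  choice \<open>\<beta> = 1/C\<^sub>2\<close>, admissible because it is below \<open>\<alpha>\<close>, gives \<open>\<Theta> = O(1/M)\<close> beyond \<open>\<tau>\<close> when
  \<open>\<tau> = C\<^sub>2 \<epsilon> ln M\<close>.

  The discrete solution is written as \<open>U = g + Y + D\<close>. The function
  \<open>g(x,t) = \<phi>(x) + \<psi>(t) - \<phi>(0)\<close> takes the boundary and initial values; \<open>Y\<close> solves the upwind
  scheme without fitting factor, with zero data and forcing \<open>-G\<close>, where \<open>G = g\<^sub>t + a g\<^sub>x + b g\<close>.
  Both are free of layers. The remainder \<open>D\<close> carries the forcing \<open>f\<close>, the consistency error of \<open>g\<close>
  and the effect of the fitting factor on \<open>g + Y\<close>.

  Suppose \<open>\<sigma> = \<epsilon> ln N\<close>. To the left of \<open>L - \<sigma>\<close> the layer is negligible on both sides: \<open>D\<close> is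
  \<open>O(1/N + 1/M)\<close> by a barrier in which the fitting factor compensates for the large mesh
  width next to the transition point (\<open>D_coarse\<close>), while \<open>u - g - Y\<close> is bounded by
  \<open>C (1/N + 1/M + exp ((x-L)/\<epsilon>))\<close> (\<open>Y_error\<close>). To the right of \<open>L - \<sigma>\<close>, and on the whole interval if
  \<open>\<sigma> = L/2\<close>, the mesh resolves the layer. There \<open>D\<close> differs by \<open>O(ln N/N + ln M/M)\<close> from the solution
  \<open>W\<close> of the upwind scheme with zero data and forcing \<open>f - f(p,0)\<close>, where \<open>p\<close> is the left end of that
  region (\<open>DW_bound\<close>); subtracting the constant \<open>f(p,0)\<close> makes the forcing vanish at the corner
  \<open>(p,0)\<close>, without which the quotients of \<open>W\<close> would jump. The residual of the interpolant of \<open>W\<close> is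
  \<open>O(ln N/N + ln M/M)\<close> times \<open>exp ((x-L)/\<epsilon>) / \<epsilon>\<close>, plus \<open>|f(p,0)|\<close>, and a barrier built from
  \<open>exp ((x-L)/\<epsilon>)\<close> and a linear function turns this into the rate of the theorem (\<open>YW_error\<close>).
\<close>

section \<open>Upwind schemes and the discrete comparison principle\<close>

text \<open>
  The quotients carry the index of the lower end of the step, so \<open>diff_x xs Y i j\<close> is the backward
  quotient at the point \<open>Suc i\<close>, and \<open>upw\<close> at \<open>(i,j)\<close> is the scheme imposed at the upper right corner
  of the cell \<open>(i,j)\<close>.
\<close>

definition diff_x :: "(nat \<Rightarrow> real) \<Rightarrow> (nat \<Rightarrow> nat \<Rightarrow> real) \<Rightarrow> nat \<Rightarrow> nat \<Rightarrow> real" where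
  "diff_x xs Y i j = (Y (Suc i) j - Y i j) / (xs (Suc i) - xs i)"

definition diff_t :: "(nat \<Rightarrow> real) \<Rightarrow> (nat \<Rightarrow> nat \<Rightarrow> real) \<Rightarrow> nat \<Rightarrow> nat \<Rightarrow> real" where
  "diff_t ts Y i j = (Y i (Suc j) - Y i j) / (ts (Suc j) - ts j)"

definition upw :: "(nat \<Rightarrow> nat \<Rightarrow> real) \<Rightarrow> (nat \<Rightarrow> nat \<Rightarrow> real) \<Rightarrow> (nat \<Rightarrow> real) \<Rightarrow> (nat \<Rightarrow> real) \<Rightarrow>
    (nat \<Rightarrow> nat \<Rightarrow> real) \<Rightarrow> nat \<Rightarrow> nat \<Rightarrow> real" where
  "upw a b xs ts Y i j =
     diff_t ts Y (Suc i) j + a (Suc i) (Suc j) * diff_x xs Y i (Suc j) + b (Suc i) (Suc j) * Y (Suc i) (Suc j)"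

lemma diff_x_diff: "diff_x xs (\<lambda>i j. Y i j - Z i j) i j = diff_x xs Y i j - diff_x xs Z i j"
  by (simp add: diff_x_def diff_divide_distrib)

lemma diff_t_diff: "diff_t ts (\<lambda>i j. Y i j - Z i j) i j = diff_t ts Y i j - diff_t ts Z i j"
  by (simp add: diff_t_def diff_divide_distrib)

lemma upw_diff: "upw a b xs ts (\<lambda>i j. Y i j - Z i j) i j = upw a b xs ts Y i j - upw a b xs ts Z i j"
  by (simp add: upw_def diff_x_diff diff_t_diff algebra_simps)

lemma upw_x_barrier:
  "upw a b xs ts (\<lambda>i j. B i) i j = a (Suc i) (Suc j) * ((B (Suc i) - B i) / (xs (Suc i) - xs i))
     + b (Suc i) (Suc j) * B (Suc i)"
  by (simp add: upw_def diff_t_def diff_x_def)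

lemma diff_x_diff_t_commute: "diff_x xs (diff_t ts Y) i j = diff_t ts (diff_x xs Y) i j"
  by (simp add: diff_x_def diff_t_def diff_divide_distrib[symmetric] algebra_simps)

lemma diff_x_mult: "diff_x xs (\<lambda>i j. Y i j * Z i j) i j = Y (Suc i) j * diff_x xs Z i j + diff_x xs Y i j * Z i j"
proof -
  have "Y (Suc i) j * Z (Suc i) j - Y i j * Z i j
      = Y (Suc i) j * (Z (Suc i) j - Z i j) + (Y (Suc i) j - Y i j) * Z i j"
    by (simp add: algebra_simps)
  then show ?thesis by (simp add: diff_x_def add_divide_distrib)
qed

lemma diff_t_mult: "diff_t ts (\<lambda>i j. Y i j * Z i j) i j = Y i (Suc j) * diff_t ts Z i j + diff_t ts Y i j * Z i j"
proof -
  have "Y i (Suc j) * Z i (Suc j) - Y i j * Z i j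
      = Y i (Suc j) * (Z i (Suc j) - Z i j) + (Y i (Suc j) - Y i j) * Z i j"
    by (simp add: algebra_simps)
  then show ?thesis by (simp add: diff_t_def add_divide_distrib)
qed

lemma diff_x_add: "diff_x xs (\<lambda>i j. Y i j + Z i j) i j = diff_x xs Y i j + diff_x xs Z i j"
  by (simp add: diff_x_def diff_divide_distrib add_divide_distrib)

lemma diff_t_add: "diff_t ts (\<lambda>i j. Y i j + Z i j) i j = diff_t ts Y i j + diff_t ts Z i j"
  by (simp add: diff_t_def diff_divide_distrib add_divide_distrib)

lemma abs_diff_le_add: "\<bar>x\<bar> \<le> u \<Longrightarrow> \<bar>y\<bar> \<le> v \<Longrightarrow> \<bar>x - y\<bar> \<le> u + v" for x y :: real
  by linarith

text \<open>
  Exponentials serve as barriers. Bounding the backward quotient by the value at the earlier point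
  is what makes the Gronwall arguments below free of restrictions on the step sizes.
\<close>

lemma exp_difference_ge:
  fixes x y c :: real
  assumes "x < y" "0 \<le> c"
  shows "c * exp (c * x) \<le> (exp (c * y) - exp (c * x)) / (y - x)"
proof -
  have "exp (c * x) * (1 + c * (y - x)) \<le> exp (c * x) * exp (c * (y - x))"
    by (intro mult_left_mono) (auto simp: exp_ge_add_one_self)
  also have "\<dots> = exp (c * y)" by (simp add: exp_add[symmetric] algebra_simps)
  finally show ?thesis using assms by (simp add: field_simps)
qed

locale upwind_mesh =
  fixes a b :: "nat \<Rightarrow> nat \<Rightarrow> real" and xs ts :: "nat \<Rightarrow> real" and n m :: nat and \<alpha> :: real
  assumes xs_step: "i < n \<Longrightarrow> xs i < xs (Suc i)"
    and ts_step: "j < m \<Longrightarrow> ts j < ts (Suc j)"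
    and alpha_pos: "0 < \<alpha>"
    and a_ge: "i \<le> n \<Longrightarrow> j \<le> m \<Longrightarrow> \<alpha> \<le> a i j"
    and b_ge: "i \<le> n \<Longrightarrow> j \<le> m \<Longrightarrow> 0 \<le> b i j"
begin

text \<open>
  The scheme gives the value at the new corner as a combination, with nonnegative weights, of the two
  neighbouring old values and the right-hand side, so a bound propagates from cell to cell. The premises
  of \<open>L\<close> make the bounds at the old corners available when the right-hand side depends on them.
\<close>

lemma comparison:
  assumes bx: "\<And>j. j \<le> m \<Longrightarrow> \<bar>Y 0 j\<bar> \<le> B 0 j"
    and bt: "\<And>i. i \<le> n \<Longrightarrow> \<bar>Y i 0\<bar> \<le> B i 0"
    and L: "\<And>i j. i < n \<Longrightarrow> j < m \<Longrightarrow> \<bar>Y (Suc i) j\<bar> \<le> B (Suc i) j \<Longrightarrow> \<bar>Y i (Suc j)\<bar> \<le> B i (Suc j)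
           \<Longrightarrow> \<bar>upw a b xs ts Y i j\<bar> \<le> upw a b xs ts B i j"
  shows "i \<le> n \<Longrightarrow> j \<le> m \<Longrightarrow> \<bar>Y i j\<bar> \<le> B i j"
proof (induction i arbitrary: j)
  case 0
  then show ?case using bx by simp
next
  case (Suc i)
  have x: "j \<le> m \<Longrightarrow> \<bar>Y i j\<bar> \<le> B i j" for j using Suc by simp
  show ?case using \<open>j \<le> m\<close>
  proof (induction j)
    case 0
    then show ?case using bt Suc.prems by simp
  next
    case (Suc j)
    have in1: "i < n" "j < m" using Suc.prems \<open>Suc i \<le> n\<close> by auto
    have t: "\<bar>Y (Suc i) j\<bar> \<le> B (Suc i) j" using Suc by simp
    have x': "\<bar>Y i (Suc j)\<bar> \<le> B i (Suc j)" using x Suc.prems by simp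
    define h k aa bb where "h = xs (Suc i) - xs i" and "k = ts (Suc j) - ts j"
      and "aa = a (Suc i) (Suc j)" and "bb = b (Suc i) (Suc j)"
    have h: "h > 0" and k: "k > 0" and aa: "aa > 0" and bb: "bb \<ge> 0"
      using xs_step[OF in1(1)] ts_step[OF in1(2)] a_ge[of "Suc i" "Suc j"] b_ge[of "Suc i" "Suc j"]
        in1 alpha_pos by (auto simp: h_def k_def aa_def bb_def)
    define D where "D = 1 / k + aa / h + bb"
    have D: "D > 0" using h k aa bb by (simp add: D_def add_pos_pos add_pos_nonneg)
    have eq: "D * Z (Suc i) (Suc j) = Z (Suc i) j / k + aa / h * Z i (Suc j) + upw a b xs ts Z i j" for Z
      using h k by (simp add: D_def upw_def diff_x_def diff_t_def h_def[symmetric] k_def[symmetric]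
          aa_def[symmetric] bb_def[symmetric] field_simps)
    have "\<bar>D * Y (Suc i) (Suc j)\<bar> \<le> \<bar>Y (Suc i) j / k\<bar> + \<bar>aa / h * Y i (Suc j)\<bar> + \<bar>upw a b xs ts Y i j\<bar>"
      unfolding eq by linarith
    also have "\<bar>Y (Suc i) j / k\<bar> \<le> B (Suc i) j / k" using t k by (simp add: abs_div_pos[symmetric] divide_right_mono)
    also have "\<bar>aa / h * Y i (Suc j)\<bar> \<le> aa / h * B i (Suc j)"
      using x' h aa by (simp add: abs_mult mult_left_mono divide_right_mono)
    also have "\<bar>upw a b xs ts Y i j\<bar> \<le> upw a b xs ts B i j" by (rule L[OF in1 t x'])
    also have "B (Suc i) j / k + aa / h * B i (Suc j) + upw a b xs ts B i j = D * B (Suc i) (Suc j)"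
      by (rule eq[symmetric])
    finally show ?case using D by (simp add: abs_mult)
  qed
qed

end

section \<open>Difference quotients of upwind solutions with zero data\<close>

text \<open>
  The forcing and its quotients have the size of a layer of width \<open>1/e\<close> with weight \<open>E\<close>. For a
  problem without layers one takes \<open>e = 1\<close> and a constant \<open>E\<close>. The condition \<open>F 0 0 = 0\<close> is a
  compatibility condition: the time quotient of \<open>W\<close> is 0 on the inflow line and starts from \<open>F\<close> on the
  initial line.
\<close>

locale zero_data_scheme = upwind_mesh +
  fixes A X T e :: real and E :: "nat \<Rightarrow> real" and F W :: "nat \<Rightarrow> nat \<Rightarrow> real"
  assumes A_nonneg: "0 \<le> A" and e_ge: "1 \<le> e"
    and xs_range: "i \<le> n \<Longrightarrow> 0 \<le> xs i \<and> xs i \<le> X"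
    and ts_range: "j \<le> m \<Longrightarrow> 0 \<le> ts j \<and> ts j \<le> T"
    and E_pos: "i \<le> n \<Longrightarrow> 0 < E i"
    and E_mono: "i < n \<Longrightarrow> E i \<le> E (Suc i)"
    and b_le: "i \<le> n \<Longrightarrow> j \<le> m \<Longrightarrow> b i j \<le> A"
    and dTa: "i \<le> n \<Longrightarrow> j < m \<Longrightarrow> \<bar>diff_t ts a i j\<bar> \<le> A"
    and dTb: "i \<le> n \<Longrightarrow> j < m \<Longrightarrow> \<bar>diff_t ts b i j\<bar> \<le> A"
    and dXa: "i < n \<Longrightarrow> j \<le> m \<Longrightarrow> \<bar>diff_x xs a i j\<bar> \<le> A"
    and dXb: "i < n \<Longrightarrow> j \<le> m \<Longrightarrow> \<bar>diff_x xs b i j\<bar> \<le> A"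
    and dXTa: "i < n \<Longrightarrow> j < m \<Longrightarrow> \<bar>diff_x xs (diff_t ts a) i j\<bar> \<le> A"
    and dXTb: "i < n \<Longrightarrow> j < m \<Longrightarrow> \<bar>diff_x xs (diff_t ts b) i j\<bar> \<le> A"
    and F_corner: "F 0 0 = 0"
    and F_le: "i \<le> n \<Longrightarrow> j \<le> m \<Longrightarrow> \<bar>F i j\<bar> \<le> e * E i"
    and dTF: "i \<le> n \<Longrightarrow> j < m \<Longrightarrow> \<bar>diff_t ts F i j\<bar> \<le> e * E i"
    and dXF: "i < n \<Longrightarrow> j \<le> m \<Longrightarrow> \<bar>diff_x xs F i j\<bar> \<le> e^2 * E (Suc i)"
    and dXTF: "i < n \<Longrightarrow> j < m \<Longrightarrow> \<bar>diff_x xs (diff_t ts F) i j\<bar> \<le> e^2 * E (Suc i)"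
    and W_inflow: "j \<le> m \<Longrightarrow> W 0 j = 0"
    and W_initial: "i \<le> n \<Longrightarrow> W i 0 = 0"
    and W_scheme: "i < n \<Longrightarrow> j < m \<Longrightarrow> upw a b xs ts W i j = F (Suc i) (Suc j)"

text \<open>
  The constants of the bounds. They depend on the coefficients and on the size of the rectangle,
  not on the mesh, on \<open>e\<close> or on \<open>E\<close>.
\<close>

definition const_P :: "real \<Rightarrow> real \<Rightarrow> real \<Rightarrow> real" where
  "const_P \<alpha> A T = exp ((1 + A / \<alpha> * (1 + A * T) + A * T + A / \<alpha>) * T)"

definition const_Q :: "real \<Rightarrow> real \<Rightarrow> real \<Rightarrow> real" where
  "const_Q \<alpha> A T = (1 + const_P \<alpha> A T + A * T) / \<alpha>"

definition const_R :: "real \<Rightarrow> real \<Rightarrow> real \<Rightarrow> real" where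
  "const_R \<alpha> A T = 1 + A * const_Q \<alpha> A T + A / \<alpha> * (1 + 2 * A * const_Q \<alpha> A T + A * T)
     + A * const_P \<alpha> A T + A * T + A * const_Q \<alpha> A T"

definition const_S0 :: "real \<Rightarrow> real \<Rightarrow> real \<Rightarrow> real" where
  "const_S0 \<alpha> A T = 1 + (1 + A * const_Q \<alpha> A T) / \<alpha>"

definition const_S :: "real \<Rightarrow> real \<Rightarrow> real \<Rightarrow> real \<Rightarrow> real" where
  "const_S \<alpha> A T X = const_S0 \<alpha> A T * exp ((const_R \<alpha> A T + A / \<alpha> + A / \<alpha>) * (X + T))"

definition const_S' :: "real \<Rightarrow> real \<Rightarrow> real \<Rightarrow> real \<Rightarrow> real" where
  "const_S' \<alpha> A T X = const_S0 \<alpha> A T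
     + (const_R \<alpha> A T + (A + A / \<alpha>) * const_S \<alpha> A T X) / \<alpha>"

context zero_data_scheme
begin

text \<open>
  \<open>P\<close>, \<open>Q\<close> and \<open>S\<close> are the quotients \<open>D\<^sub>t W\<close>, \<open>D\<^sub>x W\<close> and \<open>D\<^sub>x D\<^sub>t W\<close>, extended to the inflow and initial
  lines in such a way that the scheme holds there as well. With this extension the differenced
  schemes hold on every cell, the ones at the boundary included, and the boundary values of the quotients
  can be read off from \<open>F\<close>.
\<close>

definition P :: "nat \<Rightarrow> nat \<Rightarrow> real" where
  "P i j = (case j of 0 \<Rightarrow> F i 0 | Suc j' \<Rightarrow> diff_t ts W i j')"

definition Q :: "nat \<Rightarrow> nat \<Rightarrow> real" where
  "Q i j = (F i j - P i j - b i j * W i j) / a i j"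

definition S :: "nat \<Rightarrow> nat \<Rightarrow> real" where
  "S i j = (case i of 0 \<Rightarrow> (case j of 0 \<Rightarrow> 0 | Suc j' \<Rightarrow> diff_t ts Q 0 j') | Suc i' \<Rightarrow> diff_x xs P i' j)"

lemma T_nonneg: "0 \<le> T"
  using ts_range[of 0] by auto

lemma a_pos: "i \<le> n \<Longrightarrow> j \<le> m \<Longrightarrow> 0 < a i j"
  using a_ge[of i j] alpha_pos by simp

lemma scheme_identity: "i \<le> n \<Longrightarrow> j \<le> m \<Longrightarrow> P i j + a i j * Q i j + b i j * W i j = F i j"
  using a_pos[of i j] by (simp add: Q_def)

lemma P_Suc: "P i (Suc j) = diff_t ts W i j"
  by (simp add: P_def)

lemma P_inflow: "j \<le> m \<Longrightarrow> P 0 j = 0"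
  using W_inflow F_corner by (cases j) (auto simp: P_def diff_t_def)

lemma Q_Suc: "i < n \<Longrightarrow> j \<le> m \<Longrightarrow> Q (Suc i) j = diff_x xs W i j"
proof (cases j)
  case 0
  assume "i < n" "j \<le> m"
  then show ?thesis using 0 W_initial by (simp add: Q_def P_def diff_x_def)
next
  case (Suc j')
  assume "i < n" "j \<le> m"
  then show ?thesis using Suc W_scheme[of i j'] a_pos[of "Suc i" j]
    by (simp add: Q_def P_def upw_def field_simps)
qed

lemma S_Suc1: "S (Suc i) j = diff_x xs P i j"
  by (simp add: S_def)

text \<open>
  The two orders of differencing agree also for the extended quotients.
\<close>

lemma S_Suc2: "i \<le> n \<Longrightarrow> j < m \<Longrightarrow> S i (Suc j) = diff_t ts Q i j"
proof (cases i)
  case 0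
  then show ?thesis by (simp add: S_def)
next
  case (Suc i')
  assume "i \<le> n" "j < m"
  then have "diff_t ts Q i j = diff_t ts (diff_x xs W) i' j" using Suc Q_Suc by (simp add: diff_t_def)
  also have "\<dots> = diff_x xs (diff_t ts W) i' j" by (simp add: diff_x_diff_t_commute)
  also have "\<dots> = S i (Suc j)" using Suc by (simp add: S_def diff_x_def P_Suc)
  finally show ?thesis by simp
qed

lemma time_difference_identity:
  assumes "i \<le> n" "j < m"
  shows "diff_t ts P i j + a i (Suc j) * S i (Suc j) + diff_t ts a i j * Q i j
     + b i (Suc j) * P i (Suc j) + diff_t ts b i j * W i j = diff_t ts F i j"
proof -
  have "diff_t ts F i j = diff_t ts (\<lambda>i j. P i j + a i j * Q i j + b i j * W i j) i j"
    unfolding diff_t_def using assms scheme_identity[of i j] scheme_identity[of i "Suc j"] by simp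
  also have "\<dots> = diff_t ts P i j + (a i (Suc j) * diff_t ts Q i j + diff_t ts a i j * Q i j)
     + (b i (Suc j) * diff_t ts W i j + diff_t ts b i j * W i j)"
    by (simp add: diff_t_add diff_t_mult)
  finally show ?thesis using S_Suc2[OF assms] by (simp add: P_Suc)
qed

lemma space_difference_identity:
  assumes "i < n" "j \<le> m"
  shows "S (Suc i) j + a (Suc i) j * diff_x xs Q i j + diff_x xs a i j * Q i j
     + b (Suc i) j * Q (Suc i) j + diff_x xs b i j * W i j = diff_x xs F i j"
proof -
  have "diff_x xs F i j = diff_x xs (\<lambda>i j. P i j + a i j * Q i j + b i j * W i j) i j"
    unfolding diff_x_def using assms scheme_identity[of i j] scheme_identity[of "Suc i" j] by simp
  also have "\<dots> = diff_x xs P i j + (a (Suc i) j * diff_x xs Q i j + diff_x xs a i j * Q i j)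
     + (b (Suc i) j * diff_x xs W i j + diff_x xs b i j * W i j)"
    by (simp add: diff_x_add diff_x_mult)
  finally show ?thesis using Q_Suc[OF assms] by (simp add: S_Suc1)
qed

lemma upw_P:
  assumes "i < n" "j < m"
  shows "upw a b xs ts P i j
    = diff_t ts F (Suc i) j - diff_t ts a (Suc i) j * Q (Suc i) j - diff_t ts b (Suc i) j * W (Suc i) j"
  using time_difference_identity[of "Suc i" j] assms by (simp add: upw_def S_Suc1)

text \<open>
  Differencing the scheme in \<open>t\<close> and then in \<open>x\<close>. The product rule puts the undifferenced factor at the
  earlier index, hence the value of \<open>S\<close> on the right is an old one, which \<open>comparison\<close> permits.
\<close>

lemma upw_S:
  assumes "i < n" "j < m"
  shows "upw a b xs ts S i j = diff_x xs (diff_t ts F) i j - diff_x xs a i (Suc j) * S i (Suc j)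
     - diff_x xs (diff_t ts a) i j * Q (Suc i) j - diff_t ts a i j * diff_x xs Q i j
     - diff_x xs b i (Suc j) * P i (Suc j)
     - diff_x xs (diff_t ts b) i j * W (Suc i) j - diff_t ts b i j * Q (Suc i) j"
proof -
  let ?a = "\<lambda>i j. a i (Suc j)" and ?b = "\<lambda>i j. b i (Suc j)"
  let ?S = "\<lambda>i j. S i (Suc j)" and ?P = "\<lambda>i j. P i (Suc j)"
  have shift: "diff_x xs (\<lambda>i j. Y i (Suc j)) i j = diff_x xs Y i (Suc j)" for Y by (simp add: diff_x_def)
  have "diff_x xs (diff_t ts F) i j = diff_x xs (\<lambda>i j. diff_t ts P i j + ?a i j * ?S i j + Q i j * diff_t ts a i j
     + ?b i j * ?P i j + W i j * diff_t ts b i j) i j"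
    unfolding diff_x_def using assms time_difference_identity[of i j] time_difference_identity[of "Suc i" j] by (simp add: mult.commute)
  also have "\<dots> = diff_x xs (diff_t ts P) i j + (?a (Suc i) j * diff_x xs ?S i j + diff_x xs ?a i j * ?S i j)
      + (Q (Suc i) j * diff_x xs (diff_t ts a) i j + diff_x xs Q i j * diff_t ts a i j)
      + (?b (Suc i) j * diff_x xs ?P i j + diff_x xs ?b i j * ?P i j)
      + (W (Suc i) j * diff_x xs (diff_t ts b) i j + diff_x xs W i j * diff_t ts b i j)"
    by (simp only: diff_x_add diff_x_mult)
  also have "diff_x xs (diff_t ts P) i j = diff_t ts S (Suc i) j"
    by (simp add: diff_x_diff_t_commute) (simp add: diff_t_def S_Suc1)
  finally show ?thesis using Q_Suc[of i j] assms
    by (simp add: upw_def S_Suc1 shift algebra_simps)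
qed

lemma exp_t: "j < m \<Longrightarrow> 0 \<le> c \<Longrightarrow> c * exp (c * ts j) \<le> (exp (c * ts (Suc j)) - exp (c * ts j)) / (ts (Suc j) - ts j)"
  using exp_difference_ge[OF ts_step] by simp

lemma exp_x: "i < n \<Longrightarrow> 0 \<le> c \<Longrightarrow> c * exp (c * xs i) \<le> (exp (c * xs (Suc i)) - exp (c * xs i)) / (xs (Suc i) - xs i)"
  using exp_difference_ge[OF xs_step] by simp

text \<open>
  The barrier is \<open>t\<close> times the bound of the forcing.
\<close>

lemma W_bound: assumes "i \<le> n" "j \<le> m" shows "\<bar>W i j\<bar> \<le> T * (e * E i)"
proof -
  have "\<bar>W i j\<bar> \<le> ts j * (e * E i)"
  proof (rule comparison[where B="\<lambda>i j. ts j * (e * E i)"])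
    fix j assume "j \<le> m"
    then show "\<bar>W 0 j\<bar> \<le> ts j * (e * E 0)"
      using W_inflow ts_range[of j] e_ge E_pos[of 0] by simp
  next
    fix i assume "i \<le> n"
    then show "\<bar>W i 0\<bar> \<le> ts 0 * (e * E i)"
      using W_initial ts_range[of 0] e_ge E_pos[of i] by simp
  next
    fix i j assume ij: "i < n" "j < m"
    let ?B = "\<lambda>i j. ts j * (e * E i)"
    have "diff_t ts ?B (Suc i) j = e * E (Suc i)"
      using ts_step[OF ij(2)] by (simp add: diff_t_def field_simps)
    moreover have "0 \<le> diff_x xs ?B i (Suc j)"
      using ts_range[of "Suc j"] ij e_ge E_mono[of i] xs_step[of i]
      unfolding diff_x_def by (intro divide_nonneg_pos) (auto intro!: mult_left_mono)
    moreover have "0 \<le> ?B (Suc i) (Suc j)"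
      using ts_range[of "Suc j"] ij e_ge E_pos[of "Suc i"] by simp
    ultimately have "e * E (Suc i) \<le> upw a b xs ts ?B i j"
      unfolding upw_def using a_pos[of "Suc i" "Suc j"] b_ge[of "Suc i" "Suc j"] ij by simp
    then show "\<bar>upw a b xs ts W i j\<bar> \<le> upw a b xs ts ?B i j"
      using W_scheme[OF ij] F_le[of "Suc i" "Suc j"] ij by simp
  qed (use assms in auto)
  also have "\<dots> \<le> T * (e * E i)"
    using ts_range[of j] assms e_ge E_pos[of i] by (intro mult_right_mono) auto
  finally show ?thesis .
qed

lemma Q_le_P:
  assumes "i \<le> n" "j \<le> m"
  shows "\<bar>Q i j\<bar> \<le> ((1 + A * T) * (e * E i) + \<bar>P i j\<bar>) / \<alpha>"
proof -
  have eE: "0 \<le> e * E i" using e_ge E_pos[of i] assms by simp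
  have "b i j * \<bar>W i j\<bar> \<le> A * (T * (e * E i))"
    using W_bound[OF assms] b_le[OF assms] b_ge[OF assms] A_nonneg eE T_nonneg
    by (intro mult_mono) auto
  then have "\<bar>F i j - P i j - b i j * W i j\<bar> \<le> (1 + A * T) * (e * E i) + \<bar>P i j\<bar>"
    using F_le[OF assms] b_ge[OF assms] abs_triangle_ineq4[of "F i j - P i j" "b i j * W i j"]
      abs_triangle_ineq4[of "F i j" "P i j"] by (simp add: abs_mult algebra_simps)
  then show ?thesis unfolding Q_def abs_divide
    using a_ge[OF assms] a_pos[OF assms] alpha_pos by (intro frac_le) auto
qed

text \<open>
  The term with \<open>Q\<close> on the right-hand side is an old value of \<open>P\<close> up to known terms, by the scheme;
  a barrier growing exponentially in time absorbs it.
\<close>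

lemma P_bound: assumes "i \<le> n" "j \<le> m" shows "\<bar>P i j\<bar> \<le> const_P \<alpha> A T * (e * E i)"
proof -
  define c1 where "c1 = 1 + A / \<alpha> * (1 + A * T) + A * T"
  define c2 where "c2 = A / \<alpha>"
  define c where "c = c1 + c2"
  have c1: "c1 \<ge> 0" and c2: "c2 \<ge> 0" using A_nonneg alpha_pos T_nonneg by (auto simp: c1_def c2_def)
  have c: "c \<ge> 0" using c1 c2 by (simp add: c_def)
  let ?B = "\<lambda>i j. exp (c * ts j) * (e * E i)"
  have "\<bar>P i j\<bar> \<le> exp (c * ts j) * (e * E i)"
  proof (rule comparison[where B="?B"])
    fix j assume "j \<le> m"
    then show "\<bar>P 0 j\<bar> \<le> ?B 0 j" using P_inflow e_ge E_pos[of 0] by simp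
  next
    fix i assume i: "i \<le> n"
    have "1 * (e * E i) \<le> exp (c * ts 0) * (e * E i)"
      using ts_range[of 0] c e_ge E_pos[of i] i by (intro mult_right_mono) auto
    then show "\<bar>P i 0\<bar> \<le> ?B i 0" using F_le[of i 0] i by (simp add: P_def)
  next
    fix i j assume ij: "i < n" "j < m" and t: "\<bar>P (Suc i) j\<bar> \<le> ?B (Suc i) j"
    let ?e = "e * E (Suc i)"
    have eE: "0 \<le> ?e" using e_ge E_pos[of "Suc i"] ij by simp
    have "c * exp (c * ts j) * ?e \<le> diff_t ts ?B (Suc i) j"
      using mult_right_mono[OF exp_t[OF ij(2) c] eE] by (simp add: diff_t_def left_diff_distrib)
    moreover have "0 \<le> diff_x xs ?B i (Suc j)"
      using ij e_ge E_mono[of i] xs_step[of i]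
      unfolding diff_x_def by (intro divide_nonneg_pos) (auto intro!: mult_left_mono)
    ultimately have LB: "c * exp (c * ts j) * ?e \<le> upw a b xs ts ?B i j"
      unfolding upw_def using a_pos[of "Suc i" "Suc j"] b_ge[of "Suc i" "Suc j"] ij eE
      by (smt (verit) Suc_leI exp_ge_zero mult_nonneg_nonneg)
    have ex1: "1 \<le> exp (c * ts j)" using c ts_range[of j] ij by simp
    have "\<bar>diff_t ts a (Suc i) j * Q (Suc i) j\<bar> \<le> A * (((1 + A * T) * ?e + \<bar>P (Suc i) j\<bar>) / \<alpha>)"
      unfolding abs_mult using dTa[of "Suc i" j] Q_le_P[of "Suc i" j] ij A_nonneg
      by (intro mult_mono) auto
    also have "\<dots> \<le> A * (((1 + A * T) * ?e + ?B (Suc i) j) / \<alpha>)"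
      using t A_nonneg alpha_pos by (intro mult_left_mono divide_right_mono) auto
    finally have 1: "\<bar>diff_t ts a (Suc i) j * Q (Suc i) j\<bar> \<le> A / \<alpha> * (1 + A * T) * ?e + c2 * ?B (Suc i) j"
      by (simp add: c2_def ring_distribs add_divide_distrib)
    have 2: "\<bar>diff_t ts b (Suc i) j * W (Suc i) j\<bar> \<le> A * (T * ?e)"
      unfolding abs_mult using dTb[of "Suc i" j] W_bound[of "Suc i" j] ij A_nonneg
      by (intro mult_mono) auto
    have "\<bar>upw a b xs ts P i j\<bar> \<le> ?e + (A / \<alpha> * (1 + A * T) * ?e + c2 * ?B (Suc i) j) + A * (T * ?e)"
      unfolding upw_P[OF ij] using 1 2 dTF[of "Suc i" j] ij by simp
    also have "\<dots> = c1 * ?e + c2 * ?B (Suc i) j" by (simp add: c1_def algebra_simps)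
    also have "c1 * ?e \<le> c1 * ?B (Suc i) j"
      using mult_right_mono[OF ex1 eE] c1 by (intro mult_left_mono) auto
    also have "c1 * ?B (Suc i) j + c2 * ?B (Suc i) j = c * exp (c * ts j) * ?e"
      by (simp add: c_def algebra_simps)
    also note LB
    finally show "\<bar>upw a b xs ts P i j\<bar> \<le> upw a b xs ts ?B i j" by simp
  qed (use assms in auto)
  also have "\<dots> \<le> exp (c * T) * (e * E i)"
    using ts_range[of j] assms e_ge E_pos[of i] c
    by (intro mult_right_mono) (auto intro!: mult_left_mono)
  finally show ?thesis by (simp add: const_P_def c_def c1_def c2_def)
qed

lemma Q_bound: assumes "i \<le> n" "j \<le> m" shows "\<bar>Q i j\<bar> \<le> const_Q \<alpha> A T * (e * E i)"
proof -
  have "\<bar>Q i j\<bar> \<le> ((1 + A * T) * (e * E i) + const_P \<alpha> A T * (e * E i)) / \<alpha>"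
    using Q_le_P[OF assms] P_bound[OF assms] alpha_pos
    by (smt (verit) divide_right_mono)
  then show ?thesis by (simp add: const_Q_def algebra_simps)
qed

lemma const_nonneg: "0 \<le> const_P \<alpha> A T" "0 \<le> const_Q \<alpha> A T" "1 \<le> const_R \<alpha> A T" "1 \<le> const_S0 \<alpha> A T"
  "0 \<le> const_S \<alpha> A T X"
proof -
  show 1: "0 \<le> const_P \<alpha> A T" by (simp add: const_P_def)
  then show 2: "0 \<le> const_Q \<alpha> A T" using A_nonneg alpha_pos T_nonneg by (simp add: const_Q_def)
  show "1 \<le> const_R \<alpha> A T" using 1 2 A_nonneg alpha_pos T_nonneg
    by (simp add: const_R_def)
  show 3: "1 \<le> const_S0 \<alpha> A T" using 2 A_nonneg alpha_pos by (simp add: const_S0_def)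
  show "0 \<le> const_S \<alpha> A T X" using 3 by (simp add: const_S_def)
qed

lemma S_inflow: assumes "j \<le> m" shows "\<bar>S 0 j\<bar> \<le> const_S0 \<alpha> A T * (e * E 0)"
proof (cases j)
  case 0
  then show ?thesis using const_nonneg(4) e_ge E_pos[of 0] by (simp add: S_def)
next
  case (Suc j')
  then have j': "j' < m" using assms by simp
  have eE: "0 \<le> e * E 0" using e_ge E_pos[of 0] by simp
  have "a 0 (Suc j') * S 0 (Suc j') = diff_t ts F 0 j' - diff_t ts a 0 j' * Q 0 j'"
    using time_difference_identity[of 0 j'] j' P_inflow W_inflow[of j'] by (simp add: diff_t_def)
  moreover have "\<bar>diff_t ts a 0 j' * Q 0 j'\<bar> \<le> A * (const_Q \<alpha> A T * (e * E 0))"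
    unfolding abs_mult using dTa[of 0 j'] Q_bound[of 0 j'] j' A_nonneg by (intro mult_mono) auto
  ultimately have "\<bar>a 0 (Suc j') * S 0 (Suc j')\<bar> \<le> (1 + A * const_Q \<alpha> A T) * (e * E 0)"
    using dTF[of 0 j'] j' by (simp add: algebra_simps)
  moreover have "\<alpha> * \<bar>S 0 j\<bar> \<le> \<bar>a 0 (Suc j') * S 0 (Suc j')\<bar>"
    unfolding abs_mult Suc using a_ge[of 0 "Suc j'"] j' alpha_pos by (intro mult_right_mono) auto
  ultimately have "\<bar>S 0 j\<bar> \<le> (1 + A * const_Q \<alpha> A T) * (e * E 0) / \<alpha>"
    using alpha_pos by (simp add: field_simps)
  then show ?thesis using eE by (simp add: const_S0_def algebra_simps)
qed

lemma e_square: "c * (e * E') \<le> c * (e^2 * E')" if "0 \<le> c" "0 \<le> E'"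
  using that e_ge by (intro mult_left_mono mult_right_mono) (auto simp: power2_eq_square)

text \<open>
  The quotient \<open>D\<^sub>x Q\<close>, a pure second difference of \<open>W\<close>, is eliminated by the scheme differenced in
  \<open>x\<close>; this produces one more old value of \<open>S\<close>.
\<close>

lemma LS_bound:
  assumes "i < n" "j < m"
  shows "\<bar>upw a b xs ts S i j\<bar> \<le> const_R \<alpha> A T * (e^2 * E (Suc i))
    + A * \<bar>S i (Suc j)\<bar> + A / \<alpha> * \<bar>S (Suc i) j\<bar>"
proof -
  let ?K = "const_Q \<alpha> A T" and ?KP = "const_P \<alpha> A T"
  let ?e = "e^2 * E (Suc i)"
  have E0: "0 \<le> E (Suc i)" "0 \<le> E i" using E_pos[of "Suc i"] E_pos[of i] assms by auto
  have le_i: "e * E i \<le> e * E (Suc i)" using E_mono[of i] assms e_ge by simp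
  note K = const_nonneg
  have q: "\<bar>Q (Suc i) j\<bar> \<le> ?K * ?e"
    using Q_bound[of "Suc i" j] e_square[OF K(2) E0(1)] assms by simp
  have q': "\<bar>Q i j\<bar> \<le> ?K * ?e"
    using Q_bound[of i j] mult_left_mono[OF le_i K(2)] e_square[OF K(2) E0(1)] assms by simp
  have p: "\<bar>P i (Suc j)\<bar> \<le> ?KP * ?e"
    using P_bound[of i "Suc j"] mult_left_mono[OF le_i K(1)] e_square[OF K(1) E0(1)] assms by simp
  have w: "\<bar>W (Suc i) j\<bar> \<le> T * ?e"
    using W_bound[of "Suc i" j] e_square[OF T_nonneg E0(1)] assms by simp
  have w': "\<bar>W i j\<bar> \<le> T * ?e"
    using W_bound[of i j] mult_left_mono[OF le_i T_nonneg] e_square[OF T_nonneg E0(1)] assms by simp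
  have m: "\<bar>c * y\<bar> \<le> A * z" if "\<bar>c\<bar> \<le> A" "\<bar>y\<bar> \<le> z" for c y z
    unfolding abs_mult using that A_nonneg by (intro mult_mono) auto
  have "a (Suc i) j * diff_x xs Q i j = diff_x xs F i j - S (Suc i) j - diff_x xs a i j * Q i j
     - b (Suc i) j * Q (Suc i) j - diff_x xs b i j * W i j"
    using space_difference_identity[of i j] assms by simp
  moreover have "\<bar>diff_x xs a i j * Q i j\<bar> \<le> A * (?K * ?e)" using m[OF dXa q'] assms by simp
  moreover have "\<bar>b (Suc i) j * Q (Suc i) j\<bar> \<le> A * (?K * ?e)"
    using m[OF _ q, of "b (Suc i) j"] b_ge[of "Suc i" j] b_le[of "Suc i" j] assms by simp
  moreover have "\<bar>diff_x xs b i j * W i j\<bar> \<le> A * (T * ?e)" using m[OF dXb w'] assms by simp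
  ultimately have "\<bar>a (Suc i) j * diff_x xs Q i j\<bar> \<le> (1 + 2 * A * ?K + A * T) * ?e + \<bar>S (Suc i) j\<bar>"
    using dXF[of i j] assms by (simp add: algebra_simps)
  moreover have "\<alpha> * \<bar>diff_x xs Q i j\<bar> \<le> \<bar>a (Suc i) j * diff_x xs Q i j\<bar>"
    unfolding abs_mult using a_ge[of "Suc i" j] assms by (intro mult_right_mono) auto
  ultimately have dq: "\<bar>diff_x xs Q i j\<bar> \<le> ((1 + 2 * A * ?K + A * T) * ?e + \<bar>S (Suc i) j\<bar>) / \<alpha>"
    using alpha_pos by (simp add: field_simps)
  have "\<bar>upw a b xs ts S i j\<bar> \<le> ?e + A * \<bar>S i (Suc j)\<bar> + A * (?K * ?e)
      + A * (((1 + 2 * A * ?K + A * T) * ?e + \<bar>S (Suc i) j\<bar>) / \<alpha>)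
      + A * (?KP * ?e) + A * (T * ?e) + A * (?K * ?e)"
    unfolding upw_S[OF assms]
    by (intro abs_diff_le_add dXTF m[OF dXa order_refl] m[OF dXTa q] m[OF dTa dq] m[OF dXb p]
        m[OF dXTb w] m[OF dTb q]) (use assms in auto)
  also have "\<dots> = const_R \<alpha> A T * ?e + A * \<bar>S i (Suc j)\<bar> + A / \<alpha> * \<bar>S (Suc i) j\<bar>"
    using alpha_pos by (simp add: const_R_def field_simps)
  finally show ?thesis .
qed

lemma S_initial: assumes "i \<le> n" shows "\<bar>S i 0\<bar> \<le> e^2 * E i"
proof (cases i)
  case 0
  then show ?thesis using E_pos[of 0] by (simp add: S_def)
next
  case (Suc i')
  then show ?thesis using dXF[of i' 0] assms by (simp add: S_Suc1 P_def diff_x_def)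
qed

text \<open>
  The old values of \<open>S\<close> lie at \<open>(Suc i, j)\<close> and at \<open>(i, Suc j)\<close>, so the barrier grows in both
  directions; \<open>c\<close> is chosen so that its growth dominates both terms of \<open>LS_bound\<close>.
\<close>

lemma S_bound: assumes "i \<le> n" "j \<le> m" shows "\<bar>S i j\<bar> \<le> const_S \<alpha> A T X * (e^2 * E i)"
proof -
  define R where "R = const_R \<alpha> A T"
  define c where "c = R + A / \<alpha> + A / \<alpha>"
  define K where "K = const_S0 \<alpha> A T"
  note cn = const_nonneg
  have R1: "R \<ge> 1" and K1: "K \<ge> 1" using cn by (auto simp: R_def K_def)
  have c: "c \<ge> 0" using R1 A_nonneg alpha_pos by (simp add: c_def)
  let ?B = "\<lambda>i j. K * (exp (c * xs i) * exp (c * ts j) * (e^2 * E i))"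
  have exi: "1 \<le> exp (c * xs i)" if "i \<le> n" for i using c xs_range[of i] that by simp
  have exj: "1 \<le> exp (c * ts j)" if "j \<le> m" for j using c ts_range[of j] that by simp
  have ex: "1 \<le> exp (c * xs i) * exp (c * ts j)" if "i \<le> n" "j \<le> m" for i j
    using mult_mono[OF exi[OF that(1)] exj[OF that(2)]] by simp
  have Bge: "K * (e^2 * E i) \<le> ?B i j" if "i \<le> n" "j \<le> m" for i j
    using mult_right_mono[OF ex[OF that], of "e^2 * E i"] K1 E_pos[OF that(1)] by simp
  have "\<bar>S i j\<bar> \<le> ?B i j"
  proof (rule comparison[where B="?B"])
    fix j assume j: "j \<le> m"
    have "K * (e * E 0) \<le> K * (e^2 * E 0)" using e_square[of K "E 0"] K1 E_pos[of 0] by simp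
    then show "\<bar>S 0 j\<bar> \<le> ?B 0 j" using S_inflow[OF j] Bge[of 0 j] j K_def by simp
  next
    fix i assume i: "i \<le> n"
    have "1 * (e^2 * E i) \<le> K * (e^2 * E i)" using K1 E_pos[OF i] by (intro mult_right_mono) auto
    then show "\<bar>S i 0\<bar> \<le> ?B i 0" using S_initial[OF i] Bge[of i 0] i by simp
  next
    fix i j assume ij: "i < n" "j < m" and t: "\<bar>S (Suc i) j\<bar> \<le> ?B (Suc i) j"
      and x: "\<bar>S i (Suc j)\<bar> \<le> ?B i (Suc j)"
    let ?e = "e^2 * E (Suc i)"
    have E0: "0 < E (Suc i)" "0 < E i" using E_pos[of "Suc i"] E_pos[of i] ij by auto
    have eE: "0 \<le> ?e" using E0 by simp
    have Em: "e^2 * E i \<le> ?e" using E_mono[of i] ij by (intro mult_left_mono) auto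
    have "c * ?B (Suc i) j = K * exp (c * xs (Suc i)) * ?e * (c * exp (c * ts j))" by simp
    also have "\<dots> \<le> K * exp (c * xs (Suc i)) * ?e * ((exp (c * ts (Suc j)) - exp (c * ts j)) / (ts (Suc j) - ts j))"
      using exp_t[OF ij(2) c] K1 eE by (intro mult_left_mono) auto
    also have "\<dots> = diff_t ts ?B (Suc i) j" by (simp add: diff_t_def algebra_simps)
    finally have d1: "c * ?B (Suc i) j \<le> diff_t ts ?B (Suc i) j" .
    have "c * ?B i (Suc j) \<le> K * exp (c * ts (Suc j)) * ?e * (c * exp (c * xs i))"
      using mult_left_mono[OF Em, of "c * K * exp (c * ts (Suc j)) * exp (c * xs i)"] c K1
      by (simp add: mult_ac)
    also have "\<dots> \<le> K * exp (c * ts (Suc j)) * ?e * ((exp (c * xs (Suc i)) - exp (c * xs i)) / (xs (Suc i) - xs i))"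
      using exp_x[OF ij(1) c] K1 eE by (intro mult_left_mono) auto
    also have "\<dots> = (?B (Suc i) (Suc j) - K * exp (c * ts (Suc j)) * exp (c * xs i) * ?e) / (xs (Suc i) - xs i)"
      by (simp add: algebra_simps)
    also have "\<dots> \<le> diff_x xs ?B i (Suc j)"
      unfolding diff_x_def using xs_step[OF ij(1)]
        mult_left_mono[OF Em, of "K * exp (c * ts (Suc j)) * exp (c * xs i)"] K1
      by (intro divide_right_mono) (auto simp: mult_ac)
    finally have d2: "c * ?B i (Suc j) \<le> diff_x xs ?B i (Suc j)" .
    have B0: "0 \<le> ?B i (Suc j)" "0 \<le> ?B (Suc i) j" "0 \<le> ?B (Suc i) (Suc j)" using K1 E0 by auto
    have "\<alpha> * (c * ?B i (Suc j)) \<le> a (Suc i) (Suc j) * diff_x xs ?B i (Suc j)"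
      using d2 a_ge[of "Suc i" "Suc j"] ij alpha_pos c B0 by (intro mult_mono) auto
    moreover have "0 \<le> b (Suc i) (Suc j) * ?B (Suc i) (Suc j)"
      using mult_nonneg_nonneg[OF b_ge[of "Suc i" "Suc j"] B0(3)] ij by simp
    ultimately have LB: "c * ?B (Suc i) j + \<alpha> * (c * ?B i (Suc j)) \<le> upw a b xs ts ?B i j"
      unfolding upw_def using d1 by linarith
    have "R * ?e \<le> R * ?B (Suc i) j"
    proof (intro mult_left_mono)
      show "?e \<le> ?B (Suc i) j"
        using Bge[of "Suc i" j] mult_right_mono[OF K1 eE] ij by simp
    qed (use R1 in auto)
    moreover have "A * \<bar>S i (Suc j)\<bar> \<le> A * ?B i (Suc j)" using x A_nonneg by (rule mult_left_mono)
    moreover have "A / \<alpha> * \<bar>S (Suc i) j\<bar> \<le> A / \<alpha> * ?B (Suc i) j"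
      using t A_nonneg alpha_pos by (intro mult_left_mono) auto
    moreover have "R * ?B (Suc i) j + A / \<alpha> * ?B (Suc i) j \<le> c * ?B (Suc i) j"
    proof -
      have "R + A / \<alpha> \<le> c" using divide_nonneg_pos[OF A_nonneg alpha_pos] unfolding c_def by linarith
      then show ?thesis unfolding distrib_right[symmetric] using B0(2) by (rule mult_right_mono)
    qed
    moreover have "A * ?B i (Suc j) \<le> \<alpha> * (c * ?B i (Suc j))"
    proof -
      have "A \<le> \<alpha> * c" using A_nonneg alpha_pos R1 by (simp add: c_def algebra_simps)
      then show ?thesis using mult_right_mono[OF _ B0(1), of A "\<alpha> * c"] by (simp add: mult_ac)
    qed
    ultimately show "\<bar>upw a b xs ts S i j\<bar> \<le> upw a b xs ts ?B i j"
      using LS_bound[OF ij] LB unfolding R_def[symmetric] by linarith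
  qed (use assms in auto)
  also have "\<dots> \<le> K * (exp (c * (X + T)) * (e^2 * E i))"
  proof (intro mult_left_mono mult_right_mono)
    show "exp (c * xs i) * exp (c * ts j) \<le> exp (c * (X + T))"
      unfolding exp_add[symmetric] using xs_range[of i] ts_range[of j] assms c
      by (simp add: distrib_left[symmetric] mult_left_mono)
  qed (use K1 E_pos[of i] assms in auto)
  finally show ?thesis by (simp add: const_S_def K_def c_def R_def mult_ac)
qed

text \<open>
  A weight \<open>E\<close> that grows like a layer gains a factor \<open>e\<close>: the operator applied to \<open>e E\<close> is of
  order \<open>e\<^sup>2 E\<close>, the size of the right-hand side once \<open>S_bound\<close> is known. The initial values, which are
  of order \<open>e\<^sup>2 E\<close>, are carried by \<open>e\<^sup>2 E \<Theta>\<close>, for which the growth in \<open>x\<close> outweighs the decay in \<open>t\<close>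
  since \<open>\<beta> \<le> \<alpha>\<close>.
\<close>

lemma S_bound_layer:
  fixes \<Theta> :: "nat \<Rightarrow> real" and \<beta> :: real
  assumes E_layer: "\<And>i. i < n \<Longrightarrow> e * E (Suc i) \<le> (E (Suc i) - E i) / (xs (Suc i) - xs i)"
    and Th0: "\<Theta> 0 = 1" and Th_pos: "\<And>j. j \<le> m \<Longrightarrow> 0 \<le> \<Theta> j" and be: "\<beta> \<le> \<alpha>"
    and Th: "\<And>j. j < m \<Longrightarrow> (\<Theta> (Suc j) - \<Theta> j) / (ts (Suc j) - ts j) = - \<beta> * e * \<Theta> (Suc j)"
    and "i \<le> n" "j \<le> m"
  shows "\<bar>S i j\<bar> \<le> const_S' \<alpha> A T X * (e * E i + e^2 * E i * \<Theta> j)"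
proof -
  define R where "R = const_R \<alpha> A T + (A + A / \<alpha>) * const_S \<alpha> A T X"
  define K where "K = const_S' \<alpha> A T X"
  note cn = const_nonneg
  have R0: "0 \<le> R" using cn A_nonneg alpha_pos by (simp add: R_def)
  have K_eq: "K = const_S0 \<alpha> A T + R / \<alpha>" by (simp add: K_def const_S'_def R_def)
  have K1: "const_S0 \<alpha> A T \<le> K" using R0 alpha_pos by (simp add: K_eq)
  have K1': "1 \<le> K" using K1 cn by simp
  have KR: "R \<le> \<alpha> * K" using cn(4) alpha_pos by (simp add: K_eq field_simps)
  let ?B = "\<lambda>i j. K * (e * E i + e^2 * E i * \<Theta> j)"
  show ?thesis unfolding K_def[symmetric]
  proof (rule comparison[where B="?B"])
    fix j assume j: "j \<le> m"
    have "const_S0 \<alpha> A T * (e * E 0) \<le> K * (e * E 0)"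
      using K1 e_ge E_pos[of 0] by (intro mult_right_mono) auto
    also have "\<dots> \<le> ?B 0 j" using K1' E_pos[of 0] Th_pos[OF j] by (intro mult_left_mono) auto
    finally show "\<bar>S 0 j\<bar> \<le> ?B 0 j" using S_inflow[OF j] by simp
  next
    fix i assume i: "i \<le> n"
    have "1 * (e^2 * E i) \<le> K * (e * E i + e^2 * E i * \<Theta> 0)"
      using K1' e_ge E_pos[OF i] by (intro mult_mono) (auto simp: Th0)
    then show "\<bar>S i 0\<bar> \<le> ?B i 0" using S_initial[OF i] by simp
  next
    fix i j assume ij: "i < n" "j < m"
    let ?e = "e^2 * E (Suc i)"
    let ?a = "a (Suc i) (Suc j)"
    have E0: "0 < E (Suc i)" "0 < E i" using E_pos[of "Suc i"] E_pos[of i] ij by auto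
    have e0: "0 < e" using e_ge by simp
    have ThS: "0 \<le> \<Theta> (Suc j)" using Th_pos ij by simp
    have Em: "e^2 * E i \<le> ?e" using E_mono[of i] ij by (intro mult_left_mono) auto
    have LS: "\<bar>upw a b xs ts S i j\<bar> \<le> R * ?e"
    proof -
      have "A * \<bar>S i (Suc j)\<bar> \<le> A * (const_S \<alpha> A T X * ?e)"
        using S_bound[of i "Suc j"] mult_left_mono[OF Em cn(5)] ij A_nonneg
        by (intro mult_left_mono) auto
      moreover have "A / \<alpha> * \<bar>S (Suc i) j\<bar> \<le> A / \<alpha> * (const_S \<alpha> A T X * ?e)"
        using S_bound[of "Suc i" j] ij A_nonneg alpha_pos by (intro mult_left_mono) auto
      ultimately show ?thesis using LS_bound[OF ij] by (simp add: R_def algebra_simps)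
    qed
    have "diff_t ts ?B (Suc i) j = K * ?e * ((\<Theta> (Suc j) - \<Theta> j) / (ts (Suc j) - ts j))"
      by (simp add: diff_t_def algebra_simps)
    also have "\<dots> = - (\<beta> * (K * e * ?e * \<Theta> (Suc j)))" unfolding Th[OF ij(2)] by simp
    also have "\<dots> \<ge> - (?a * (K * e * ?e * \<Theta> (Suc j)))"
      using be a_ge[of "Suc i" "Suc j"] ij K1' e0 E0 ThS
      by (simp add: mult_right_mono)
    finally have d1: "- (?a * (K * e * ?e * \<Theta> (Suc j))) \<le> diff_t ts ?B (Suc i) j" .
    have "K * (e + e^2 * \<Theta> (Suc j)) * (e * E (Suc i))
      \<le> K * (e + e^2 * \<Theta> (Suc j)) * ((E (Suc i) - E i) / (xs (Suc i) - xs i))"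
      using E_layer[OF ij(1)] K1' e0 ThS by (intro mult_left_mono) auto
    also have "\<dots> = diff_x xs ?B i (Suc j)"
      unfolding diff_x_def times_divide_eq_right by (rule arg_cong2[where f="(/)"]) (auto simp: algebra_simps)
    finally have d2: "K * (e + e^2 * \<Theta> (Suc j)) * (e * E (Suc i)) \<le> diff_x xs ?B i (Suc j)" .
    have a0: "0 < ?a" using a_pos[of "Suc i" "Suc j"] ij by simp
    have "?a * (K * ?e) + ?a * (K * e * ?e * \<Theta> (Suc j))
       = ?a * (K * (e + e^2 * \<Theta> (Suc j)) * (e * E (Suc i)))"
      by (simp add: power2_eq_square algebra_simps)
    also have "\<dots> \<le> ?a * diff_x xs ?B i (Suc j)" using d2 a0 by (intro mult_left_mono) auto
    finally have d3: "?a * (K * ?e) + ?a * (K * e * ?e * \<Theta> (Suc j)) \<le> ?a * diff_x xs ?B i (Suc j)" .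
    have d4: "0 \<le> b (Suc i) (Suc j) * ?B (Suc i) (Suc j)"
      using b_ge[of "Suc i" "Suc j"] ij K1' e0 E0 ThS by (intro mult_nonneg_nonneg) auto
    have "R * ?e \<le> \<alpha> * K * ?e" using KR E0 by (intro mult_right_mono) auto
    also have "\<dots> \<le> ?a * (K * ?e)"
      using a_ge[of "Suc i" "Suc j"] ij K1' E0 by (simp add: mult.assoc mult_right_mono)
    finally show "\<bar>upw a b xs ts S i j\<bar> \<le> upw a b xs ts ?B i j"
      using LS d1 d3 d4 unfolding upw_def by linarith
  qed (use assms in auto)
qed

lemma diff_x_W_bound: "i < n \<Longrightarrow> j \<le> m \<Longrightarrow> \<bar>diff_x xs W i j\<bar> \<le> const_Q \<alpha> A T * (e * E (Suc i))"
  using Q_bound[of "Suc i" j] Q_Suc[of i j] by simp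

lemma diff_t_W_bound: "i \<le> n \<Longrightarrow> j < m \<Longrightarrow> \<bar>diff_t ts W i j\<bar> \<le> const_P \<alpha> A T * (e * E i)"
  using P_bound[of i "Suc j"] by (simp add: P_Suc)

lemma diff_x_diff_t_W: "diff_x xs (diff_t ts W) i j = S (Suc i) (Suc j)"
  by (simp add: S_Suc1 diff_x_def P_Suc)

end


section \<open>Lipschitz bounds from smoothness on the rectangle\<close>

lemma has_derivative_deriv_on:
  assumes "g differentiable (at x within S)"
  shows "(g has_real_derivative deriv_on S g x) (at x within S)"
  using assms vector_derivative_works[of g "at x within S"]
  by (simp add: deriv_on_def has_real_derivative_iff_has_vector_derivative)

lemma lipschitz_of_deriv_on:
  assumes d: "\<And>y. y \<in> {p..q} \<Longrightarrow> g differentiable (at y within S)" and S: "{p..q} \<subseteq> S"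
    and B: "\<And>y. y \<in> {p..q} \<Longrightarrow> \<bar>deriv_on S g y\<bar> \<le> B" and "x \<in> {p..q}" "y \<in> {p..q}"
  shows "\<bar>g x - g y\<bar> \<le> B * \<bar>x - y\<bar>"
proof -
  have "norm (g x - g y) \<le> B * norm (x - y)"
  proof (rule field_differentiable_bound[where S="{p..q}" and f'="deriv_on S g"])
    fix z assume "z \<in> {p..q}"
    then show "(g has_real_derivative deriv_on S g z) (at z within {p..q})"
      using has_derivative_deriv_on[OF d] S by (blast intro: has_field_derivative_subset)
  qed (use assms in auto)
  then show ?thesis by simp
qed

text \<open>
  What the discrete estimates need to know about a smooth function on the rectangle. Unlike bounds on
  derivatives, these conditions pass to sums and products by algebra alone.
\<close>

definition mixed_lipschitz :: "real \<Rightarrow> real \<Rightarrow> real \<Rightarrow> (real \<Rightarrow> real \<Rightarrow> real) \<Rightarrow> bool" where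
  "mixed_lipschitz L T A g \<longleftrightarrow>
     (\<forall>x\<in>{0..L}. \<forall>x'\<in>{0..L}. \<forall>t\<in>{0..T}. \<forall>t'\<in>{0..T}.
        \<bar>g x t\<bar> \<le> A \<and> \<bar>g x t - g x' t\<bar> \<le> A * \<bar>x - x'\<bar> \<and> \<bar>g x t - g x t'\<bar> \<le> A * \<bar>t - t'\<bar> \<and>
        \<bar>g x t - g x' t - g x t' + g x' t'\<bar> \<le> A * \<bar>x - x'\<bar> * \<bar>t - t'\<bar>)"

lemma Ck_rect_continuous: "Ck_rect k L T g \<Longrightarrow> continuous_on ({0..L} \<times> {0..T}) (\<lambda>(x, t). g x t)"
  by (cases k) auto

lemma Ck_rect_dx_lipschitz:
  assumes g: "Ck_rect (Suc k) L T g" and r: "0 \<le> x" "x \<le> x'" "x' \<le> L" "t \<in> {0..T}"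
    and B: "\<And>y. y \<in> {x..x'} \<Longrightarrow> \<bar>dx L g y t\<bar> \<le> B"
  shows "\<bar>g x' t - g x t\<bar> \<le> B * (x' - x)"
  using lipschitz_of_deriv_on[of x x' "\<lambda>y. g y t" "{0..L}" B x' x] g r B
  by (auto simp: dx_def)

lemma Ck_rect_dt_lipschitz:
  assumes g: "Ck_rect (Suc k) L T g" and r: "x \<in> {0..L}" "t \<in> {0..T}" "t' \<in> {0..T}"
    and B: "\<And>s. s \<in> {0..T} \<Longrightarrow> \<bar>dt T g x s\<bar> \<le> B"
  shows "\<bar>g x t - g x t'\<bar> \<le> B * \<bar>t - t'\<bar>"
  using lipschitz_of_deriv_on[of 0 T "g x" "{0..T}" B t t'] g r B
  by (auto simp: dt_def)

text \<open>
  The time derivative of \<open>s \<mapsto> g x' s - g x s\<close> is an increment in \<open>x\<close> of \<open>g\<^sub>t\<close>, so the mean value theorem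
  applies twice.
\<close>

lemma Ck_rect_mixed_lipschitz:
  assumes g: "Ck_rect 2 L T g" and r: "0 \<le> x" "x \<le> x'" "x' \<le> L" "t \<in> {0..T}" "t' \<in> {0..T}"
    and B: "\<And>y s. y \<in> {x..x'} \<Longrightarrow> s \<in> {0..T} \<Longrightarrow> \<bar>dx L (dt T g) y s\<bar> \<le> B"
  shows "\<bar>g x' t - g x t - g x' t' + g x t'\<bar> \<le> B * (x' - x) * \<bar>t - t'\<bar>"
proof -
  have g1: "Ck_rect (Suc 1) L T g" using g by (simp add: numeral_2_eq_2)
  have gt: "Ck_rect (Suc 0) L T (dt T g)" using g by (simp add: numeral_2_eq_2)
  let ?G = "\<lambda>s. g x' s - g x s"
  have "norm (?G t - ?G t') \<le> B * (x' - x) * norm (t - t')"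
  proof (rule field_differentiable_bound[where S="{0..T}" and f'="\<lambda>s. dt T g x' s - dt T g x s"])
    fix s assume s: "s \<in> {0..T}"
    show "(?G has_real_derivative dt T g x' s - dt T g x s) (at s within {0..T})"
      using g1 r s unfolding dt_def
      by (auto intro!: derivative_intros has_derivative_deriv_on)
    show "norm (dt T g x' s - dt T g x s) \<le> B * (x' - x)"
      using Ck_rect_dx_lipschitz[OF gt r(1-3) s B] s by simp
  qed (use r in auto)
  then show ?thesis by (simp add: algebra_simps)
qed

lemma continuous_rect_bounded:
  assumes "continuous_on ({0..L} \<times> {0..T}) (\<lambda>(x, t). g x (t::real) :: real)"
  obtains B where "\<And>x t. x \<in> {0..L::real} \<Longrightarrow> t \<in> {0..T} \<Longrightarrow> \<bar>g x t\<bar> \<le> B"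
proof -
  have "bounded ((\<lambda>(x, t). g x t) ` ({0..L} \<times> {0..T}))"
    by (intro compact_imp_bounded compact_continuous_image assms compact_Times) auto
  then show thesis using that unfolding bounded_iff by (force simp: image_iff)
qed

lemma mixed_lipschitz_of_Ck_rect:
  assumes g: "Ck_rect 2 L T g"
  obtains A where "0 \<le> A" "mixed_lipschitz L T A g"
proof -
  have g1: "Ck_rect (Suc 1) L T g" using g by (simp add: numeral_2_eq_2)
  have ct: "continuous_on ({0..L} \<times> {0..T}) (\<lambda>(x, t). dt T g x t)"
    and cx: "continuous_on ({0..L} \<times> {0..T}) (\<lambda>(x, t). dx L g x t)"
    and cxt: "continuous_on ({0..L} \<times> {0..T}) (\<lambda>(x, t). dx L (dt T g) x t)"
    using g by (auto simp: numeral_2_eq_2)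
  obtain B1 where B1: "\<And>x t. x \<in> {0..L} \<Longrightarrow> t \<in> {0..T} \<Longrightarrow> \<bar>g x t\<bar> \<le> B1"
    using continuous_rect_bounded[OF Ck_rect_continuous[OF g]] by blast
  obtain B2 where B2: "\<And>x t. x \<in> {0..L} \<Longrightarrow> t \<in> {0..T} \<Longrightarrow> \<bar>dt T g x t\<bar> \<le> B2"
    using continuous_rect_bounded[OF ct] by blast
  obtain B3 where B3: "\<And>x t. x \<in> {0..L} \<Longrightarrow> t \<in> {0..T} \<Longrightarrow> \<bar>dx L g x t\<bar> \<le> B3"
    using continuous_rect_bounded[OF cx] by blast
  obtain B4 where B4: "\<And>x t. x \<in> {0..L} \<Longrightarrow> t \<in> {0..T} \<Longrightarrow> \<bar>dx L (dt T g) x t\<bar> \<le> B4"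
    using continuous_rect_bounded[OF cxt] by blast
  define A where "A = \<bar>B1\<bar> + \<bar>B2\<bar> + \<bar>B3\<bar> + \<bar>B4\<bar>"
  have A: "\<bar>B1\<bar> \<le> A" "\<bar>B2\<bar> \<le> A" "\<bar>B3\<bar> \<le> A" "\<bar>B4\<bar> \<le> A" by (auto simp: A_def)
  have ord: "\<bar>g x' t - g x t\<bar> \<le> A * (x' - x) \<and>
        \<bar>g x' t - g x t - g x' t' + g x t'\<bar> \<le> A * (x' - x) * \<bar>t - t'\<bar>"
    if "0 \<le> x" "x \<le> x'" "x' \<le> L" "t \<in> {0..T}" "t' \<in> {0..T}" for x x' t t'
  proof
    have "\<bar>dx L g y t\<bar> \<le> A" if "y \<in> {x..x'}" for y
      using B3[of y t] A that \<open>0 \<le> x\<close> \<open>x' \<le> L\<close> \<open>t \<in> {0..T}\<close> by auto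
    then show "\<bar>g x' t - g x t\<bar> \<le> A * (x' - x)" using Ck_rect_dx_lipschitz[OF g1] that by blast
    have "\<bar>dx L (dt T g) y s\<bar> \<le> A" if "y \<in> {x..x'}" "s \<in> {0..T}" for y s
      using B4[of y s] A that \<open>0 \<le> x\<close> \<open>x' \<le> L\<close> by auto
    then show "\<bar>g x' t - g x t - g x' t' + g x t'\<bar> \<le> A * (x' - x) * \<bar>t - t'\<bar>"
      using Ck_rect_mixed_lipschitz[OF g] that by blast
  qed
  have "mixed_lipschitz L T A g"
    unfolding mixed_lipschitz_def
  proof (intro ballI conjI)
    fix x x' t t' assume r: "x \<in> {0..L}" "x' \<in> {0..L}" "t \<in> {0..T}" "t' \<in> {0..T}"
    show "\<bar>g x t\<bar> \<le> A" using B1[of x t] A r by auto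
    have "\<bar>dt T g x s\<bar> \<le> A" if "s \<in> {0..T}" for s using B2[of x s] r A that by auto
    then show "\<bar>g x t - g x t'\<bar> \<le> A * \<bar>t - t'\<bar>" using Ck_rect_dt_lipschitz[OF g1] r by blast
    show "\<bar>g x t - g x' t\<bar> \<le> A * \<bar>x - x'\<bar>"
      using ord[of x x' t t] ord[of x' x t t] r by (cases "x \<le> x'") auto
    show "\<bar>g x t - g x' t - g x t' + g x' t'\<bar> \<le> A * \<bar>x - x'\<bar> * \<bar>t - t'\<bar>"
      using ord[of x x' t t'] ord[of x' x t t'] r by (cases "x \<le> x'") auto
  qed
  then show thesis using that A abs_ge_zero order_trans by metis
qed

lemma mixed_lipschitz_mono: "mixed_lipschitz L T A g \<Longrightarrow> A \<le> B \<Longrightarrow> mixed_lipschitz L T B g"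
  unfolding mixed_lipschitz_def
  by (smt (verit, ccfv_SIG) abs_ge_zero mult_right_mono)

lemma mixed_lipschitz_add:
  assumes "mixed_lipschitz L T A g" "mixed_lipschitz L T B h"
  shows "mixed_lipschitz L T (A + B) (\<lambda>x t. g x t + h x t)"
  unfolding mixed_lipschitz_def
proof (intro ballI conjI)
  fix x x' t t' assume "x \<in> {0..L}" "x' \<in> {0..L}" "t \<in> {0..T}" "t' \<in> {0..T}"
  then have g: "\<bar>g x t\<bar> \<le> A" "\<bar>g x t - g x' t\<bar> \<le> A * \<bar>x - x'\<bar>" "\<bar>g x t - g x t'\<bar> \<le> A * \<bar>t - t'\<bar>"
      "\<bar>g x t - g x' t - g x t' + g x' t'\<bar> \<le> A * \<bar>x - x'\<bar> * \<bar>t - t'\<bar>"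
    and h: "\<bar>h x t\<bar> \<le> B" "\<bar>h x t - h x' t\<bar> \<le> B * \<bar>x - x'\<bar>" "\<bar>h x t - h x t'\<bar> \<le> B * \<bar>t - t'\<bar>"
      "\<bar>h x t - h x' t - h x t' + h x' t'\<bar> \<le> B * \<bar>x - x'\<bar> * \<bar>t - t'\<bar>"
    using assms unfolding mixed_lipschitz_def by auto
  show "\<bar>g x t + h x t\<bar> \<le> A + B" using g(1) h(1) by linarith
  show "\<bar>g x t + h x t - (g x' t + h x' t)\<bar> \<le> (A + B) * \<bar>x - x'\<bar>"
    using g(2) h(2) unfolding distrib_right by linarith
  show "\<bar>g x t + h x t - (g x t' + h x t')\<bar> \<le> (A + B) * \<bar>t - t'\<bar>"
    using g(3) h(3) unfolding distrib_right by linarith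
  show "\<bar>g x t + h x t - (g x' t + h x' t) - (g x t' + h x t') + (g x' t' + h x' t')\<bar>
      \<le> (A + B) * \<bar>x - x'\<bar> * \<bar>t - t'\<bar>"
    using g(4) h(4) unfolding distrib_right by linarith
qed

lemma mixed_lipschitz_minus:
  assumes "mixed_lipschitz L T A g"
  shows "mixed_lipschitz L T A (\<lambda>x t. - g x t)"
  unfolding mixed_lipschitz_def
proof (intro ballI conjI)
  fix x x' t t' assume "x \<in> {0..L}" "x' \<in> {0..L}" "t \<in> {0..T}" "t' \<in> {0..T}"
  then have g: "\<bar>g x t\<bar> \<le> A" "\<bar>g x t - g x' t\<bar> \<le> A * \<bar>x - x'\<bar>" "\<bar>g x t - g x t'\<bar> \<le> A * \<bar>t - t'\<bar>"
      "\<bar>g x t - g x' t - g x t' + g x' t'\<bar> \<le> A * \<bar>x - x'\<bar> * \<bar>t - t'\<bar>"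
    using assms unfolding mixed_lipschitz_def by auto
  then show "\<bar>- g x t\<bar> \<le> A" "\<bar>- g x t - - g x' t\<bar> \<le> A * \<bar>x - x'\<bar>" "\<bar>- g x t - - g x t'\<bar> \<le> A * \<bar>t - t'\<bar>"
      "\<bar>- g x t - - g x' t - - g x t' + - g x' t'\<bar> \<le> A * \<bar>x - x'\<bar> * \<bar>t - t'\<bar>"
    by linarith+
qed

lemma mixed_lipschitz_mult:
  assumes "mixed_lipschitz L T A g" "mixed_lipschitz L T B h" and A: "0 \<le> A"
  shows "mixed_lipschitz L T (4 * A * B) (\<lambda>x t. g x t * h x t)"
  unfolding mixed_lipschitz_def
proof (intro ballI)
  fix x x' t t' assume r: "x \<in> {0..L}" "x' \<in> {0..L}" "t \<in> {0..T}" "t' \<in> {0..T}"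
  have g: "\<bar>g x t\<bar> \<le> A" "\<bar>g x' t\<bar> \<le> A" "\<bar>g x' t'\<bar> \<le> A"  "\<bar>g x t - g x' t\<bar> \<le> A * \<bar>x - x'\<bar>" "\<bar>g x t - g x t'\<bar> \<le> A * \<bar>t - t'\<bar>"
      "\<bar>g x' t - g x' t'\<bar> \<le> A * \<bar>t - t'\<bar>"
      "\<bar>g x t - g x' t - g x t' + g x' t'\<bar> \<le> A * \<bar>x - x'\<bar> * \<bar>t - t'\<bar>"
    and h: "\<bar>h x t\<bar> \<le> B" "\<bar>h x' t\<bar> \<le> B" "\<bar>h x t'\<bar> \<le> B" "\<bar>h x t - h x' t\<bar> \<le> B * \<bar>x - x'\<bar>"
      "\<bar>h x t' - h x' t'\<bar> \<le> B * \<bar>x - x'\<bar>" "\<bar>h x t - h x t'\<bar> \<le> B * \<bar>t - t'\<bar>"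
      "\<bar>h x t - h x' t - h x t' + h x' t'\<bar> \<le> B * \<bar>x - x'\<bar> * \<bar>t - t'\<bar>"
    using assms r unfolding mixed_lipschitz_def by auto
  define X Y where "X = \<bar>x - x'\<bar>" and "Y = \<bar>t - t'\<bar>"
  note gh = g h
  note gh = gh[folded X_def Y_def]
  have XY: "0 \<le> X" "0 \<le> Y" and B: "0 \<le> B" using h(1) by (auto simp: X_def Y_def)
  have m: "\<bar>u * v\<bar> \<le> U * V" if "\<bar>u\<bar> \<le> U" "\<bar>v\<bar> \<le> V" for u v U V :: real
    unfolding abs_mult using that by (intro mult_mono) auto
  have AB: "0 \<le> A * B" using A B by simp
  have 1: "\<bar>g x t * h x t\<bar> \<le> 4 * A * B"
    using m[OF gh(1) gh(8)] AB by simp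
  have "g x t * h x t - g x' t * h x' t = (g x t - g x' t) * h x t + g x' t * (h x t - h x' t)"
    by (simp add: algebra_simps)
  then have "\<bar>g x t * h x t - g x' t * h x' t\<bar> \<le> A * X * B + A * (B * X)"
    using m[OF gh(4) gh(8)] m[OF gh(2) gh(11)] by linarith
  also have "\<dots> \<le> 4 * A * B * X" using mult_nonneg_nonneg[OF AB XY(1)] by (simp add: mult_ac)
  finally have 2: "\<bar>g x t * h x t - g x' t * h x' t\<bar> \<le> 4 * A * B * X" .
  have "g x t * h x t - g x t' * h x t' = (g x t - g x t') * h x t' + g x t * (h x t - h x t')"
    by (simp add: algebra_simps)
  then have "\<bar>g x t * h x t - g x t' * h x t'\<bar> \<le> A * Y * B + A * (B * Y)"
    using m[OF gh(5) gh(10)] m[OF gh(1) gh(13)] by linarith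
  also have "\<dots> \<le> 4 * A * B * Y" using mult_nonneg_nonneg[OF AB XY(2)] by (simp add: mult_ac)
  finally have 3: "\<bar>g x t * h x t - g x t' * h x t'\<bar> \<le> 4 * A * B * Y" .
  have eq: "g x t * h x t - g x' t * h x' t - g x t' * h x t' + g x' t' * h x' t'
    = (g x t - g x' t - g x t' + g x' t') * h x t'
      + (g x t - g x' t) * (h x t - h x t')
      + g x' t' * (h x t - h x' t - h x t' + h x' t') + (g x' t - g x' t') * (h x t - h x' t)"
    by (simp add: algebra_simps)
  have "\<bar>g x t * h x t - g x' t * h x' t - g x t' * h x t' + g x' t' * h x' t'\<bar>
     \<le> A * X * Y * B + A * X * (B * Y) + A * (B * X * Y) + A * Y * (B * X)"
    unfolding eq
    using m[OF gh(7) gh(10)] m[OF gh(4) gh(13)] m[OF gh(3) gh(14)] m[OF gh(6) gh(11)]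
    by linarith
  then have "\<bar>g x t * h x t - g x' t * h x' t - g x t' * h x t' + g x' t' * h x' t'\<bar> \<le> 4 * A * B * X * Y"
    by (simp add: mult_ac)
  with 1 2 3 show "\<bar>g x t * h x t\<bar> \<le> 4 * A * B \<and>
       \<bar>g x t * h x t - g x' t * h x' t\<bar> \<le> 4 * A * B * \<bar>x - x'\<bar> \<and>
       \<bar>g x t * h x t - g x t' * h x t'\<bar> \<le> 4 * A * B * \<bar>t - t'\<bar> \<and>
       \<bar>g x t * h x t - g x' t * h x' t - g x t' * h x t' + g x' t' * h x' t'\<bar>
       \<le> 4 * A * B * \<bar>x - x'\<bar> * \<bar>t - t'\<bar>" by (simp add: X_def Y_def)
qed

lemma Ck_on_2_bounds:
  assumes g: "Ck_on 2 {0..L} g"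
  obtains A where "0 \<le> A"
    "\<And>x. x \<in> {0..L} \<Longrightarrow> \<bar>g x\<bar> \<le> A"
    "\<And>x y. x \<in> {0..L} \<Longrightarrow> y \<in> {0..L} \<Longrightarrow> \<bar>g x - g y\<bar> \<le> A * \<bar>x - y\<bar>"
    "\<And>x. x \<in> {0..L} \<Longrightarrow> \<bar>deriv_on {0..L} g x\<bar> \<le> A"
    "\<And>x y. x \<in> {0..L} \<Longrightarrow> y \<in> {0..L} \<Longrightarrow> \<bar>deriv_on {0..L} g x - deriv_on {0..L} g y\<bar> \<le> A * \<bar>x - y\<bar>"
proof -
  let ?g1 = "deriv_on {0..L} g" let ?g2 = "deriv_on {0..L} ?g1"
  have c: "continuous_on {0..L} g" "continuous_on {0..L} ?g1" "continuous_on {0..L} ?g2"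
    and d: "\<And>x. x \<in> {0..L} \<Longrightarrow> g differentiable (at x within {0..L})"
      "\<And>x. x \<in> {0..L} \<Longrightarrow> ?g1 differentiable (at x within {0..L})"
    using g by (auto simp: numeral_2_eq_2)
  have bd: "\<exists>B. \<forall>x\<in>{0..L}. \<bar>h x\<bar> \<le> B" if "continuous_on {0..L} h" for h :: "real \<Rightarrow> real"
    using compact_imp_bounded[OF compact_continuous_image[OF that]] unfolding bounded_iff by auto
  from bd[OF c(1)] obtain B0 where B0: "\<forall>x\<in>{0..L}. \<bar>g x\<bar> \<le> B0" by blast
  from bd[OF c(2)] obtain B1 where B1: "\<forall>x\<in>{0..L}. \<bar>?g1 x\<bar> \<le> B1" by blast
  from bd[OF c(3)] obtain B2 where B2: "\<forall>x\<in>{0..L}. \<bar>?g2 x\<bar> \<le> B2" by blast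
  define A where "A = \<bar>B0\<bar> + \<bar>B1\<bar> + \<bar>B2\<bar>"
  have b: "\<bar>g x\<bar> \<le> A" "\<bar>?g1 x\<bar> \<le> A" "\<bar>?g2 x\<bar> \<le> A" if "x \<in> {0..L}" for x
    using bspec[OF B0 that] bspec[OF B1 that] bspec[OF B2 that] unfolding A_def by linarith+
  show thesis
  proof (rule that[of A])
    show "0 \<le> A" by (simp add: A_def)
    show "\<bar>g x - g y\<bar> \<le> A * \<bar>x - y\<bar>" if "x \<in> {0..L}" "y \<in> {0..L}" for x y
      using lipschitz_of_deriv_on[of 0 L g "{0..L}" A x y] d b that by auto
    show "\<bar>?g1 x - ?g1 y\<bar> \<le> A * \<bar>x - y\<bar>" if "x \<in> {0..L}" "y \<in> {0..L}" for x y
      using lipschitz_of_deriv_on[of 0 L ?g1 "{0..L}" A x y] d b that by auto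
  qed (use b in auto)
qed

text \<open>
  Consistency of the backward quotient, from the Lipschitz bound on the derivative applied to
  \<open>g - g' x\<close> times the identity.
\<close>

lemma Ck_on_2_taylor:
  assumes g: "Ck_on 2 {0..L} g"
    and lip: "\<And>x y. x \<in> {0..L} \<Longrightarrow> y \<in> {0..L} \<Longrightarrow> \<bar>deriv_on {0..L} g x - deriv_on {0..L} g y\<bar> \<le> A * \<bar>x - y\<bar>"
    and A: "0 \<le> A" and xy: "x \<in> {0..L}" "y \<in> {0..L}" "y < x"
  shows "\<bar>(g x - g y) / (x - y) - deriv_on {0..L} g x\<bar> \<le> A * (x - y)"
proof -
  let ?g' = "deriv_on {0..L} g"
  have d: "g differentiable (at s within {0..L})" if "s \<in> {0..L}" for s
    using g that by (auto simp: numeral_2_eq_2)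
  have "norm ((g x - ?g' x * x) - (g y - ?g' x * y)) \<le> (A * (x - y)) * norm (x - y)"
  proof (rule field_differentiable_bound[where S="{y..x}" and f'="\<lambda>s. ?g' s - ?g' x"])
    fix s assume s: "s \<in> {y..x}"
    have "(g has_real_derivative ?g' s) (at s within {y..x})"
      by (rule has_field_derivative_subset[OF has_derivative_deriv_on[OF d]]) (use s xy in auto)
    then show "((\<lambda>s. g s - ?g' x * s) has_real_derivative ?g' s - ?g' x) (at s within {y..x})"
      by (auto intro!: derivative_eq_intros)
    have "\<bar>?g' s - ?g' x\<bar> \<le> A * \<bar>s - x\<bar>" by (rule lip) (use s xy in auto)
    also have "\<dots> \<le> A * (x - y)" using s A by (intro mult_left_mono) auto
    finally show "norm (?g' s - ?g' x) \<le> A * (x - y)" by simp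
  qed (use xy in auto)
  then have le: "\<bar>g x - g y - ?g' x * (x - y)\<bar> \<le> (A * (x - y)) * (x - y)"
    using xy by (simp add: algebra_simps)
  have "(g x - g y) / (x - y) - ?g' x = (g x - g y - ?g' x * (x - y)) / (x - y)"
    using xy by (simp add: diff_divide_distrib)
  then show ?thesis using le xy by (simp add: pos_divide_le_eq)
qed

lemma mixed_lipschitz_x:
  assumes "0 \<le> A" "\<And>x. x \<in> {0..L} \<Longrightarrow> \<bar>g x\<bar> \<le> A"
    "\<And>x y. x \<in> {0..L} \<Longrightarrow> y \<in> {0..L} \<Longrightarrow> \<bar>g x - g y\<bar> \<le> A * \<bar>x - y\<bar>"
  shows "mixed_lipschitz L T A (\<lambda>x t. g x)"
  using assms by (auto simp: mixed_lipschitz_def)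

lemma mixed_lipschitz_t:
  assumes "0 \<le> A" "\<And>t. t \<in> {0..T} \<Longrightarrow> \<bar>g t\<bar> \<le> A"
    "\<And>x y. x \<in> {0..T} \<Longrightarrow> y \<in> {0..T} \<Longrightarrow> \<bar>g x - g y\<bar> \<le> A * \<bar>x - y\<bar>"
  shows "mixed_lipschitz L T A (\<lambda>x t. g t)"
  using assms by (auto simp: mixed_lipschitz_def)

lemma mixed_lipschitz_mesh_quotients:
  assumes c: "mixed_lipschitz L T A c"
    and x: "xs i \<in> {0..L}" and t: "ts j \<in> {0..T}"
  shows "\<bar>c (xs i) (ts j)\<bar> \<le> A"
    and "ts (Suc j) \<in> {0..T} \<Longrightarrow> ts j < ts (Suc j) \<Longrightarrow> \<bar>diff_t ts (\<lambda>i j. c (xs i) (ts j)) i j\<bar> \<le> A"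
    and "xs (Suc i) \<in> {0..L} \<Longrightarrow> xs i < xs (Suc i) \<Longrightarrow> \<bar>diff_x xs (\<lambda>i j. c (xs i) (ts j)) i j\<bar> \<le> A"
    and "xs (Suc i) \<in> {0..L} \<Longrightarrow> xs i < xs (Suc i) \<Longrightarrow> ts (Suc j) \<in> {0..T} \<Longrightarrow> ts j < ts (Suc j)
      \<Longrightarrow> \<bar>diff_x xs (diff_t ts (\<lambda>i j. c (xs i) (ts j))) i j\<bar> \<le> A"
proof -
  show "\<bar>c (xs i) (ts j)\<bar> \<le> A" using c x t unfolding mixed_lipschitz_def by blast
  {
    assume t': "ts (Suc j) \<in> {0..T}" "ts j < ts (Suc j)"
    have "\<bar>c (xs i) (ts (Suc j)) - c (xs i) (ts j)\<bar> \<le> A * \<bar>ts (Suc j) - ts j\<bar>"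
      using c x t t'(1) unfolding mixed_lipschitz_def by blast
    then show "\<bar>diff_t ts (\<lambda>i j. c (xs i) (ts j)) i j\<bar> \<le> A" using t'(2) by (simp add: diff_t_def field_simps)
  }
  {
    assume x': "xs (Suc i) \<in> {0..L}" "xs i < xs (Suc i)"
    have "\<bar>c (xs (Suc i)) (ts j) - c (xs i) (ts j)\<bar> \<le> A * \<bar>xs (Suc i) - xs i\<bar>"
      using c x t x'(1) unfolding mixed_lipschitz_def by blast
    then show "\<bar>diff_x xs (\<lambda>i j. c (xs i) (ts j)) i j\<bar> \<le> A" using x'(2) by (simp add: diff_x_def field_simps)
  }
  assume x': "xs (Suc i) \<in> {0..L}" "xs i < xs (Suc i)" and t': "ts (Suc j) \<in> {0..T}" "ts j < ts (Suc j)"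
  define h k where "h = xs (Suc i) - xs i" and "k = ts (Suc j) - ts j"
  have hk: "0 < h" "0 < k" using x' t' by (auto simp: h_def k_def)
  define d where "d = c (xs (Suc i)) (ts (Suc j)) - c (xs i) (ts (Suc j)) - c (xs (Suc i)) (ts j) + c (xs i) (ts j)"
  have "\<bar>d\<bar> \<le> A * \<bar>xs (Suc i) - xs i\<bar> * \<bar>ts (Suc j) - ts j\<bar>"
    using c x t x'(1) t'(1) unfolding mixed_lipschitz_def d_def by blast
  then have d: "\<bar>d\<bar> \<le> A * (h * k)" using hk by (simp add: h_def k_def)
  have "diff_x xs (diff_t ts (\<lambda>i j. c (xs i) (ts j))) i j = d / (h * k)"
    by (simp add: diff_x_def diff_t_def h_def[symmetric] k_def[symmetric] d_def diff_divide_distrib[symmetric] algebra_simps)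
  then show "\<bar>diff_x xs (diff_t ts (\<lambda>i j. c (xs i) (ts j))) i j\<bar> \<le> A"
    using d hk by (simp add: abs_mult pos_divide_le_eq)
qed

text \<open>
  The exponential weight increases in \<open>x\<close>, so increments in \<open>x\<close> carry its value at the right end.
\<close>

lemma layer_forcing_bounds:
  assumes f: "Ck_rect 2 L T f" and l: "layer_forcing L T C \<epsilon> f" and e: "0 < \<epsilon>"
    and r: "0 \<le> x" "x \<le> x'" "x' \<le> L" "t \<in> {0..T}" "t' \<in> {0..T}"
  shows "0 \<le> C" "\<bar>f x t\<bar> \<le> C / \<epsilon> * exp ((x - L) / \<epsilon>)"
    "\<bar>f x' t - f x t\<bar> \<le> C / \<epsilon>^2 * exp ((x' - L) / \<epsilon>) * (x' - x)"
    "\<bar>f x t - f x t'\<bar> \<le> C / \<epsilon> * exp ((x - L) / \<epsilon>) * \<bar>t - t'\<bar>"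
    "\<bar>f x' t - f x t - f x' t' + f x t'\<bar> \<le> C / \<epsilon>^2 * exp ((x' - L) / \<epsilon>) * (x' - x) * \<bar>t - t'\<bar>"
proof -
  have f1: "Ck_rect (Suc 1) L T f" using f by (simp add: numeral_2_eq_2)
  have b: "\<bar>dxt L T i j f y s\<bar> \<le> C / \<epsilon> ^ (1 + i) * exp ((y - L) / \<epsilon>)"
    if "i + j \<le> 2" "y \<in> {0..L}" "s \<in> {0..T}" for i j y s
    using l that unfolding layer_forcing_def by blast
  show f0: "\<bar>f x t\<bar> \<le> C / \<epsilon> * exp ((x - L) / \<epsilon>)" using b[of 0 0 x t] r by (simp add: dxt_def)
  then have "0 \<le> C / \<epsilon> * exp ((x - L) / \<epsilon>)" by linarith
  then show C: "0 \<le> C" using e by (simp add: zero_le_mult_iff zero_le_divide_iff)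
  have mono: "C / \<epsilon>^2 * exp ((y - L) / \<epsilon>) \<le> C / \<epsilon>^2 * exp ((x' - L) / \<epsilon>)" if "y \<le> x'" for y
    using that C e by (intro mult_left_mono) (auto simp: divide_right_mono)
  have x: "\<bar>dx L f y s\<bar> \<le> C / \<epsilon>^2 * exp ((x' - L) / \<epsilon>)" if "y \<in> {x..x'}" "s \<in> {0..T}" for y s
    using b[of 1 0 y s] mono[of y] that r by (simp add: dxt_def power2_eq_square)
  have t: "\<bar>dt T f x s\<bar> \<le> C / \<epsilon> * exp ((x - L) / \<epsilon>)" if "s \<in> {0..T}" for s
    using b[of 0 1 x s] that r by (simp add: dxt_def)
  have xt: "\<bar>dx L (dt T f) y s\<bar> \<le> C / \<epsilon>^2 * exp ((x' - L) / \<epsilon>)" if "y \<in> {x..x'}" "s \<in> {0..T}" for y s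
    using b[of 1 1 y s] mono[of y] that r by (simp add: dxt_def power2_eq_square)
  show "\<bar>f x' t - f x t\<bar> \<le> C / \<epsilon>^2 * exp ((x' - L) / \<epsilon>) * (x' - x)"
    using Ck_rect_dx_lipschitz[OF f1 r(1-4) x] r by blast
  show "\<bar>f x t - f x t'\<bar> \<le> C / \<epsilon> * exp ((x - L) / \<epsilon>) * \<bar>t - t'\<bar>"
    using Ck_rect_dt_lipschitz[OF f1 _ r(4,5) t] r by auto
  show "\<bar>f x' t - f x t - f x' t' + f x t'\<bar> \<le> C / \<epsilon>^2 * exp ((x' - L) / \<epsilon>) * (x' - x) * \<bar>t - t'\<bar>"
    using Ck_rect_mixed_lipschitz[OF f r xt] by blast
qed

lemma layer_forcing_corner: "layer_forcing L T C \<epsilon> f \<Longrightarrow> f 0 0 = 0"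
  unfolding layer_forcing_def dxt_def by (metis add.right_neutral funpow_0 zero_le)


section \<open>Piecewise bilinear interpolation and its residual\<close>

lemma mesh_mono:
  fixes xs :: "nat \<Rightarrow> real"
  assumes "\<And>i. i < n \<Longrightarrow> xs i < xs (Suc i)" "i \<le> j" "j \<le> n"
  shows "xs i \<le> xs j"
  using assms(2,3)
proof (induction j rule: dec_induct)
  case (step k)
  then show ?case using assms(1)[of k] by simp
qed simp

lemma mesh_cell_left_open:
  fixes xs :: "nat \<Rightarrow> real"
  assumes "xs 0 < x" "x \<le> xs n"
  obtains i where "i < n" "xs i < x" "x \<le> xs (Suc i)"
  using assms
proof (induction n arbitrary: thesis)
  case (Suc n)
  show ?case
  proof (cases "x \<le> xs n")
    case True
    then show ?thesis using Suc.IH[OF _ Suc.prems(2) True] Suc.prems(1) less_SucI by blast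
  next
    case False
    then show ?thesis using Suc.prems(1)[of n] Suc.prems(3) by simp
  qed
qed simp

lemma mesh_cell_closed:
  fixes xs :: "nat \<Rightarrow> real"
  assumes "\<And>i. i < n \<Longrightarrow> xs i < xs (Suc i)" "0 < n" "xs 0 \<le> x" "x \<le> xs n"
  obtains i where "i < n" "xs i \<le> x" "x \<le> xs (Suc i)"
proof (cases "xs 0 < x")
  case True
  then show ?thesis using mesh_cell_left_open[OF True assms(4)] that by (metis less_imp_le)
next
  case False
  then have "x = xs 0" using assms by simp
  then show ?thesis using that[of 0] assms(1)[of 0] assms(2) by simp
qed

text \<open>
  A sum of clamped linear functions: continuity and linearity in \<open>g\<close> are evident, and on each cell all
  clamped factors but one are 0 or 1.
\<close>

definition lin_interp :: "(nat \<Rightarrow> real) \<Rightarrow> nat \<Rightarrow> (nat \<Rightarrow> real) \<Rightarrow> real \<Rightarrow> real" where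
  "lin_interp xs n g x =
     g 0 + (\<Sum>i<n. (g (Suc i) - g i) * max 0 (min 1 ((x - xs i) / (xs (Suc i) - xs i))))"

lemma lin_interp_cell:
  assumes st: "\<And>i. i < n \<Longrightarrow> xs i < xs (Suc i)" and i: "i < n" and x: "xs i \<le> x" "x \<le> xs (Suc i)"
  shows "lin_interp xs n g x = g i + (g (Suc i) - g i) * ((x - xs i) / (xs (Suc i) - xs i))"
proof -
  let ?c = "\<lambda>l. (g (Suc l) - g l) * max 0 (min 1 ((x - xs l) / (xs (Suc l) - xs l)))"
  have "{..<n} = {..<i} \<union> {i} \<union> {Suc i..<n}" using i by auto
  then have "(\<Sum>l<n. ?c l) = (\<Sum>l<i. ?c l) + ?c i + (\<Sum>l=Suc i..<n. ?c l)"
    by (simp add: sum.union_disjoint disjoint_iff)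
  also have "(\<Sum>l<i. ?c l) = (\<Sum>l<i. g (Suc l) - g l)"
  proof (intro sum.cong refl)
    fix l assume l: "l \<in> {..<i}"
    then have "xs (Suc l) \<le> x" using mesh_mono[of n xs "Suc l" i] st i x by auto
    then have "1 \<le> (x - xs l) / (xs (Suc l) - xs l)" using st[of l] l i by simp
    then show "?c l = g (Suc l) - g l" by simp
  qed
  also have "\<dots> = g i - g 0" by (rule sum_lessThan_telescope)
  also have "(\<Sum>l=Suc i..<n. ?c l) = 0"
  proof (intro sum.neutral ballI)
    fix l assume l: "l \<in> {Suc i..<n}"
    then have "x \<le> xs l" using mesh_mono[of n xs "Suc i" l] st i x by auto
    then have "(x - xs l) / (xs (Suc l) - xs l) \<le> 0"
      using st[of l] l by (intro divide_nonpos_pos) auto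
    then show "?c l = 0" by simp
  qed
  also have "?c i = (g (Suc i) - g i) * ((x - xs i) / (xs (Suc i) - xs i))"
    using st[OF i] x by (simp add: min_def max_def)
  finally show ?thesis by (simp add: lin_interp_def)
qed

definition bil :: "(nat \<Rightarrow> real) \<Rightarrow> (nat \<Rightarrow> real) \<Rightarrow> nat \<Rightarrow> nat \<Rightarrow> (nat \<Rightarrow> nat \<Rightarrow> real) \<Rightarrow> real \<Rightarrow> real \<Rightarrow> real" where
  "bil xs ts n m Y x t = lin_interp xs n (\<lambda>i. lin_interp ts m (Y i) t) x"

text \<open>
  The bilinear function on a cell in terms of its corner values, with relative coordinates \<open>p\<close> and \<open>q\<close>.
\<close>

definition corner_mean :: "real \<Rightarrow> real \<Rightarrow> real \<Rightarrow> real \<Rightarrow> real \<Rightarrow> real \<Rightarrow> real" where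
  "corner_mean p q y00 y10 y01 y11 = (1 - p) * (1 - q) * y00 + p * (1 - q) * y10 + (1 - p) * q * y01 + p * q * y11"

lemma corner_mean_le:
  assumes "0 \<le> p" "p \<le> 1" "0 \<le> q" "q \<le> 1"
    "\<bar>y00\<bar> \<le> w" "\<bar>y10\<bar> \<le> w" "\<bar>y01\<bar> \<le> w" "\<bar>y11\<bar> \<le> w"
  shows "\<bar>corner_mean p q y00 y10 y01 y11\<bar> \<le> w"
proof -
  have m: "\<bar>c * y\<bar> \<le> c * w" if "0 \<le> c" "\<bar>y\<bar> \<le> w" for c y
    using that by (simp add: abs_mult mult_left_mono)
  have "\<bar>corner_mean p q y00 y10 y01 y11\<bar>
     \<le> (1 - p) * (1 - q) * w + p * (1 - q) * w + (1 - p) * q * w + p * q * w"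
    unfolding corner_mean_def
    by (intro order_trans[OF abs_triangle_ineq] add_mono m) (use assms in auto)
  also have "\<dots> = w" by (simp add: algebra_simps)
  finally show ?thesis .
qed

lemma corner_mean_diff:
  "corner_mean p q (y00 - z00) (y10 - z10) (y01 - z01) (y11 - z11)
    = corner_mean p q y00 y10 y01 y11 - corner_mean p q z00 z10 z01 z11"
  by (simp add: corner_mean_def algebra_simps)

lemma corner_mean_const: "corner_mean p q c c c c = c"
  by (simp add: corner_mean_def algebra_simps)

lemma bil_cell:
  assumes sx: "\<And>i. i < n \<Longrightarrow> xs i < xs (Suc i)" and st: "\<And>j. j < m \<Longrightarrow> ts j < ts (Suc j)"
    and "i < n" "xs i \<le> x" "x \<le> xs (Suc i)" "j < m" "ts j \<le> t" "t \<le> ts (Suc j)"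
  shows "bil xs ts n m Y x t = corner_mean ((x - xs i) / (xs (Suc i) - xs i)) ((t - ts j) / (ts (Suc j) - ts j))
    (Y i j) (Y (Suc i) j) (Y i (Suc j)) (Y (Suc i) (Suc j))"
proof -
  define p q where "p = (x - xs i) / (xs (Suc i) - xs i)" and "q = (t - ts j) / (ts (Suc j) - ts j)"
  have *: "lin_interp ts m (Y l) t = Y l j + (Y l (Suc j) - Y l j) * q" for l
    unfolding q_def by (rule lin_interp_cell[OF st assms(6-8)])
  have "bil xs ts n m Y x t = lin_interp ts m (Y i) t + (lin_interp ts m (Y (Suc i)) t - lin_interp ts m (Y i) t) * p"
    unfolding bil_def p_def by (rule lin_interp_cell[OF sx assms(3-5)])
  then show ?thesis unfolding * p_def[symmetric] q_def[symmetric] corner_mean_def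
    by (simp add: algebra_simps)
qed

lemma bilinear_corner_mean:
  assumes V: "\<And>x t. x \<in> {x0..x1} \<Longrightarrow> t \<in> {t0..t1} \<Longrightarrow> V x t = c0 + c1 * x + c2 * t + c3 * x * t"
    and "x0 < x1" "t0 < t1" and x: "x \<in> {x0..x1}" "t \<in> {t0..t1}"
  shows "V x t = corner_mean ((x - x0) / (x1 - x0)) ((t - t0) / (t1 - t0)) (V x0 t0) (V x1 t0) (V x0 t1) (V x1 t1)"
proof -
  define p q where "p = (x - x0) / (x1 - x0)" and "q = (t - t0) / (t1 - t0)"
  have xp: "x = x0 + p * (x1 - x0)" and tq: "t = t0 + q * (t1 - t0)"
    using assms by (auto simp: p_def q_def)
  have "c0 + c1 * x + c2 * t + c3 * x * t = corner_mean p q (c0 + c1 * x0 + c2 * t0 + c3 * x0 * t0)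
    (c0 + c1 * x1 + c2 * t0 + c3 * x1 * t0) (c0 + c1 * x0 + c2 * t1 + c3 * x0 * t1)
    (c0 + c1 * x1 + c2 * t1 + c3 * x1 * t1)"
    unfolding xp tq corner_mean_def by (simp add: algebra_simps)
  then show ?thesis using V x assms(2,3) by (simp add: p_def q_def)
qed

lemma continuous_on_bil: "continuous_on S (\<lambda>(x, t). bil xs ts n m Y x t)"
proof -
  have c: "continuous_on S (\<lambda>z. max 0 (min 1 ((g z - u) / v)))"
    if "continuous_on S g" for g :: "real \<times> real \<Rightarrow> real" and u v S
    unfolding divide_inverse using that
    by (intro continuous_on_max continuous_on_min continuous_intros)
  show ?thesis
    unfolding bil_def lin_interp_def case_prod_unfold
    by (intro continuous_intros c)
qed

text \<open>
  The derivatives of a bilinear function differ from the backward quotients at the upper right corner by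
  multiples of \<open>h\<close> and \<open>k\<close> times the mixed quotient. Subtracting the scheme at this corner leaves only
  these differences and the variation of the coefficients over the cell.
\<close>

lemma bilinear_residual:
  fixes h k p q :: real
  assumes hk: "0 < h" "0 < k" and pq: "0 \<le> p" "p \<le> 1" "0 \<le> q" "q \<le> 1"
    and eq: "(y11 - y10) / k + a1 * ((y11 - y01) / h) + b1 * y11 = F"
    and a: "\<bar>a - a1\<bar> \<le> A * (h + k)" "\<bar>b - b1\<bar> \<le> A * (h + k)" "\<bar>a\<bar> \<le> A" "\<bar>b1\<bar> \<le> A"
    and Q: "\<bar>(y10 - y00) / h\<bar> \<le> r" "\<bar>(y11 - y01) / h\<bar> \<le> r"
    and P: "\<bar>(y01 - y00) / k\<bar> \<le> r" "\<bar>(y11 - y10) / k\<bar> \<le> r"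
    and S: "\<bar>((y11 - y10) / k - (y01 - y00) / k) / h\<bar> \<le> s"
    and w: "\<bar>y00\<bar> \<le> w" "\<bar>y10\<bar> \<le> w" "\<bar>y01\<bar> \<le> w" "\<bar>y11\<bar> \<le> w"
  shows "\<bar>((1 - p) * ((y01 - y00) / k) + p * ((y11 - y10) / k))
     + a * ((1 - q) * ((y10 - y00) / h) + q * ((y11 - y01) / h))
     + b * corner_mean p q y00 y10 y01 y11 - F\<bar> \<le> (h + A * k) * s + A * (h + k) * (2 * r + w)"
proof -
  define Q0 Q1 P0 P1 where "Q0 = (y10 - y00) / h" and "Q1 = (y11 - y01) / h"
    and "P0 = (y01 - y00) / k" and "P1 = (y11 - y10) / k"
  define Z where "Z = (P1 - P0) / h"
  define V where "V = corner_mean p q y00 y10 y01 y11"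
  have Pd: "P1 - P0 = h * Z" using hk by (simp add: Z_def)
  have "h * (Q1 - Q0) = y11 - y01 - (y10 - y00)" "k * (P1 - P0) = y11 - y10 - (y01 - y00)"
    unfolding right_diff_distrib using hk by (simp_all add: Q0_def Q1_def P0_def P1_def)
  then have "h * (Q1 - Q0) = k * (P1 - P0)" by simp
  then have Qd: "Q1 - Q0 = k * Z" using hk by (simp add: Z_def field_simps)
  have Vle: "\<bar>V\<bar> \<le> w" unfolding V_def using pq w by (rule corner_mean_le)
  have y: "y01 = y11 - h * Q1" "y10 = y11 - k * P1" "y00 = y01 - k * P0"
    using hk by (auto simp: P0_def P1_def Q0_def Q1_def)
  have r: "\<bar>Q1\<bar> \<le> r" "\<bar>P0\<bar> \<le> r" "\<bar>P1\<bar> \<le> r" using P Q by (auto simp: P0_def P1_def Q1_def)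
  have "V - y11 = - ((1 - q) * k * ((1 - p) * P0 + p * P1)) - (1 - p) * h * Q1"
    unfolding V_def corner_mean_def y by (simp add: algebra_simps)
  moreover have "\<bar>(1 - q) * k * ((1 - p) * P0 + p * P1)\<bar> \<le> 1 * k * ((1 - p) * r + p * r)"
  proof -
    have "\<bar>(1 - p) * P0\<bar> \<le> (1 - p) * r" "\<bar>p * P1\<bar> \<le> p * r"
      unfolding abs_mult using pq r by (auto intro!: mult_mono)
    then have "\<bar>(1 - p) * P0 + p * P1\<bar> \<le> (1 - p) * r + p * r" by linarith
    then show ?thesis unfolding abs_mult[of "(1 - q) * k"] using pq hk
      by (intro mult_mono) (auto simp: abs_mult mult_left_le_one_le)
  qed
  moreover have "\<bar>(1 - p) * h * Q1\<bar> \<le> 1 * h * r"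
    unfolding abs_mult using pq hk r by (intro mult_mono) auto
  ultimately have Vd: "\<bar>V - y11\<bar> \<le> (h + k) * r" by (simp add: algebra_simps)
  have m: "\<bar>c * y\<bar> \<le> C * Y" if "\<bar>c\<bar> \<le> C" "\<bar>y\<bar> \<le> Y" for c y C Y :: real
    unfolding abs_mult using that by (intro mult_mono) auto
  have eq': "F = P1 + a1 * Q1 + b1 * y11" using eq by (simp only: P1_def Q1_def)
  have Z: "\<bar>Z\<bar> \<le> s" using S by (simp add: Z_def P0_def P1_def)
  have "((1 - p) * P0 + p * P1) + a * ((1 - q) * Q0 + q * Q1) + b * V - F
    = (P1 - (1 - p) * (P1 - P0)) + a * (Q1 - (1 - q) * (Q1 - Q0)) + b * V - (P1 + a1 * Q1 + b1 * y11)"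
    unfolding eq' by (simp add: algebra_simps)
  also have "\<dots> = - ((1 - p) * h) * Z + (- (a * ((1 - q) * k))) * Z + (a - a1) * Q1 + (b - b1) * V + b1 * (V - y11)"
    unfolding Pd Qd by (simp add: algebra_simps)
  also have "\<bar>\<dots>\<bar> \<le> h * s + (A * k) * s + (A * (h + k)) * r + (A * (h + k)) * w + A * ((h + k) * r)"
  proof -
    have "\<bar>- ((1 - p) * h)\<bar> \<le> h" using pq hk by (simp add: abs_mult mult_left_le_one_le)
    moreover have "\<bar>- (a * ((1 - q) * k))\<bar> \<le> A * k"
      unfolding abs_minus_cancel using pq hk by (intro m a) (simp add: abs_mult mult_left_le_one_le)
    ultimately show ?thesis
      by (intro order_trans[OF abs_triangle_ineq] add_mono m Z a r Vle Vd)
  qed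
  also have "\<dots> = (h + A * k) * s + A * (h + k) * (2 * r + w)" by (simp add: algebra_simps)
  finally show ?thesis unfolding P0_def P1_def Q0_def Q1_def V_def .
qed

text \<open>
  The derivatives are taken from the left, over some interval below the point: this is defined also
  on mesh lines, and it is stable under sums.
\<close>

definition residual_le :: "(real \<Rightarrow> real \<Rightarrow> real) \<Rightarrow> (real \<Rightarrow> real \<Rightarrow> real) \<Rightarrow> (real \<Rightarrow> real \<Rightarrow> real) \<Rightarrow> real \<Rightarrow> real \<Rightarrow> real \<Rightarrow> real \<Rightarrow> bool" where
  "residual_le a b z F R x t \<longleftrightarrow> (\<exists>l\<in>{0..<x}. \<exists>s\<in>{0..<t}. \<exists>zx zt.
     ((\<lambda>y. z y t) has_real_derivative zx) (at x within {l..x}) \<and>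
     ((\<lambda>s. z x s) has_real_derivative zt) (at t within {s..t}) \<and>
     \<bar>zt + a x t * zx + b x t * z x t - F\<bar> \<le> R)"

lemma residual_leI:
  assumes "((\<lambda>y. z y t) has_real_derivative zx) (at x within {l..x})"
    "((\<lambda>s. z x s) has_real_derivative zt) (at t within {s..t})"
    "\<bar>zt + a x t * zx + b x t * z x t - F\<bar> \<le> R" "0 \<le> l" "l < x" "0 \<le> s" "s < t"
  shows "residual_le a b z F R x t"
  unfolding residual_le_def using assms by (intro bexI[of _ l] bexI[of _ s]) auto

lemma residual_le_mono:
  assumes "residual_le a b z F R x t" "\<bar>F - F'\<bar> + R \<le> R'"
  shows "residual_le a b z F' R' x t"
proof -
  from assms(1) obtain l s zx zt where "l \<in> {0..<x}" "s \<in> {0..<t}"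
    "((\<lambda>y. z y t) has_real_derivative zx) (at x within {l..x})"
    "((\<lambda>s. z x s) has_real_derivative zt) (at t within {s..t})"
    "\<bar>zt + a x t * zx + b x t * z x t - F\<bar> \<le> R" unfolding residual_le_def by blast
  moreover from this(5) have "\<bar>zt + a x t * zx + b x t * z x t - F'\<bar> \<le> R'" using assms(2) by linarith
  ultimately show ?thesis by (auto intro: residual_leI)
qed

lemma residual_le_add:
  assumes "residual_le a b z F R x t" "residual_le a b w F' R' x t"
  shows "residual_le a b (\<lambda>x t. z x t + w x t) (F + F') (R + R') x t"
proof -
  from assms(1) obtain l s zx zt where z: "l \<in> {0..<x}" "s \<in> {0..<t}"
    "((\<lambda>y. z y t) has_real_derivative zx) (at x within {l..x})"
    "((\<lambda>s. z x s) has_real_derivative zt) (at t within {s..t})"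
    "\<bar>zt + a x t * zx + b x t * z x t - F\<bar> \<le> R" unfolding residual_le_def by blast
  from assms(2) obtain l' s' wx wt where w: "l' \<in> {0..<x}" "s' \<in> {0..<t}"
    "((\<lambda>y. w y t) has_real_derivative wx) (at x within {l'..x})"
    "((\<lambda>s. w x s) has_real_derivative wt) (at t within {s'..t})"
    "\<bar>wt + a x t * wx + b x t * w x t - F'\<bar> \<le> R'" unfolding residual_le_def by blast
  show ?thesis
  proof (rule residual_leI[where l="max l l'" and s="max s s'"])
    show "((\<lambda>y. z y t + w y t) has_real_derivative zx + wx) (at x within {max l l'..x})"
      by (intro DERIV_add has_field_derivative_subset[OF z(3)] has_field_derivative_subset[OF w(3)]) auto
    show "((\<lambda>s. z x s + w x s) has_real_derivative zt + wt) (at t within {max s s'..t})"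
      by (intro DERIV_add has_field_derivative_subset[OF z(4)] has_field_derivative_subset[OF w(4)]) auto
    have "zt + wt + a x t * (zx + wx) + b x t * (z x t + w x t) - (F + F')
      = (zt + a x t * zx + b x t * z x t - F) + (wt + a x t * wx + b x t * w x t - F')"
      by (simp add: algebra_simps)
    then show "\<bar>zt + wt + a x t * (zx + wx) + b x t * (z x t + w x t) - (F + F')\<bar> \<le> R + R'"
      using z(5) w(5) by linarith
  qed (use z w in auto)
qed

lemma residual_le_minus:
  assumes "residual_le a b z F R x t"
  shows "residual_le a b (\<lambda>x t. - z x t) (- F) R x t"
proof -
  from assms obtain l s zx zt where z: "l \<in> {0..<x}" "s \<in> {0..<t}"
    "((\<lambda>y. z y t) has_real_derivative zx) (at x within {l..x})"
    "((\<lambda>s. z x s) has_real_derivative zt) (at t within {s..t})"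
    "\<bar>zt + a x t * zx + b x t * z x t - F\<bar> \<le> R" unfolding residual_le_def by blast
  show ?thesis
    by (rule residual_leI[OF DERIV_minus[OF z(3)] DERIV_minus[OF z(4)]]) (use z in auto)
qed

lemma bil_residual:
  assumes sx: "\<And>i. i < n \<Longrightarrow> xs i < xs (Suc i)" and st: "\<And>j. j < m \<Longrightarrow> ts j < ts (Suc j)"
    and i: "i < n" "xs i < x" "x \<le> xs (Suc i)" and j: "j < m" "ts j < t" "t \<le> ts (Suc j)"
    and ab: "mixed_lipschitz L T A a" "mixed_lipschitz L T A b"
    and rect: "0 \<le> xs i" "xs (Suc i) \<le> L" "0 \<le> ts j" "ts (Suc j) \<le> T"
    and eq: "upw (\<lambda>i j. a (xs i) (ts j)) (\<lambda>i j. b (xs i) (ts j)) xs ts Y i j = F"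
    and Q: "\<bar>diff_x xs Y i j\<bar> \<le> r" "\<bar>diff_x xs Y i (Suc j)\<bar> \<le> r"
    and P: "\<bar>diff_t ts Y i j\<bar> \<le> r" "\<bar>diff_t ts Y (Suc i) j\<bar> \<le> r"
    and S: "\<bar>diff_x xs (diff_t ts Y) i j\<bar> \<le> s"
    and w: "\<bar>Y i j\<bar> \<le> w" "\<bar>Y (Suc i) j\<bar> \<le> w" "\<bar>Y i (Suc j)\<bar> \<le> w" "\<bar>Y (Suc i) (Suc j)\<bar> \<le> w"
  defines "h \<equiv> xs (Suc i) - xs i" and "k \<equiv> ts (Suc j) - ts j"
  shows "residual_le a b (bil xs ts n m Y) F ((h + A * k) * s + A * (h + k) * (2 * r + w)) x t"
proof -
  have hk: "0 < h" "0 < k" using sx[OF i(1)] st[OF j(1)] by (auto simp: h_def k_def)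
  define p q where "p = (x - xs i) / h" and "q = (t - ts j) / k"
  have pq: "0 \<le> p" "p \<le> 1" "0 \<le> q" "q \<le> 1" using i j hk by (auto simp: p_def q_def h_def k_def)
  define zx where "zx = (1 - q) * ((Y (Suc i) j - Y i j) / h) + q * ((Y (Suc i) (Suc j) - Y i (Suc j)) / h)"
  define zt where "zt = (1 - p) * ((Y i (Suc j) - Y i j) / k) + p * ((Y (Suc i) (Suc j) - Y (Suc i) j) / k)"
  have cell: "bil xs ts n m Y y s = corner_mean ((y - xs i) / h) ((s - ts j) / k) (Y i j) (Y (Suc i) j) (Y i (Suc j)) (Y (Suc i) (Suc j))"
    if "xs i \<le> y" "y \<le> xs (Suc i)" "ts j \<le> s" "s \<le> ts (Suc j)" for y s
    unfolding h_def k_def by (rule bil_cell[OF sx st i(1) that(1,2) j(1) that(3,4)])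
  show ?thesis
  proof (rule residual_leI[where l="xs i" and s="ts j"])
    show "((\<lambda>y. bil xs ts n m Y y t) has_real_derivative zx) (at x within {xs i..x})"
    proof (rule has_field_derivative_transform_within[OF _ zero_less_one])
      show "((\<lambda>y. corner_mean ((y - xs i) / h) q (Y i j) (Y (Suc i) j) (Y i (Suc j)) (Y (Suc i) (Suc j)))
         has_real_derivative zx) (at x within {xs i..x})"
        unfolding corner_mean_def zx_def using hk
        by (auto intro!: derivative_eq_intros simp: field_simps)
    qed (use i j cell in \<open>auto simp: q_def\<close>)
    show "((\<lambda>s. bil xs ts n m Y x s) has_real_derivative zt) (at t within {ts j..t})"
    proof (rule has_field_derivative_transform_within[OF _ zero_less_one])
      show "((\<lambda>s. corner_mean p ((s - ts j) / k) (Y i j) (Y (Suc i) j) (Y i (Suc j)) (Y (Suc i) (Suc j)))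
         has_real_derivative zt) (at t within {ts j..t})"
        unfolding corner_mean_def zt_def using hk
        by (auto intro!: derivative_eq_intros simp: field_simps)
    qed (use i j cell in \<open>auto simp: p_def\<close>)
    have bl: "bil xs ts n m Y x t = corner_mean p q (Y i j) (Y (Suc i) j) (Y i (Suc j)) (Y (Suc i) (Suc j))"
      using cell[of x t] i j by (simp add: p_def q_def)
    have in_rect: "x \<in> {0..L}" "t \<in> {0..T}" "xs (Suc i) \<in> {0..L}" "ts (Suc j) \<in> {0..T}"
      using i j rect by auto
    have lip: "\<bar>c x t - c (xs (Suc i)) (ts (Suc j))\<bar> \<le> A * (h + k)" "\<bar>c x t\<bar> \<le> A" "\<bar>c (xs (Suc i)) (ts (Suc j))\<bar> \<le> A"
      if c: "mixed_lipschitz L T A c" for c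
    proof -
      show "\<bar>c x t\<bar> \<le> A" and "\<bar>c (xs (Suc i)) (ts (Suc j))\<bar> \<le> A"
        using c in_rect unfolding mixed_lipschitz_def by blast+
      then have A: "0 \<le> A" by linarith
      have "\<bar>c x t - c (xs (Suc i)) t\<bar> \<le> A * \<bar>x - xs (Suc i)\<bar>"
        "\<bar>c (xs (Suc i)) t - c (xs (Suc i)) (ts (Suc j))\<bar> \<le> A * \<bar>t - ts (Suc j)\<bar>"
        using c in_rect unfolding mixed_lipschitz_def by blast+
      moreover have "A * \<bar>x - xs (Suc i)\<bar> \<le> A * h" "A * \<bar>t - ts (Suc j)\<bar> \<le> A * k"
        using A i j by (auto intro!: mult_left_mono simp: h_def k_def)
      ultimately show "\<bar>c x t - c (xs (Suc i)) (ts (Suc j))\<bar> \<le> A * (h + k)" by (simp add: distrib_left)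
    qed
    show "\<bar>zt + a x t * zx + b x t * bil xs ts n m Y x t - F\<bar> \<le> (h + A * k) * s + A * (h + k) * (2 * r + w)"
      unfolding zx_def zt_def bl
    proof (rule bilinear_residual[OF hk pq _ lip(1)[OF ab(1)] lip(1)[OF ab(2)] lip(2)[OF ab(1)] lip(3)[OF ab(2)] _ _ _ _ _ w])
      show "(Y (Suc i) (Suc j) - Y (Suc i) j) / k + a (xs (Suc i)) (ts (Suc j)) * ((Y (Suc i) (Suc j) - Y i (Suc j)) / h)
        + b (xs (Suc i)) (ts (Suc j)) * Y (Suc i) (Suc j) = F"
        using eq by (simp add: upw_def diff_x_def diff_t_def h_def k_def)
    qed (use Q P S in \<open>auto simp: diff_x_def diff_t_def h_def k_def\<close>)
  qed (use rect i j in auto)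
qed

section \<open>Comparison principle for the transport operator\<close>

lemma left_derivative_at_max_nonneg:
  fixes g :: "real \<Rightarrow> real"
  assumes d: "(g has_real_derivative d) (at x within {l..x})" and "l < x" "p < x"
    and max: "\<And>y. p \<le> y \<Longrightarrow> y \<le> x \<Longrightarrow> g y \<le> g x"
  shows "0 \<le> d"
proof (rule ccontr)
  assume "\<not> 0 \<le> d"
  then obtain e where e: "e > 0" "\<And>h. h > 0 \<Longrightarrow> x - h \<in> {l..x} \<Longrightarrow> h < e \<Longrightarrow> g x < g (x - h)"
    using has_real_derivative_neg_dec_left[OF d] by auto
  define h where "h = min (e / 2) (min (x - l) (x - p))"
  have "0 < h" "h < e" "h \<le> x - l" "h \<le> x - p" using e(1) assms(2,3) by (auto simp: h_def)
  then show False using e(2)[of h] max[of "x - h"] by auto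
qed

text \<open>
  At a positive maximum of \<open>z - B - d t\<close> away from the inflow and initial lines the left derivatives are
  nonnegative, which makes \<open>z\<^sub>t + a z\<^sub>x + b z\<close> exceed \<open>\<alpha> B'\<close> by at least \<open>d\<close>.
\<close>

lemma transport_comparison_upper:
  fixes z :: "real \<Rightarrow> real \<Rightarrow> real"
  assumes cont: "continuous_on ({p..q} \<times> {0..T}) (\<lambda>(x, t). z x t)"
    and alpha: "0 \<le> \<alpha>"
    and B: "\<And>x. (B has_real_derivative B' x) (at x)" and B0: "\<And>x. x \<in> {p..q} \<Longrightarrow> 0 \<le> B x"
    and B1: "\<And>x. x \<in> {p..q} \<Longrightarrow> 0 \<le> B' x"
    and a: "\<And>x t. x \<in> {p..q} \<Longrightarrow> t \<in> {0..T} \<Longrightarrow> \<alpha> \<le> a x t"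
    and b: "\<And>x t. x \<in> {p..q} \<Longrightarrow> t \<in> {0..T} \<Longrightarrow> 0 \<le> b x t"
    and int: "\<And>x t. x \<in> {p<..q} \<Longrightarrow> t \<in> {0<..T} \<Longrightarrow> residual_le a b z 0 (\<alpha> * B' x) x t"
    and bx: "\<And>t. t \<in> {0..T} \<Longrightarrow> z p t \<le> B p" and bt: "\<And>x. x \<in> {p..q} \<Longrightarrow> z x 0 \<le> B x"
    and xt: "x \<in> {p..q}" "t \<in> {0..T}"
  shows "z x t \<le> B x"
proof (rule ccontr)
  assume "\<not> z x t \<le> B x"
  define d where "d = (z x t - B x) / (1 + t)"
  have t0: "0 < 1 + t" using xt by simp
  have d: "0 < d" using \<open>\<not> z x t \<le> B x\<close> t0 by (simp add: d_def)
  have "t * d < (1 + t) * d" using d by simp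
  also have "\<dots> = z x t - B x" using t0 by (simp add: d_def)
  finally have pos: "0 < z x t - B x - d * t" by (simp add: mult.commute)
  let ?g = "\<lambda>(x, t). z x t - B x - d * t"
  have cB: "continuous_on UNIV B" using B by (intro continuous_at_imp_continuous_on ballI DERIV_isCont) blast
  have "continuous_on ({p..q} \<times> {0..T}) ?g"
    using cont unfolding case_prod_unfold
    by (intro continuous_intros continuous_on_compose2[OF cB]) auto
  then obtain m where m: "m \<in> {p..q} \<times> {0..T}" "\<And>y. y \<in> {p..q} \<times> {0..T} \<Longrightarrow> ?g y \<le> ?g m"
    using continuous_attains_sup[of "{p..q} \<times> {0..T}" ?g] xt by (force intro: compact_Times)
  obtain X S where mX: "m = (X, S)" by (cases m)
  have X: "X \<in> {p..q}" and S: "S \<in> {0..T}" using m mX by auto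
  have max: "z y s - B y - d * s \<le> z X S - B X - d * S" if "y \<in> {p..q}" "s \<in> {0..T}" for y s
    using m(2)[of "(y, s)"] that mX by simp
  have gpos: "0 < z X S - B X - d * S" using max[OF xt] pos by simp
  have dS: "0 \<le> d * S" using d S by simp
  have "X \<noteq> p" using bx[OF S] gpos dS by auto
  moreover have "S \<noteq> 0" using bt[OF X] gpos by auto
  ultimately have XS: "X \<in> {p<..q}" "S \<in> {0<..T}" using X S by auto
  from int[OF this] obtain zx zt l s where ls: "l < X" "s < S"
    and zx: "((\<lambda>y. z y S) has_real_derivative zx) (at X within {l..X})"
    and zt: "((\<lambda>s. z X s) has_real_derivative zt) (at S within {s..S})"
    and le: "zt + a X S * zx + b X S * z X S \<le> \<alpha> * B' X"
    unfolding residual_le_def by (force dest: abs_le_D1)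
  have "0 \<le> zx - B' X"
  proof (rule left_derivative_at_max_nonneg[where g="\<lambda>y. z y S - B y" and p=p])
    show "((\<lambda>y. z y S - B y) has_real_derivative zx - B' X) (at X within {l..X})"
      by (intro DERIV_diff zx DERIV_subset[OF B]) auto
    show "z y S - B y \<le> z X S - B X" if "p \<le> y" "y \<le> X" for y using max[of y S] that X S by auto
  qed (use XS ls in auto)
  moreover have "0 \<le> zt - d"
  proof (rule left_derivative_at_max_nonneg[where g="\<lambda>s. z X s - d * s" and p=0])
    show "((\<lambda>s. z X s - d * s) has_real_derivative zt - d) (at S within {s..S})"
      by (rule derivative_eq_intros zt refl | simp)+
    show "z X y - d * y \<le> z X S - d * S" if "0 \<le> y" "y \<le> S" for y using max[of X y] that X S by auto
  qed (use XS ls in auto)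
  moreover have "a X S * B' X \<le> a X S * zx"
    using calculation(1) a[OF X S] alpha by (intro mult_left_mono) auto
  moreover have "0 \<le> b X S * z X S" using b[OF X S] gpos dS B0[OF X] by (intro mult_nonneg_nonneg) auto
  moreover have "\<alpha> * B' X \<le> a X S * B' X" using a[OF X S] B1[OF X] by (rule mult_right_mono)
  ultimately show False using le d by linarith
qed

lemma transport_comparison:
  fixes z :: "real \<Rightarrow> real \<Rightarrow> real"
  assumes cont: "continuous_on ({p..q} \<times> {0..T}) (\<lambda>(x, t). z x t)"
    and alpha: "0 \<le> \<alpha>"
    and B: "\<And>x. (B has_real_derivative B' x) (at x)" and B0: "\<And>x. x \<in> {p..q} \<Longrightarrow> 0 \<le> B x"
    and B1: "\<And>x. x \<in> {p..q} \<Longrightarrow> 0 \<le> B' x"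
    and a: "\<And>x t. x \<in> {p..q} \<Longrightarrow> t \<in> {0..T} \<Longrightarrow> \<alpha> \<le> a x t"
    and b: "\<And>x t. x \<in> {p..q} \<Longrightarrow> t \<in> {0..T} \<Longrightarrow> 0 \<le> b x t"
    and int: "\<And>x t. x \<in> {p<..q} \<Longrightarrow> t \<in> {0<..T} \<Longrightarrow> residual_le a b z 0 (\<alpha> * B' x) x t"
    and bx: "\<And>t. t \<in> {0..T} \<Longrightarrow> \<bar>z p t\<bar> \<le> B p" and bt: "\<And>x. x \<in> {p..q} \<Longrightarrow> \<bar>z x 0\<bar> \<le> B x"
    and xt: "x \<in> {p..q}" "t \<in> {0..T}"
  shows "\<bar>z x t\<bar> \<le> B x"
proof -
  have "z x t \<le> B x"
    by (rule transport_comparison_upper[OF cont alpha B B0 B1 a b int _ _ xt])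
      (use bx bt in \<open>auto intro: abs_le_D1\<close>)
  moreover have "- z x t \<le> B x"
  proof (rule transport_comparison_upper[of p q T "\<lambda>x t. - z x t", OF _ alpha B B0 B1 a b _ _ _ xt])
    show "continuous_on ({p..q} \<times> {0..T}) (\<lambda>(x, t). - z x t)"
      using cont unfolding case_prod_unfold by (intro continuous_intros)
    show "residual_le a b (\<lambda>x t. - z x t) 0 (\<alpha> * B' x) x t" if "x \<in> {p<..q}" "t \<in> {0<..T}" for x t
      using residual_le_minus[OF int[OF that]] by simp
  qed (use bx bt in \<open>auto intro: abs_le_D2\<close>)
  ultimately show ?thesis by linarith
qed


section \<open>Upwind solutions and the layer-adapted meshes\<close>

text \<open>
  The scheme is explicit along the cells: each equation determines the value at one new corner.
\<close>

fun upwind_solution :: "(nat \<Rightarrow> nat \<Rightarrow> real) \<Rightarrow> (nat \<Rightarrow> nat \<Rightarrow> real) \<Rightarrow> (nat \<Rightarrow> real) \<Rightarrow> (nat \<Rightarrow> real) \<Rightarrow>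
    (nat \<Rightarrow> nat \<Rightarrow> real) \<Rightarrow> nat \<Rightarrow> nat \<Rightarrow> real" where
  "upwind_solution a b xs ts F 0 j = 0"
| "upwind_solution a b xs ts F (Suc i) 0 = 0"
| "upwind_solution a b xs ts F (Suc i) (Suc j) =
    (upwind_solution a b xs ts F (Suc i) j / (ts (Suc j) - ts j)
      + a (Suc i) (Suc j) / (xs (Suc i) - xs i) * upwind_solution a b xs ts F i (Suc j) + F (Suc i) (Suc j))
    / (1 / (ts (Suc j) - ts j) + a (Suc i) (Suc j) / (xs (Suc i) - xs i) + b (Suc i) (Suc j))"

lemma upwind_solution_initial: "upwind_solution a b xs ts F i 0 = 0"
  by (cases i) auto

lemma upw_upwind_solution:
  assumes "xs i < xs (Suc i)" "ts j < ts (Suc j)" "0 < a (Suc i) (Suc j)" "0 \<le> b (Suc i) (Suc j)"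
  shows "upw a b xs ts (upwind_solution a b xs ts F) i j = F (Suc i) (Suc j)"
proof -
  define h k aa bb where "h = xs (Suc i) - xs i" and "k = ts (Suc j) - ts j"
    and "aa = a (Suc i) (Suc j)" and "bb = b (Suc i) (Suc j)"
  define y0 y1 where "y0 = upwind_solution a b xs ts F (Suc i) j"
    and "y1 = upwind_solution a b xs ts F i (Suc j)"
  define y where "y = upwind_solution a b xs ts F (Suc i) (Suc j)"
  have pos: "0 < h" "0 < k" "0 < aa" "0 \<le> bb" using assms by (auto simp: h_def k_def aa_def bb_def)
  then have D: "0 < 1 / k + aa / h + bb" by (simp add: add_pos_pos add_pos_nonneg)
  have "y = (y0 / k + aa / h * y1 + F (Suc i) (Suc j)) / (1 / k + aa / h + bb)"
    by (simp add: y_def y0_def y1_def h_def k_def aa_def bb_def)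
  then have "(1 / k + aa / h + bb) * y = y0 / k + aa / h * y1 + F (Suc i) (Suc j)" using D by simp
  then have "(y - y0) / k + aa * ((y - y1) / h) + bb * y = F (Suc i) (Suc j)"
    by (simp add: diff_divide_distrib algebra_simps)
  then show ?thesis unfolding upw_def diff_x_def diff_t_def h_def[symmetric] k_def[symmetric]
      aa_def[symmetric] bb_def[symmetric] y_def[symmetric] y0_def[symmetric] y1_def[symmetric] .
qed

lemma ln_le_two_fifths:
  fixes x :: real
  assumes "0 < x"
  shows "ln x \<le> 2 / 5 * x"
proof -
  have "5 / 2 \<le> exp (1 :: real)" using exp_lower_Taylor_quadratic[of "1 :: real"] by simp
  then have "x \<le> exp 1 * (2 / 5 * x)" using assms by (simp add: field_simps)
  also have "\<dots> \<le> exp 1 * exp (2 / 5 * x - 1)"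
    using exp_ge_add_one_self[of "2 / 5 * x - 1"] by (intro mult_left_mono) auto
  also have "\<dots> = exp (2 / 5 * x)" by (simp add: exp_add[symmetric])
  finally show ?thesis using assms ln_le_cancel_iff[of x "exp (2 / 5 * x)"] by simp
qed

lemma ln_square_le:
  fixes x :: real
  assumes "1 \<le> x"
  shows "(ln x)^2 \<le> 4 * x"
proof -
  have "ln x = 2 * ln (sqrt x)" using assms by (simp add: ln_sqrt)
  also have "\<dots> \<le> 2 * sqrt x" using assms ln_le_minus_one[of "sqrt x"] by simp
  finally have "(ln x)^2 \<le> (2 * sqrt x)^2" using assms by (intro power_mono) auto
  then show ?thesis using assms by (simp add: power_mult_distrib)
qed

lemma ln_ge_half: "1 / 2 \<le> ln x" if "2 \<le> x" for x :: real
proof -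
  have "1 / 2 \<le> ln (2 :: real)" using ln_le_minus_one[of "1 / 2 :: real"] by (simp add: ln_div)
  also have "\<dots> \<le> ln x" using that by simp
  finally show ?thesis .
qed

text \<open>
  On the fine mesh \<open>k y\<^sup>2\<close> stays bounded, since \<open>y\<close> is of order \<open>ln N/N\<close> and \<open>k \<le> N\<close>. Hence the discrete
  exponential \<open>(1-y)\<^sup>k\<close> and \<open>exp (-k y)\<close> agree up to a constant factor.
\<close>

lemma one_minus_power_bounds:
  fixes y c :: real
  assumes y: "0 \<le> y" "y \<le> 4 / 5" and c: "real k * y^2 \<le> c"
  shows "(1 - y) ^ k \<le> exp (- (real k * y))" "exp (- (real k * y)) \<le> exp (5 * c) * (1 - y) ^ k"
proof -
  have "(1 - y) ^ k \<le> exp (- y) ^ k"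
    using exp_ge_add_one_self[of "- y"] y by (intro power_mono) auto
  then show "(1 - y) ^ k \<le> exp (- (real k * y))" by (simp add: exp_of_nat_mult[symmetric])
  have "exp (- (y + 5 * y^2)) \<le> 1 - y"
  proof -
    have "0 \<le> y^2 * (4 - 5 * y)" using y by simp
    then have "1 \<le> (1 + (y + 5 * y^2)) * (1 - y)" by (simp add: algebra_simps power2_eq_square)
    also have "\<dots> \<le> exp (y + 5 * y^2) * (1 - y)"
      using exp_ge_add_one_self[of "y + 5 * y^2"] y by (intro mult_right_mono) auto
    finally have "inverse (exp (y + 5 * y^2)) * 1
        \<le> inverse (exp (y + 5 * y^2)) * (exp (y + 5 * y^2) * (1 - y))"
      by (intro mult_left_mono) auto
    then show ?thesis unfolding exp_minus mult.assoc[symmetric] by simp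
  qed
  then have "exp (- (y + 5 * y^2)) ^ k \<le> (1 - y) ^ k" by (intro power_mono) auto
  then have "exp (- (real k * y)) * exp (- (5 * (real k * y^2))) \<le> (1 - y) ^ k"
    by (simp add: exp_of_nat_mult[symmetric] exp_add[symmetric] algebra_simps)
  moreover have "exp (- (real k * y)) * exp (- (5 * c)) \<le> exp (- (real k * y)) * exp (- (5 * (real k * y^2)))"
    using c by (intro mult_left_mono) auto
  ultimately have "exp (- (real k * y)) * exp (- (5 * c)) \<le> (1 - y) ^ k" by linarith
  then have "exp (5 * c) * (exp (- (real k * y)) * exp (- (5 * c))) \<le> exp (5 * c) * (1 - y) ^ k"
    by (intro mult_left_mono) auto
  moreover have "exp (5 * c) * (exp (- (real k * y)) * exp (- (5 * c))) = exp (- (real k * y))"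
    by (simp add: exp_add[symmetric])
  ultimately show "exp (- (real k * y)) \<le> exp (5 * c) * (1 - y) ^ k" by simp
qed

lemma one_plus_power_lower_bound:
  fixes y c :: real
  assumes y: "0 \<le> y" and c: "real k * y^2 \<le> c"
  shows "exp (real k * y) \<le> exp c * (1 + y) ^ k"
proof -
  have pos: "0 < 1 - y + y^2"
  proof -
    have "1 - y + y^2 = (y - 1 / 2)^2 + 3 / 4" by (simp add: power2_eq_square algebra_simps)
    then show ?thesis using zero_le_power2[of "y - 1 / 2"] by linarith
  qed
  have "1 - y + y^2 \<le> exp (- (y - y^2))"
    using exp_ge_add_one_self[of "- (y - y^2)"] by linarith
  then have "exp (y - y^2) * (1 - y + y^2) \<le> exp (y - y^2) * exp (- (y - y^2))"
    by (intro mult_left_mono) auto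
  also have "\<dots> = 1" by (simp add: exp_add[symmetric])
  also have "1 \<le> (1 + y) * (1 - y + y^2)"
    using y zero_le_power[of y 3] by (simp add: algebra_simps power2_eq_square power3_eq_cube)
  finally have "exp (y - y^2) \<le> 1 + y" using pos by simp
  then have "exp (y - y^2) ^ k \<le> (1 + y) ^ k" by (intro power_mono) auto
  then have "exp (real k * y - real k * y^2) \<le> (1 + y) ^ k"
    by (simp add: exp_of_nat_mult[symmetric] algebra_simps)
  then have "exp c * exp (real k * y - real k * y^2) \<le> exp c * (1 + y) ^ k" by (intro mult_left_mono) auto
  moreover have "exp (real k * y) \<le> exp c * exp (real k * y - real k * y^2)"
    using c by (simp add: exp_add[symmetric])
  ultimately show ?thesis by linarith
qed

lemma even_pos_double:
  assumes "even n" "0 < (n::nat)"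
  obtains n2 where "n = 2 * n2" "n div 2 = n2" "0 < n2"
  using assms by (metis dvd_mult_div_cancel nat_0_less_mult_iff)

lemma pw_mesh_step:
  assumes "even n" "0 < n"
  shows "i < n div 2 \<Longrightarrow> pw_mesh p R n (Suc i) - pw_mesh p R n i = 2 * p / n"
    "n div 2 \<le> i \<Longrightarrow> pw_mesh p R n (Suc i) - pw_mesh p R n i = 2 * (R - p) / n"
proof -
  obtain n2 where n: "n = 2 * n2" "n div 2 = n2" "0 < n2" using even_pos_double[OF assms] .
  show "i < n div 2 \<Longrightarrow> pw_mesh p R n (Suc i) - pw_mesh p R n i = 2 * p / n"
    using n by (simp add: pw_mesh_def field_simps)
  have "real n2 * (2 * p / real n) = p" using n by simp
  then show "n div 2 \<le> i \<Longrightarrow> pw_mesh p R n (Suc i) - pw_mesh p R n i = 2 * (R - p) / n"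
    using n by (auto simp: pw_mesh_def field_simps)
qed

lemma pw_mesh_points:
  assumes "even n" "0 < n"
  shows "pw_mesh p R n 0 = 0" "pw_mesh p R n (n div 2) = p" "pw_mesh p R n n = R"
    "i \<le> n div 2 \<Longrightarrow> pw_mesh p R n i = p - real (n div 2 - i) * (2 * p / n)"
    "n div 2 \<le> i \<Longrightarrow> i \<le> n \<Longrightarrow> pw_mesh p R n i = R - real (n - i) * (2 * (R - p) / n)"
proof -
  obtain n2 where n: "n = 2 * n2" "n div 2 = n2" "0 < n2" using even_pos_double[OF assms] .
  show "pw_mesh p R n 0 = 0" "pw_mesh p R n (n div 2) = p" "pw_mesh p R n n = R"
    "i \<le> n div 2 \<Longrightarrow> pw_mesh p R n i = p - real (n div 2 - i) * (2 * p / n)"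
    using n by (auto simp: pw_mesh_def field_simps of_nat_diff)
  show "n div 2 \<le> i \<Longrightarrow> i \<le> n \<Longrightarrow> pw_mesh p R n i = R - real (n - i) * (2 * (R - p) / n)"
    using n by (auto simp: pw_mesh_def field_simps of_nat_diff)
qed

text \<open>
  The solution of the backward difference equation for \<open>exp (-r t)\<close>.
\<close>

definition layer_decay :: "real \<Rightarrow> (nat \<Rightarrow> real) \<Rightarrow> nat \<Rightarrow> real" where
  "layer_decay r ts j = (\<Prod>l<j. 1 / (1 + r * (ts (Suc l) - ts l)))"

lemma layer_decay_step:
  assumes "0 < r" "ts j < ts (Suc j)"
  shows "(layer_decay r ts (Suc j) - layer_decay r ts j) / (ts (Suc j) - ts j) = - r * layer_decay r ts (Suc j)"
proof -
  define k where "k = ts (Suc j) - ts j"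
  have k: "0 < k" "0 < 1 + r * k" using assms by (auto simp: k_def add_pos_pos)
  have "layer_decay r ts (Suc j) = layer_decay r ts j / (1 + r * k)" by (simp add: layer_decay_def k_def)
  then have "layer_decay r ts j = layer_decay r ts (Suc j) * (1 + r * k)" using k by simp
  then show ?thesis using k unfolding k_def[symmetric] by (simp add: field_simps)
qed

lemma layer_decay_pos:
  assumes "0 < r" "\<And>l. l < j \<Longrightarrow> ts l < ts (Suc l)"
  shows "0 < layer_decay r ts j" "layer_decay r ts j \<le> 1"
proof -
  have "0 < 1 / (1 + r * (ts (Suc l) - ts l))" "1 / (1 + r * (ts (Suc l) - ts l)) \<le> 1" if "l < j" for l
    using assms(1) assms(2)[OF that] by (auto simp: add_pos_pos)
  then show "0 < layer_decay r ts j" "layer_decay r ts j \<le> 1"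
    unfolding layer_decay_def by (intro prod_pos prod_le_1; fastforce intro: less_imp_le)+
qed

lemma layer_decay_antimono:
  assumes "0 < r" "\<And>l. l < n \<Longrightarrow> ts l < ts (Suc l)" "i \<le> j" "j \<le> n"
  shows "layer_decay r ts j \<le> layer_decay r ts i"
  using assms(3,4)
proof (induction j rule: dec_induct)
  case (step j)
  have "0 < layer_decay r ts (Suc j)" using layer_decay_pos(1)[of r "Suc j" ts] assms(1,2) step by auto
  then have "(layer_decay r ts (Suc j) - layer_decay r ts j) / (ts (Suc j) - ts j) \<le> 0"
    using layer_decay_step[of r ts j] assms(1,2) step by simp
  then have "layer_decay r ts (Suc j) \<le> layer_decay r ts j"
    using assms(2)[of j] step by (simp add: divide_le_0_iff)
  then show ?case using step by simp
qed simp

lemma mesh_t_facts: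
  assumes "0 < T" "0 < C" "0 < \<epsilon>" "even M" "0 < M"
  shows "j < M \<Longrightarrow> mesh_t T C \<epsilon> M j < mesh_t T C \<epsilon> M (Suc j)"
    "j < M \<Longrightarrow> mesh_t T C \<epsilon> M (Suc j) - mesh_t T C \<epsilon> M j \<le> 2 * T / M"
    "mesh_t T C \<epsilon> M 0 = 0" "mesh_t T C \<epsilon> M M = T"
proof -
  let ?\<tau> = "mesh_tau T C \<epsilon> M"
  have M: "2 \<le> M" using assms by (auto elim: evenE)
  then have "0 < ln (real M)" by simp
  then have tau: "0 < ?\<tau>" "?\<tau> \<le> T / 2" using assms by (auto simp: mesh_tau_def)
  have "mesh_t T C \<epsilon> M (Suc j) - mesh_t T C \<epsilon> M j = 2 * ?\<tau> / M
    \<or> mesh_t T C \<epsilon> M (Suc j) - mesh_t T C \<epsilon> M j = 2 * (T - ?\<tau>) / M"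
    unfolding mesh_t_def using pw_mesh_step[OF assms(4,5), of j ?\<tau> T] by linarith
  moreover have "0 < 2 * ?\<tau> / M" "0 < 2 * (T - ?\<tau>) / M" using tau assms by auto
  moreover have "2 * ?\<tau> / M \<le> 2 * T / M" "2 * (T - ?\<tau>) / M \<le> 2 * T / M"
    using tau assms by (auto intro!: divide_right_mono)
  ultimately show "mesh_t T C \<epsilon> M j < mesh_t T C \<epsilon> M (Suc j)"
    "mesh_t T C \<epsilon> M (Suc j) - mesh_t T C \<epsilon> M j \<le> 2 * T / M" by auto
  show "mesh_t T C \<epsilon> M 0 = 0" "mesh_t T C \<epsilon> M M = T"
    unfolding mesh_t_def using pw_mesh_points[OF assms(4,5)] by auto
qed

text \<open>
  On the fine part of the mesh the step is itself of order \<open>\<epsilon> ln M/M\<close>. On the coarse part the step times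
  the decay function equals, by the difference equation, a multiple of \<open>\<epsilon>\<close> times a decrement of the decay
  function, which is already \<open>O(1/M)\<close> at \<open>\<tau>\<close>: with rate \<open>1/(C \<epsilon>)\<close> the choice
  \<open>\<tau> = C \<epsilon> ln M\<close> is just large enough.
\<close>

lemma mesh_t_layer_decay:
  fixes C T \<epsilon> :: real
  assumes pos: "0 < T" "0 < C" "0 < \<epsilon>" "even M" "0 < M" and j: "j < M"
  defines "ts \<equiv> mesh_t T C \<epsilon> M"
  shows "(ts (Suc j) - ts j) / \<epsilon> * layer_decay (1 / (C * \<epsilon>)) ts (Suc j) \<le> (2 * C + 2 * C * exp 8) * (ln M / M)"
proof -
  define r where "r = 1 / (C * \<epsilon>)"
  have r: "0 < r" using pos by (simp add: r_def)
  obtain M2 where M2: "M = 2 * M2" "M div 2 = M2" "0 < M2" using even_pos_double[OF pos(4,5)] .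
  have M: "2 \<le> M" using M2 by simp
  have lnM: "1 / 2 \<le> ln M" using ln_ge_half[of "real M"] M by simp
  have lnM': "ln M / M \<ge> 0" using lnM by simp
  have st: "l < M \<Longrightarrow> ts l < ts (Suc l)" for l unfolding ts_def by (rule mesh_t_facts(1)[OF pos])
  have th: "0 < layer_decay r ts l" "layer_decay r ts l \<le> 1" if "l \<le> M" for l
    using layer_decay_pos[OF r, of l ts] st that by auto
  have fine: "(ts (Suc j) - ts j) / \<epsilon> * layer_decay r ts (Suc j) \<le> (2 * C + 2 * C * exp 8) * (ln M / M)"
    if le: "ts (Suc j) - ts j \<le> 2 * (C * \<epsilon> * ln M) / M"
  proof -
    have "(ts (Suc j) - ts j) / \<epsilon> * layer_decay r ts (Suc j) \<le> (2 * (C * \<epsilon> * ln M) / M) / \<epsilon> * 1"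
      using le th[of "Suc j"] j pos st[OF j] lnM by (intro mult_mono divide_right_mono) auto
    also have "\<dots> = 2 * C * (ln M / M)" using pos by (simp add: field_simps)
    also have "\<dots> \<le> (2 * C + 2 * C * exp 8) * (ln M / M)" using pos lnM' by (intro mult_right_mono) auto
    finally show ?thesis .
  qed
  have "(ts (Suc j) - ts j) / \<epsilon> * layer_decay r ts (Suc j) \<le> (2 * C + 2 * C * exp 8) * (ln M / M)"
  proof (cases "T / 2 \<le> C * \<epsilon> * ln M")
    case True
    then have tau: "mesh_tau T C \<epsilon> M = T / 2" by (simp add: mesh_tau_def)
    have "ts (Suc j) - ts j = T / M"
      unfolding ts_def mesh_t_def tau using pw_mesh_step[OF pos(4,5), of j "T / 2" T]
      by (cases "j < M div 2") (auto simp: not_less)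
    also have "\<dots> \<le> 2 * (C * \<epsilon> * ln M) / M" using True by (intro divide_right_mono) auto
    finally show ?thesis by (rule fine)
  next
    case False
    then have tau: "mesh_tau T C \<epsilon> M = C * \<epsilon> * ln M" by (simp add: mesh_tau_def)
    have fstep: "ts (Suc l) - ts l = 2 * (C * \<epsilon> * ln M) / M" if "l < M2" for l
      unfolding ts_def mesh_t_def tau using pw_mesh_step(1)[OF pos(4,5), of l] M2 that by simp
    show ?thesis
    proof (cases "j < M2")
      case True
      then show ?thesis by (intro fine) (simp add: fstep)
    next
      case False
      define y where "y = 2 * ln M / M"
      have ry: "r * (2 * (C * \<epsilon> * ln M) / M) = y" using pos by (simp add: r_def y_def)
      have "layer_decay r ts M2 = (\<Prod>l<M2. 1 / (1 + y))"
        unfolding layer_decay_def by (intro prod.cong refl) (simp only: lessThan_iff fstep ry)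
      then have Th: "layer_decay r ts M2 = 1 / (1 + y) ^ M2" by (simp add: power_divide)
      have y0: "0 \<le> y" using lnM by (simp add: y_def)
      have "real M2 * y^2 = 2 * ((ln M)^2 / M)" using M2 by (simp add: y_def power2_eq_square field_simps)
      also have "(ln M)^2 / M \<le> 4" using ln_square_le[of "real M"] M by (simp add: field_simps)
      finally have "real M2 * y^2 \<le> 8" by simp
      from one_plus_power_lower_bound[OF y0 this] have "exp (real M2 * y) \<le> exp 8 * (1 + y) ^ M2" .
      moreover have "real M2 * y = ln M" using M2 by (simp add: y_def)
      ultimately have "real M \<le> exp 8 * (1 + y) ^ M2" using M by simp
      then have Thle: "layer_decay r ts M2 \<le> exp 8 / M"
        unfolding Th using M y0 by (simp add: field_simps)
      have "layer_decay r ts j \<le> exp 8 / M"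
        using layer_decay_antimono[of r M ts M2 j] r st Thle False j by simp
      moreover have "(ts (Suc j) - ts j) * (r * layer_decay r ts (Suc j)) = layer_decay r ts j - layer_decay r ts (Suc j)"
        using layer_decay_step[of r ts j] r st[OF j] by (simp add: field_simps)
      moreover have "0 < layer_decay r ts (Suc j)" using th j by simp
      ultimately have "(ts (Suc j) - ts j) * (r * layer_decay r ts (Suc j)) \<le> exp 8 / M" by linarith
      then have "C * ((ts (Suc j) - ts j) * (r * layer_decay r ts (Suc j))) \<le> C * (exp 8 / M)"
        using pos by (intro mult_left_mono) auto
      moreover have "C * ((ts (Suc j) - ts j) * (r * layer_decay r ts (Suc j))) = (ts (Suc j) - ts j) / \<epsilon> * layer_decay r ts (Suc j)"
        using pos by (simp add: r_def)
      ultimately have "(ts (Suc j) - ts j) / \<epsilon> * layer_decay r ts (Suc j) \<le> C * exp 8 / M" by simp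
      also have "C * exp 8 / M = 2 * C * exp 8 * (1 / 2 / M)" by simp
      also have "\<dots> \<le> 2 * C * exp 8 * (ln M / M)"
        using pos lnM by (intro mult_left_mono divide_right_mono) auto
      also have "\<dots> \<le> (2 * C + 2 * C * exp 8) * (ln M / M)" using pos lnM' by (intro mult_right_mono) auto
      finally show ?thesis .
    qed
  qed
  then show ?thesis by (simp add: r_def)
qed

lemma mesh_x_facts:
  assumes "0 < L" "0 < \<epsilon>" "even N" "0 < N"
  shows "i < N \<Longrightarrow> mesh_x L \<epsilon> N i < mesh_x L \<epsilon> N (Suc i)"
    "i < N \<Longrightarrow> mesh_x L \<epsilon> N (Suc i) - mesh_x L \<epsilon> N i \<le> 2 * L / N"
    "mesh_x L \<epsilon> N 0 = 0" "mesh_x L \<epsilon> N N = L" "mesh_x L \<epsilon> N (N div 2) = L - mesh_sigma L \<epsilon> N"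
    "0 < mesh_sigma L \<epsilon> N" "mesh_sigma L \<epsilon> N \<le> L / 2"
proof -
  let ?\<sigma> = "mesh_sigma L \<epsilon> N"
  have N: "2 \<le> N" using assms by (auto elim: evenE)
  then have "0 < ln (real N)" by simp
  then show s: "0 < ?\<sigma>" "?\<sigma> \<le> L / 2" using assms by (auto simp: mesh_sigma_def)
  have "mesh_x L \<epsilon> N (Suc i) - mesh_x L \<epsilon> N i = 2 * (L - ?\<sigma>) / N
    \<or> mesh_x L \<epsilon> N (Suc i) - mesh_x L \<epsilon> N i = 2 * ?\<sigma> / N"
    unfolding mesh_x_def using pw_mesh_step[OF assms(3,4), of i "L - ?\<sigma>" L]
    by (cases "i < N div 2") (auto simp: not_less)
  moreover have "0 < 2 * ?\<sigma> / N" "0 < 2 * (L - ?\<sigma>) / N" using s assms by auto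
  moreover have "2 * ?\<sigma> / N \<le> 2 * L / N" "2 * (L - ?\<sigma>) / N \<le> 2 * L / N"
    using s assms by (auto intro!: divide_right_mono)
  ultimately show "mesh_x L \<epsilon> N i < mesh_x L \<epsilon> N (Suc i)"
    "mesh_x L \<epsilon> N (Suc i) - mesh_x L \<epsilon> N i \<le> 2 * L / N" by auto
  show "mesh_x L \<epsilon> N 0 = 0" "mesh_x L \<epsilon> N N = L" "mesh_x L \<epsilon> N (N div 2) = L - ?\<sigma>"
    unfolding mesh_x_def using pw_mesh_points(1-3)[OF assms(3,4)] by (auto simp only:)
qed

text \<open>
  The first bound says that fitting increases the convection coefficient; the second one that the fitted
  coefficient divided by \<open>H\<close> is at least \<open>1/\<epsilon>\<close>, as if the mesh width were \<open>\<epsilon>\<close>.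
\<close>

lemma fitting_factor:
  fixes \<rho> :: real
  assumes "0 < \<rho>"
  shows "1 \<le> \<rho> / (1 - exp (- \<rho>))" "\<rho> \<le> \<rho> / (1 - exp (- \<rho>))"
proof -
  have "0 < 1 - exp (- \<rho>)" "1 - exp (- \<rho>) \<le> \<rho>" "1 - exp (- \<rho>) \<le> 1"
    using assms exp_ge_add_one_self[of "- \<rho>"] by (auto)
  then show "1 \<le> \<rho> / (1 - exp (- \<rho>))" "\<rho> \<le> \<rho> / (1 - exp (- \<rho>))"
    using assms by (auto simp: field_simps)
qed


section \<open>The layer-free part of the solution\<close>

text \<open>
  The data that do not depend on \<open>\<epsilon>\<close>, with a common bound \<open>A\<close>.
\<close>

locale transport_data =
  fixes L T \<alpha> C\<^sub>1 C\<^sub>2 A :: real and a b :: "real \<Rightarrow> real \<Rightarrow> real" and \<phi> \<psi> :: "real \<Rightarrow> real"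
  assumes L_pos: "0 < L" and T_pos: "0 < T" and alpha_pos: "0 < \<alpha>" and C2_gt: "1 / \<alpha> < C\<^sub>2" and A_ge: "1 \<le> A"
    and a_ge: "x \<in> {0..L} \<Longrightarrow> t \<in> {0..T} \<Longrightarrow> \<alpha> \<le> a x t"
    and b_ge: "x \<in> {0..L} \<Longrightarrow> t \<in> {0..T} \<Longrightarrow> 0 \<le> b x t"
    and a_lip: "mixed_lipschitz L T A a" and b_lip: "mixed_lipschitz L T A b"
    and phi_C2: "Ck_on 2 {0..L} \<phi>" and psi_C2: "Ck_on 2 {0..T} \<psi>"
    and phi_lip: "x \<in> {0..L} \<Longrightarrow> y \<in> {0..L} \<Longrightarrow> \<bar>\<phi> x - \<phi> y\<bar> \<le> A * \<bar>x - y\<bar>"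
    and psi_lip: "t \<in> {0..T} \<Longrightarrow> s \<in> {0..T} \<Longrightarrow> \<bar>\<psi> t - \<psi> s\<bar> \<le> A * \<bar>t - s\<bar>"
    and phi'_lip: "x \<in> {0..L} \<Longrightarrow> y \<in> {0..L} \<Longrightarrow> \<bar>deriv_on {0..L} \<phi> x - deriv_on {0..L} \<phi> y\<bar> \<le> A * \<bar>x - y\<bar>"
    and psi'_lip: "t \<in> {0..T} \<Longrightarrow> s \<in> {0..T} \<Longrightarrow> \<bar>deriv_on {0..T} \<psi> t - deriv_on {0..T} \<psi> s\<bar> \<le> A * \<bar>t - s\<bar>"
    and G_lip: "mixed_lipschitz L T A (\<lambda>x t. deriv_on {0..T} \<psi> t + a x t * deriv_on {0..L} \<phi> x
        + b x t * (\<phi> x + \<psi> t - \<phi> 0))"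
begin

definition g :: "real \<Rightarrow> real \<Rightarrow> real" where "g x t = \<phi> x + \<psi> t - \<phi> 0"

definition G :: "real \<Rightarrow> real \<Rightarrow> real" where
  "G x t = deriv_on {0..T} \<psi> t + a x t * deriv_on {0..L} \<phi> x + b x t * g x t"

text \<open>
  The constants of the error estimates; none of them depends on \<open>\<epsilon>\<close> or on the mesh. \<open>r\<close> bounds first
  difference quotients, \<open>reg_const\<close> the residual of the layer-free part, \<open>weight_const\<close> the exponential weight on the
  layer mesh, \<open>coarse_const\<close> the remainder on the coarse mesh, \<open>split_const\<close> its deviation from the layer
  part on the fine mesh.
\<close>

definition r :: real where "r = const_P \<alpha> A T + const_Q \<alpha> A T"

definition reg_const :: real where
  "reg_const = (1 + A) * (const_S \<alpha> A T L * A) + A * (2 * (r * A) + T * A + 1)"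

definition weight_const :: real where "weight_const = (2 * C\<^sub>1 + 1) * exp 80"

definition coarse_const :: real where
  "coarse_const = A^2 * (2 * (L + T)) / \<alpha> * L + 2 * (C\<^sub>1 / \<alpha>) + (A + r * A) * (2 * L)"

definition split_const :: real where
  "split_const = 2 * coarse_const + 4 * A^2 * (L + T) * L / \<alpha> + C\<^sub>1 / \<alpha> + 4 * L * (A + r * A) + 2 * (r * weight_const)"

lemma A_pos: "0 < A" using A_ge by simp

lemma G_mixed_lipschitz: "mixed_lipschitz L T A G"
  using G_lip unfolding G_def g_def by simp

lemma C2_pos: "0 < C\<^sub>2"
  using C2_gt alpha_pos by (meson less_trans zero_less_divide_1_iff)

lemma const_r: "0 \<le> const_P \<alpha> A T" "0 \<le> const_Q \<alpha> A T" "const_P \<alpha> A T \<le> r" "const_Q \<alpha> A T \<le> r" "0 \<le> r"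
proof -
  show 1: "0 \<le> const_P \<alpha> A T" by (simp add: const_P_def)
  then show 2: "0 \<le> const_Q \<alpha> A T" using A_pos alpha_pos T_pos by (simp add: const_Q_def)
  show "const_P \<alpha> A T \<le> r" "const_Q \<alpha> A T \<le> r" "0 \<le> r" using 1 2 by (auto simp: r_def)
qed

lemma zero_data_scheme_upwind:
  assumes x: "\<And>i. i < n \<Longrightarrow> xs i < xs (Suc i)" "\<And>i. i \<le> n \<Longrightarrow> xs i \<in> {0..L}"
    and t: "\<And>j. j < m \<Longrightarrow> ts j < ts (Suc j)" "\<And>j. j \<le> m \<Longrightarrow> ts j \<in> {0..T}"
    and e: "1 \<le> e" and E: "\<And>i. i \<le> n \<Longrightarrow> 0 < E i" "\<And>i. i < n \<Longrightarrow> E i \<le> E (Suc i)"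
    and F: "F 0 0 = 0" "\<And>i j. i \<le> n \<Longrightarrow> j \<le> m \<Longrightarrow> \<bar>F i j\<bar> \<le> e * E i"
      "\<And>i j. i \<le> n \<Longrightarrow> j < m \<Longrightarrow> \<bar>diff_t ts F i j\<bar> \<le> e * E i"
      "\<And>i j. i < n \<Longrightarrow> j \<le> m \<Longrightarrow> \<bar>diff_x xs F i j\<bar> \<le> e^2 * E (Suc i)"
      "\<And>i j. i < n \<Longrightarrow> j < m \<Longrightarrow> \<bar>diff_x xs (diff_t ts F) i j\<bar> \<le> e^2 * E (Suc i)"
  shows "zero_data_scheme (\<lambda>i j. a (xs i) (ts j)) (\<lambda>i j. b (xs i) (ts j)) xs ts n m \<alpha> A L T e E F
    (upwind_solution (\<lambda>i j. a (xs i) (ts j)) (\<lambda>i j. b (xs i) (ts j)) xs ts F)"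
proof
  note q = mixed_lipschitz_mesh_quotients
  fix i j
  show "i < n \<Longrightarrow> xs i < xs (Suc i)" "j < m \<Longrightarrow> ts j < ts (Suc j)" "0 < \<alpha>" "0 \<le> A" "1 \<le> e"
    using x t alpha_pos A_pos e by auto
  show "i \<le> n \<Longrightarrow> 0 \<le> xs i \<and> xs i \<le> L" "j \<le> m \<Longrightarrow> 0 \<le> ts j \<and> ts j \<le> T"
    using x(2)[of i] t(2)[of j] by auto
  show "i \<le> n \<Longrightarrow> j \<le> m \<Longrightarrow> \<alpha> \<le> a (xs i) (ts j)" "i \<le> n \<Longrightarrow> j \<le> m \<Longrightarrow> 0 \<le> b (xs i) (ts j)"
    using a_ge b_ge x(2) t(2) by auto
  show "i \<le> n \<Longrightarrow> j \<le> m \<Longrightarrow> b (xs i) (ts j) \<le> A"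
    using q(1)[of L T A b xs i ts j] b_lip x(2) t(2) by (auto intro: abs_le_D1)
  show "i \<le> n \<Longrightarrow> j < m \<Longrightarrow> \<bar>diff_t ts (\<lambda>i j. a (xs i) (ts j)) i j\<bar> \<le> A"
    "i \<le> n \<Longrightarrow> j < m \<Longrightarrow> \<bar>diff_t ts (\<lambda>i j. b (xs i) (ts j)) i j\<bar> \<le> A"
    by (rule q(2)[of L T A]; use x t a_lip b_lip in simp)+
  show "i < n \<Longrightarrow> j \<le> m \<Longrightarrow> \<bar>diff_x xs (\<lambda>i j. a (xs i) (ts j)) i j\<bar> \<le> A"
    "i < n \<Longrightarrow> j \<le> m \<Longrightarrow> \<bar>diff_x xs (\<lambda>i j. b (xs i) (ts j)) i j\<bar> \<le> A"
    by (rule q(3)[of L T A]; use x t a_lip b_lip in simp)+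
  show "i < n \<Longrightarrow> j < m \<Longrightarrow> \<bar>diff_x xs (diff_t ts (\<lambda>i j. a (xs i) (ts j))) i j\<bar> \<le> A"
    "i < n \<Longrightarrow> j < m \<Longrightarrow> \<bar>diff_x xs (diff_t ts (\<lambda>i j. b (xs i) (ts j))) i j\<bar> \<le> A"
    by (rule q(4)[of L T A]; use x t a_lip b_lip in simp)+
  assume "i < n" "j < m"
  then have "0 < a (xs (Suc i)) (ts (Suc j))" "0 \<le> b (xs (Suc i)) (ts (Suc j))"
    using a_ge[of "xs (Suc i)" "ts (Suc j)"] b_ge[of "xs (Suc i)" "ts (Suc j)"] alpha_pos
      x(2)[of "Suc i"] t(2)[of "Suc j"] by auto
  then show "upw (\<lambda>i j. a (xs i) (ts j)) (\<lambda>i j. b (xs i) (ts j)) xs ts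
      (upwind_solution (\<lambda>i j. a (xs i) (ts j)) (\<lambda>i j. b (xs i) (ts j)) xs ts F) i j = F (Suc i) (Suc j)"
    by (intro upw_upwind_solution x t \<open>i < n\<close> \<open>j < m\<close>)
qed (use E F in \<open>auto simp: upwind_solution_initial\<close>)

end

locale transport_instance = transport_data +
  fixes \<epsilon> :: real and f u :: "real \<Rightarrow> real \<Rightarrow> real" and N M :: nat and U :: "nat \<Rightarrow> nat \<Rightarrow> real" and V :: "real \<Rightarrow> real \<Rightarrow> real"
  assumes eps_pos: "0 < \<epsilon>" and eps_le: "\<epsilon> \<le> 1"
    and f_C2: "Ck_rect 2 L T f" and f_layer: "layer_forcing L T C\<^sub>1 \<epsilon> f"
    and compat: "compatible L T a b f \<phi> \<psi>"
    and u_sol: "transport_solution L T a b f \<phi> \<psi> u"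
    and N_even: "even N" and N_pos: "0 < N" and M_even: "even M" and M_pos: "0 < M"
    and U_sol: "discrete_solution L T C\<^sub>2 \<epsilon> a b f u N M U"
    and V_int: "bilinear_interpolant (mesh_x L \<epsilon> N) (mesh_t T C\<^sub>2 \<epsilon> M) N M U V"
begin

abbreviation "xs \<equiv> mesh_x L \<epsilon> N"
abbreviation "ts \<equiv> mesh_t T C\<^sub>2 \<epsilon> M"
abbreviation "am \<equiv> \<lambda>i j. a (xs i) (ts j)"
abbreviation "bm \<equiv> \<lambda>i j. b (xs i) (ts j)"

text \<open>
  Residuals and consistency errors of smooth functions are of order \<open>\<mu>\<close>; \<open>rate\<close> is the final rate.
\<close>

definition \<mu> :: real where "\<mu> = 1 / N + 1 / M"
definition rate :: real where "rate = ln N / N + ln M / M"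

definition Y :: "nat \<Rightarrow> nat \<Rightarrow> real" where
  "Y = upwind_solution am bm xs ts (\<lambda>i j. - G (xs i) (ts j))"

lemma NM_ge: "2 \<le> N" "2 \<le> M"
  using N_even N_pos M_even M_pos by (auto elim!: evenE)

lemma lnNM: "1 / 2 \<le> ln N" "1 / 2 \<le> ln M"
  using ln_ge_half[of "real N"] ln_ge_half[of "real M"] NM_ge by auto

lemma mu_lam: "0 < \<mu>" "\<mu> \<le> 2 * rate" "1 / N \<le> 2 * rate" "1 / N \<le> \<mu>" "1 / M \<le> \<mu>" "ln N / N \<le> rate" "ln M / M \<le> rate" "0 < rate"
proof -
  have n: "1 / 2 / N \<le> ln N / N" "1 / 2 / M \<le> ln M / M"
    using lnNM by (auto intro!: divide_right_mono simp del: divide_divide_eq_left)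
  have p: "0 < 1 / real N" "0 < 1 / real M" using N_pos M_pos by auto
  show "0 < \<mu>" "1 / N \<le> \<mu>" "1 / M \<le> \<mu>" unfolding \<mu>_def using p by linarith+
  have n': "1 / real N \<le> 2 * (ln N / N)" "1 / real M \<le> 2 * (ln M / M)" using n by auto
  then have q: "0 < ln N / N" "0 < ln M / M" using p by linarith+
  have aux: "v + w \<le> 2 * (y + z) \<and> v \<le> 2 * (y + z) \<and> y \<le> y + z \<and> z \<le> y + z \<and> 0 < y + z"
    if "v \<le> 2 * y" "w \<le> 2 * z" "0 < y" "0 < z" for v w y z :: real using that by auto
  show "\<mu> \<le> 2 * rate" "1 / N \<le> 2 * rate" "ln N / N \<le> rate" "ln M / M \<le> rate" "0 < rate"
    unfolding \<mu>_def rate_def using aux[OF n' q] by simp_all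
qed

lemmas xs_step = mesh_x_facts(1)[OF L_pos eps_pos N_even N_pos]
lemmas xs_step_le = mesh_x_facts(2)[OF L_pos eps_pos N_even N_pos]
lemmas xs_points = mesh_x_facts(3-5)[OF L_pos eps_pos N_even N_pos]
lemmas sigma = mesh_x_facts(6,7)[OF L_pos eps_pos N_even N_pos]
lemmas ts_step = mesh_t_facts(1)[OF T_pos C2_pos eps_pos M_even M_pos]
lemmas ts_step_le = mesh_t_facts(2)[OF T_pos C2_pos eps_pos M_even M_pos]
lemmas ts_points = mesh_t_facts(3,4)[OF T_pos C2_pos eps_pos M_even M_pos]

lemma xs_range: "i \<le> N \<Longrightarrow> xs i \<in> {0..L}"
  using mesh_mono[of N xs 0 i] mesh_mono[of N xs i N] xs_step xs_points by auto

lemma ts_range: "j \<le> M \<Longrightarrow> ts j \<in> {0..T}"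
  using mesh_mono[of M ts 0 j] mesh_mono[of M ts j M] ts_step ts_points by auto

lemma xs_mono: "i \<le> j \<Longrightarrow> j \<le> N \<Longrightarrow> xs i \<le> xs j"
  using mesh_mono[of N xs i j] xs_step by auto

lemma hk_le:
  assumes "i < N" "j < M"
  shows "(xs (Suc i) - xs i) + (ts (Suc j) - ts j) \<le> 2 * (L + T) * \<mu>"
    "xs (Suc i) - xs i \<le> 2 * L * \<mu>" "ts (Suc j) - ts j \<le> 2 * T * \<mu>"
proof -
  have "xs (Suc i) - xs i \<le> 2 * L * (1 / N)" using xs_step_le[OF assms(1)] by simp
  also have "\<dots> \<le> 2 * L * \<mu>" using mu_lam L_pos by (intro mult_left_mono) auto
  finally show 1: "xs (Suc i) - xs i \<le> 2 * L * \<mu>" .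
  have "ts (Suc j) - ts j \<le> 2 * T * (1 / M)" using ts_step_le[OF assms(2)] by simp
  also have "\<dots> \<le> 2 * T * \<mu>" using mu_lam T_pos by (intro mult_left_mono) auto
  finally show 2: "ts (Suc j) - ts j \<le> 2 * T * \<mu>" .
  show "(xs (Suc i) - xs i) + (ts (Suc j) - ts j) \<le> 2 * (L + T) * \<mu>" using 1 2 by (simp add: algebra_simps)
qed

lemma f_corner: "f 0 0 = 0"
  using layer_forcing_corner[OF f_layer] .

lemma G_corner: "G 0 0 = 0"
  using compat f_corner by (simp add: compatible_def Let_def G_def g_def)

lemma C1_nonneg: "0 \<le> C\<^sub>1"
  using layer_forcing_bounds(1)[OF f_C2 f_layer eps_pos, of 0 0 0 0] L_pos T_pos by simp

text \<open>
  The forcing vanishes at the corner since \<open>G 0 0 = f 0 0\<close> is the first-order compatibility condition and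
  \<open>f 0 0 = 0\<close>.
\<close>

sublocale regular: zero_data_scheme am bm xs ts N M \<alpha> A L T 1 "\<lambda>i. A" "\<lambda>i j. - G (xs i) (ts j)" Y
  unfolding Y_def
proof (rule zero_data_scheme_upwind)
  note q = mixed_lipschitz_mesh_quotients[OF mixed_lipschitz_minus[OF G_mixed_lipschitz]]
  fix i j
  show "i \<le> N \<Longrightarrow> j \<le> M \<Longrightarrow> \<bar>- G (xs i) (ts j)\<bar> \<le> 1 * A"
    using q(1)[of xs i ts j] xs_range ts_range by simp
  show "i \<le> N \<Longrightarrow> j < M \<Longrightarrow> \<bar>diff_t ts (\<lambda>i j. - G (xs i) (ts j)) i j\<bar> \<le> 1 * A"
    using q(2)[of xs i ts j] xs_range ts_range ts_range ts_step by simp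
  show "i < N \<Longrightarrow> j \<le> M \<Longrightarrow> \<bar>diff_x xs (\<lambda>i j. - G (xs i) (ts j)) i j\<bar> \<le> 1^2 * A"
    using q(3)[of xs i ts j] xs_range ts_range xs_range xs_step by simp
  show "i < N \<Longrightarrow> j < M \<Longrightarrow> \<bar>diff_x xs (diff_t ts (\<lambda>i j. - G (xs i) (ts j))) i j\<bar> \<le> 1^2 * A"
    using q(4)[of xs i ts j] xs_range ts_range xs_range xs_step ts_range ts_step by simp
qed (use xs_step ts_step xs_range ts_range A_pos G_corner xs_points ts_points in auto)

lemma u_facts:
  shows "continuous_on ({0..L} \<times> {0..T}) (\<lambda>(x, t). u x t)"
    and "t \<in> {0..T} \<Longrightarrow> u 0 t = g 0 t" and "x \<in> {0..L} \<Longrightarrow> u x 0 = g x 0"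
proof -
  have "\<phi> 0 = \<psi> 0" using compat by (simp add: compatible_def Let_def)
  then show "continuous_on ({0..L} \<times> {0..T}) (\<lambda>(x, t). u x t)"
    and "t \<in> {0..T} \<Longrightarrow> u 0 t = g 0 t" and "x \<in> {0..L} \<Longrightarrow> u x 0 = g x 0"
    using u_sol by (auto simp: transport_solution_def g_def)
qed

lemma g_has_derivatives:
  assumes "x \<in> {0..L}" "t \<in> {0..T}"
  shows "((\<lambda>y. g y t) has_real_derivative deriv_on {0..L} \<phi> x) (at x within {0..L})"
    "((\<lambda>s. g x s) has_real_derivative deriv_on {0..T} \<psi> t) (at t within {0..T})"
proof -
  have "\<phi> differentiable (at x within {0..L})" "\<psi> differentiable (at t within {0..T})"
    using phi_C2 psi_C2 assms by (auto simp: numeral_2_eq_2)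
  note d = this[THEN has_derivative_deriv_on]
  show "((\<lambda>y. g y t) has_real_derivative deriv_on {0..L} \<phi> x) (at x within {0..L})"
    "((\<lambda>s. g x s) has_real_derivative deriv_on {0..T} \<psi> t) (at t within {0..T})"
    unfolding g_def using d by (auto intro!: derivative_eq_intros)
qed

lemma u_has_derivatives:
  assumes "x \<in> {0<..L}" "t \<in> {0<..T}"
  shows "((\<lambda>y. u y t) has_real_derivative dx L u x t) (at x within {0..L})"
    "((\<lambda>s. u x s) has_real_derivative dt T u x t) (at t within {0..T})"
    "dt T u x t + a x t * dx L u x t + b x t * u x t = f x t"
  using u_sol assms unfolding transport_solution_def dx_def dt_def
  by (auto intro!: has_derivative_deriv_on)

abbreviation "defect x t \<equiv> g x t - u x t + bil xs ts N M Y x t"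

text \<open>
  In \<open>u\<close> the forcing \<open>f\<close> is present, in \<open>g + Y\<close> it is not: this is where \<open>- f x t\<close> comes from. The
  terms in \<open>G\<close> cancel up to the variation of \<open>G\<close> over a cell.
\<close>

lemma Y_residual:
  assumes x: "x \<in> {0<..L}" and t: "t \<in> {0<..T}"
  shows "residual_le a b (\<lambda>x t. defect x t) (- f x t) (reg_const * (2 * (L + T) * \<mu>)) x t"
proof -
  obtain i where i: "i < N" "xs i < x" "x \<le> xs (Suc i)"
    using mesh_cell_left_open[of xs x N] x xs_points by auto
  obtain j where j: "j < M" "ts j < t" "t \<le> ts (Suc j)"
    using mesh_cell_left_open[of ts t M] t ts_points by auto
  have ij: "xs i \<in> {0..L}" "xs (Suc i) \<in> {0..L}" "ts j \<in> {0..T}" "ts (Suc j) \<in> {0..T}"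
    using xs_range ts_range i j by auto
  note cr = const_r
  have rA: "const_P \<alpha> A T * A \<le> r * A" "const_Q \<alpha> A T * A \<le> r * A"
    using cr A_pos by (auto intro: mult_right_mono)
  define hk where "hk = (xs (Suc i) - xs i) + (ts (Suc j) - ts j)"
  have hk: "0 < xs (Suc i) - xs i" "0 < ts (Suc j) - ts j" using xs_step ts_step i j by auto
  have bY: "residual_le a b (bil xs ts N M Y) (- G (xs (Suc i)) (ts (Suc j)))
    (((xs (Suc i) - xs i) + A * (ts (Suc j) - ts j)) * (const_S \<alpha> A T L * A)
        + A * ((xs (Suc i) - xs i) + (ts (Suc j) - ts j)) * (2 * (r * A) + T * A)) x t"
  proof (rule bil_residual[OF xs_step ts_step i j a_lip b_lip])
    show "upw am bm xs ts Y i j = - G (xs (Suc i)) (ts (Suc j))" using regular.W_scheme i j by simp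
    show "\<bar>diff_x xs Y i j\<bar> \<le> r * A" "\<bar>diff_x xs Y i (Suc j)\<bar> \<le> r * A" "\<bar>diff_t ts Y i j\<bar> \<le> r * A" "\<bar>diff_t ts Y (Suc i) j\<bar> \<le> r * A"
      using regular.diff_x_W_bound[of i j] regular.diff_x_W_bound[of i "Suc j"] regular.diff_t_W_bound[of i j]
        regular.diff_t_W_bound[of "Suc i" j] rA i j by auto
    show "\<bar>diff_x xs (diff_t ts Y) i j\<bar> \<le> const_S \<alpha> A T L * A"
      using regular.S_bound[of "Suc i" "Suc j"] regular.diff_x_diff_t_W[of i j] i j by simp
    show "\<bar>Y i j\<bar> \<le> T * A" "\<bar>Y (Suc i) j\<bar> \<le> T * A" "\<bar>Y i (Suc j)\<bar> \<le> T * A" "\<bar>Y (Suc i) (Suc j)\<bar> \<le> T * A"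
      using regular.W_bound i j by auto
  qed (use ij in auto)
  have gu: "residual_le a b (\<lambda>x t. g x t - u x t) (G x t - f x t) 0 x t"
  proof (rule residual_leI[where l=0 and s=0])
    have in_rect: "x \<in> {0..L}" "t \<in> {0..T}" and sub: "{0..x} \<subseteq> {0..L}" "{0..t} \<subseteq> {0..T}" using x t by auto
    note gd = g_has_derivatives[OF in_rect] and ud = u_has_derivatives[OF x t]
    show "((\<lambda>y. g y t - u y t) has_real_derivative (deriv_on {0..L} \<phi> x - dx L u x t)) (at x within {0..x})"
      by (rule has_field_derivative_subset[OF DERIV_diff[OF gd(1) ud(1)] sub(1)])
    show "((\<lambda>s. g x s - u x s) has_real_derivative (deriv_on {0..T} \<psi> t - dt T u x t)) (at t within {0..t})"
      by (rule has_field_derivative_subset[OF DERIV_diff[OF gd(2) ud(2)] sub(2)])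
    show "\<bar>deriv_on {0..T} \<psi> t - dt T u x t + a x t * (deriv_on {0..L} \<phi> x - dx L u x t)
        + b x t * (g x t - u x t) - (G x t - f x t)\<bar> \<le> 0"
      unfolding ud(3)[symmetric] by (simp add: G_def algebra_simps)
  qed (use x t in auto)
  have "(xs (Suc i) - xs i) + A * (ts (Suc j) - ts j) \<le> (1 + A) * hk"
    using hk mult_pos_pos[OF A_pos hk(1)] by (simp add: hk_def algebra_simps)
  moreover have "0 \<le> const_S \<alpha> A T L * A" using regular.const_nonneg(5) A_pos by simp
  ultimately have S: "((xs (Suc i) - xs i) + A * (ts (Suc j) - ts j)) * (const_S \<alpha> A T L * A)
    \<le> (1 + A) * hk * (const_S \<alpha> A T L * A)" by (intro mult_right_mono)
  have "\<bar>G x t - G (xs (Suc i)) t\<bar> \<le> A * \<bar>x - xs (Suc i)\<bar>"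
    "\<bar>G (xs (Suc i)) t - G (xs (Suc i)) (ts (Suc j))\<bar> \<le> A * \<bar>t - ts (Suc j)\<bar>"
    using G_mixed_lipschitz x t ij unfolding mixed_lipschitz_def greaterThanAtMost_iff atLeastAtMost_iff by auto
  moreover have "A * \<bar>x - xs (Suc i)\<bar> \<le> A * (xs (Suc i) - xs i)" "A * \<bar>t - ts (Suc j)\<bar> \<le> A * (ts (Suc j) - ts j)"
    using A_pos i j by (auto intro!: mult_left_mono)
  ultimately have Gd: "\<bar>G x t - G (xs (Suc i)) (ts (Suc j))\<bar> \<le> A * hk" by (simp add: hk_def distrib_left)
  have hk_mu: "reg_const * hk \<le> reg_const * (2 * (L + T) * \<mu>)"
    using hk_le(1)[OF i(1) j(1)] regular.const_nonneg(5) A_pos cr T_pos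
    by (intro mult_left_mono) (auto simp: hk_def reg_const_def intro!: add_nonneg_nonneg)
  have reg_const_hk: "reg_const * hk = (1 + A) * hk * (const_S \<alpha> A T L * A) + A * hk * (2 * (r * A) + T * A) + A * hk"
    by (simp add: reg_const_def algebra_simps)
  show ?thesis
    by (rule residual_le_mono[OF residual_le_add[OF gu bY]])
      (use S Gd hk_mu reg_const_hk in \<open>simp add: hk_def[symmetric]\<close>)
qed

lemma reg_const_nonneg: "0 \<le> reg_const"
  using regular.const_nonneg(5) A_pos const_r T_pos by (simp add: reg_const_def)

lemma continuous_on_defect: "continuous_on ({0..L} \<times> {0..T}) (\<lambda>(x, t). defect x t)"
proof -
  have c: "continuous_on {0..L} \<phi>" "continuous_on {0..T} \<psi>"
    using phi_C2 psi_C2 by (auto simp: numeral_2_eq_2)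
  have "continuous_on ({0..L} \<times> {0..T}) (\<lambda>z. \<phi> (fst z))"
    by (rule continuous_on_compose2[OF c(1) continuous_on_fst[OF continuous_on_id]]) auto
  moreover have "continuous_on ({0..L} \<times> {0..T}) (\<lambda>z. \<psi> (snd z))"
    by (rule continuous_on_compose2[OF c(2) continuous_on_snd[OF continuous_on_id]]) auto
  ultimately have "continuous_on ({0..L} \<times> {0..T}) (\<lambda>z. g (fst z) (snd z))"
    unfolding g_def by (intro continuous_on_diff continuous_on_add continuous_on_const)
  then show ?thesis
    using u_facts(1) continuous_on_bil[of "{0..L} \<times> {0..T}" xs ts N M Y] unfolding case_prod_unfold
    by (intro continuous_intros)
qed

lemma bil_zero:
  assumes mx: "\<And>i. i < n \<Longrightarrow> xs' i < xs' (Suc i)" and mt: "\<And>j. j < m \<Longrightarrow> ts' j < ts' (Suc j)"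
    and nm: "0 < n" "0 < m"
  shows "(\<And>j. Z 0 j = 0) \<Longrightarrow> t \<in> {ts' 0..ts' m} \<Longrightarrow> bil xs' ts' n m Z (xs' 0) t = 0"
    and "(\<And>i. Z i 0 = 0) \<Longrightarrow> x \<in> {xs' 0..xs' n} \<Longrightarrow> bil xs' ts' n m Z x (ts' 0) = 0"
proof -
  assume Z: "\<And>j. Z 0 j = 0" and t: "t \<in> {ts' 0..ts' m}"
  then obtain j where j: "j < m" "ts' j \<le> t" "t \<le> ts' (Suc j)"
    using mesh_cell_closed[of m ts' t] mt nm(2) by auto
  show "bil xs' ts' n m Z (xs' 0) t = 0"
    by (subst bil_cell[where i=0 and j=j]) (use mx mt nm j Z in \<open>auto simp: corner_mean_def less_imp_le\<close>)
next
  assume Z: "\<And>i. Z i 0 = 0" and x: "x \<in> {xs' 0..xs' n}"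
  then obtain i where i: "i < n" "xs' i \<le> x" "x \<le> xs' (Suc i)"
    using mesh_cell_closed[of n xs' x] mx nm(1) by auto
  show "bil xs' ts' n m Z x (ts' 0) = 0"
    by (subst bil_cell[where i=i and j=0]) (use mx mt nm i Z in \<open>auto simp: corner_mean_def less_imp_le\<close>)
qed

lemma defect_boundary:
  shows "t \<in> {0..T} \<Longrightarrow> defect 0 t = 0"
    and "x \<in> {0..L} \<Longrightarrow> defect x 0 = 0"
proof -
  show "t \<in> {0..T} \<Longrightarrow> defect 0 t = 0"
    using bil_zero(1)[of N xs M ts Y t] xs_step ts_step N_pos M_pos xs_points ts_points u_facts(2)[of t]
    by (simp add: Y_def)
  show "x \<in> {0..L} \<Longrightarrow> defect x 0 = 0"
    using bil_zero(2)[of N xs M ts Y x] xs_step ts_step N_pos M_pos xs_points ts_points u_facts(3)[of x]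
    by (simp add: Y_def upwind_solution_initial)
qed

lemma f_bound: "x \<in> {0..L} \<Longrightarrow> t \<in> {0..T} \<Longrightarrow> \<bar>f x t\<bar> \<le> C\<^sub>1 / \<epsilon> * exp ((x - L) / \<epsilon>)"
  using layer_forcing_bounds(2)[OF f_C2 f_layer eps_pos, of x x t t] by simp

text \<open>
  The operator applied to \<open>exp ((x-L)/\<epsilon>)\<close> dominates the layer bound on \<open>f\<close>, so \<open>f\<close> contributes no more than
  this exponential, which is small away from the outflow boundary.
\<close>

lemma Y_error:
  assumes x: "x \<in> {0..L}" and t: "t \<in> {0..T}"
  shows "\<bar>defect x t\<bar>
    \<le> reg_const * (2 * (L + T) * \<mu>) / \<alpha> * x + C\<^sub>1 / \<alpha> * exp ((x - L) / \<epsilon>)"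
proof -
  define c where "c = reg_const * (2 * (L + T) * \<mu>) / \<alpha>"
  have c: "0 \<le> c" using reg_const_nonneg L_pos T_pos mu_lam alpha_pos by (simp add: c_def)
  let ?B = "\<lambda>x. c * x + C\<^sub>1 / \<alpha> * exp ((x - L) / \<epsilon>)"
  let ?B' = "\<lambda>x. c + C\<^sub>1 / \<alpha> * (exp ((x - L) / \<epsilon>) / \<epsilon>)"
  have "\<bar>defect x t\<bar> \<le> ?B x"
  proof (rule transport_comparison[where B="?B" and B'="?B'" and a=a and b=b and \<alpha>=\<alpha>, OF continuous_on_defect _ _ _ _ a_ge b_ge _ _ _ x t])
    show "(?B has_real_derivative ?B' x) (at x)" for x
      using eps_pos alpha_pos by (auto intro!: derivative_eq_intros simp: mult.commute)
    fix x assume "x \<in> {0..L}"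
    then show "0 \<le> ?B x" "0 \<le> ?B' x" using c C1_nonneg alpha_pos eps_pos by auto
  next
    fix x t assume xt: "x \<in> {0<..L}" "t \<in> {0<..T}"
    have "\<bar>f x t\<bar> \<le> C\<^sub>1 / \<epsilon> * exp ((x - L) / \<epsilon>)" using f_bound xt by auto
    moreover have "reg_const * (2 * (L + T) * \<mu>) + C\<^sub>1 / \<epsilon> * exp ((x - L) / \<epsilon>) = \<alpha> * ?B' x"
      using alpha_pos by (simp add: c_def distrib_left)
    ultimately show "residual_le a b (\<lambda>x t. defect x t) 0 (\<alpha> * ?B' x) x t"
      by (intro residual_le_mono[OF Y_residual[OF xt]]) simp
  next
    show "\<bar>defect 0 t\<bar> \<le> ?B 0" if "t \<in> {0..T}" for t
      unfolding defect_boundary(1)[OF that] using C1_nonneg alpha_pos by simp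
    show "\<bar>defect x 0\<bar> \<le> ?B x" if "x \<in> {0..L}" for x
      unfolding defect_boundary(2)[OF that] using C1_nonneg alpha_pos c that by simp
  qed (use alpha_pos in auto)
  then show ?thesis by (simp add: c_def)
qed

end


section \<open>The fitted scheme on the coarse mesh\<close>

context transport_instance
begin

abbreviation "n2 \<equiv> N div 2"
abbreviation "\<sigma> \<equiv> mesh_sigma L \<epsilon> N"
definition H :: real where "H = 2 * (L - \<sigma>) / N"
definition \<rho> :: real where "\<rho> = H / \<epsilon>"
definition \<kappa> :: real where "\<kappa> = \<rho> / (1 - exp (- \<rho>))"
text \<open>
  \<open>aF\<close> is the convection coefficient with the fitting factor \<open>\<kappa>\<close> built in, so that the fitted operator is
  an upwind operator to which the discrete comparison principle applies.
\<close>

definition aF :: "nat \<Rightarrow> nat \<Rightarrow> real" where "aF i j = (if i = n2 then \<kappa> else 1) * am i j"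
definition D :: "nat \<Rightarrow> nat \<Rightarrow> real" where "D i j = U i j - g (xs i) (ts j) - Y i j"

lemma n2: "N = 2 * n2" "0 < n2" "n2 < N"
  using N_even N_pos NM_ge by auto

lemma H_pos: "0 < H" and H_le: "H \<le> 2 * L * (1 / N)" and H_le_mu: "H \<le> 2 * L * \<mu>" and rho_pos: "0 < \<rho>"
proof -
  show "0 < H" using sigma L_pos N_pos by (simp add: H_def)
  then show "0 < \<rho>" using eps_pos by (simp add: \<rho>_def)
  show 1: "H \<le> 2 * L * (1 / N)" using sigma N_pos by (simp add: H_def divide_right_mono)
  have "2 * L * (1 / N) \<le> 2 * L * \<mu>" using mu_lam L_pos by (intro mult_left_mono) auto
  then show "H \<le> 2 * L * \<mu>" using 1 by linarith
qed

lemma kappa: "1 \<le> \<kappa>" "\<rho> \<le> \<kappa>"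
  unfolding \<kappa>_def using fitting_factor[OF rho_pos] by auto

lemma xs_coarse_step: "i < n2 \<Longrightarrow> xs (Suc i) - xs i = H"
  unfolding mesh_x_def H_def by (rule pw_mesh_step(1)[OF N_even N_pos])

lemma xs_fine_step: "n2 \<le> i \<Longrightarrow> xs (Suc i) - xs i = 2 * \<sigma> / N"
  unfolding mesh_x_def using pw_mesh_step(2)[OF N_even N_pos, of i "L - \<sigma>" L] by simp

lemma xs_coarse: "i \<le> n2 \<Longrightarrow> xs i = L - \<sigma> - real (n2 - i) * H"
  unfolding mesh_x_def H_def by (rule pw_mesh_points(4)[OF N_even N_pos])

lemma xs_fine: "n2 \<le> i \<Longrightarrow> i \<le> N \<Longrightarrow> xs i = L - real (N - i) * (2 * \<sigma> / N)"
  unfolding mesh_x_def using pw_mesh_points(5)[OF N_even N_pos, of i "L - \<sigma>" L] by simp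

lemma xs_eq_transition: "i \<le> N \<Longrightarrow> xs i = L - \<sigma> \<longleftrightarrow> i = n2"
proof
  assume i: "i \<le> N" "xs i = L - \<sigma>"
  show "i = n2"
  proof (rule ccontr)
    assume "i \<noteq> n2"
    then consider "i < n2" | "n2 < i" by linarith
    then show False
    proof cases
      case 1
      then show False using xs_step[of i] xs_mono[of "Suc i" n2] n2 i xs_points(3) by simp
    next
      case 2
      then show False using xs_step[of n2] xs_mono[of "Suc n2" i] n2 i xs_points(3) by simp
    qed
  qed
qed (use xs_points in auto)

lemma upw_aF:
  "upw aF bm xs ts Z i j = upw am bm xs ts Z i j
     + (if Suc i = n2 then (\<kappa> - 1) * am (Suc i) (Suc j) * diff_x xs Z i (Suc j) else 0)"
  by (simp add: upw_def aF_def algebra_simps)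

lemma U_scheme:
  assumes "i < N" "j < M"
  shows "upw aF bm xs ts U i j = f (xs (Suc i)) (ts (Suc j))"
proof -
  have "fitted_op L T C\<^sub>2 \<epsilon> a b N M U (Suc i) (Suc j) = f (xs (Suc i)) (ts (Suc j))"
    using U_sol assms by (simp add: discrete_solution_def Let_def)
  moreover have "upwind_op a b xs ts U (Suc i) (Suc j) = upw am bm xs ts U i j"
    by (simp add: upwind_op_def upw_def Dt_back_def Dx_back_def diff_t_def diff_x_def)
  moreover have "fitted_op L T C\<^sub>2 \<epsilon> a b N M U (Suc i) (Suc j) = upwind_op a b xs ts U (Suc i) (Suc j)
      + (if xs (Suc i) = L - \<sigma> then a (xs (Suc i)) (ts (Suc j)) * (\<kappa> - 1) * Dx_back xs U (Suc i) (Suc j) else 0)"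
    by (simp add: fitted_op_def Let_def \<kappa>_def \<rho>_def H_def)
  moreover have "Dx_back xs U (Suc i) (Suc j) = diff_x xs U i (Suc j)" by (simp add: Dx_back_def diff_x_def)
  ultimately show ?thesis
    using xs_eq_transition[of "Suc i"] assms
    by (cases "Suc i = n2") (simp_all add: upw_aF algebra_simps)
qed

lemma U_boundary: "j \<le> M \<Longrightarrow> U 0 j = g 0 (ts j)" "i \<le> N \<Longrightarrow> U i 0 = g (xs i) 0"
  using U_sol u_facts(2)[OF ts_range, of j] u_facts(3)[OF xs_range, of i]
  by (simp_all add: discrete_solution_def Let_def)

lemma a_le: "i \<le> N \<Longrightarrow> j \<le> M \<Longrightarrow> am i j \<le> A" "i \<le> N \<Longrightarrow> j \<le> M \<Longrightarrow> \<alpha> \<le> am i j" "i \<le> N \<Longrightarrow> j \<le> M \<Longrightarrow> 0 \<le> bm i j"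
  using mixed_lipschitz_mesh_quotients(1)[OF a_lip, of xs i ts j] a_ge b_ge xs_range ts_range
  by (auto intro: abs_le_D1)

definition consist_const :: real where "consist_const = A^2 * (2 * (L + T) * \<mu>) / \<alpha>"

lemma consist_const_nonneg: "0 \<le> consist_const"
  using L_pos T_pos mu_lam alpha_pos by (simp add: consist_const_def)

lemma g_consistency:
  assumes "i < N" "j < M"
  shows "\<bar>upw am bm xs ts (\<lambda>i j. g (xs i) (ts j)) i j - G (xs (Suc i)) (ts (Suc j))\<bar> \<le> \<alpha> * consist_const"
proof -
  let ?h = "xs (Suc i) - xs i" and ?k = "ts (Suc j) - ts j"
  have p: "xs i \<in> {0..L}" "xs (Suc i) \<in> {0..L}" "ts j \<in> {0..T}" "ts (Suc j) \<in> {0..T}"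
    using xs_range ts_range assms by auto
  have st: "xs i < xs (Suc i)" "ts j < ts (Suc j)" using xs_step ts_step assms by auto
  define d1 where "d1 = (\<psi> (ts (Suc j)) - \<psi> (ts j)) / ?k - deriv_on {0..T} \<psi> (ts (Suc j))"
  define d2 where "d2 = (\<phi> (xs (Suc i)) - \<phi> (xs i)) / ?h - deriv_on {0..L} \<phi> (xs (Suc i))"
  have d1: "\<bar>d1\<bar> \<le> A * ?k" unfolding d1_def
    by (rule Ck_on_2_taylor[OF psi_C2 psi'_lip]) (use p st A_pos in auto)
  have d2: "\<bar>d2\<bar> \<le> A * ?h" unfolding d2_def
    by (rule Ck_on_2_taylor[OF phi_C2 phi'_lip]) (use p st A_pos in auto)
  have "\<bar>am (Suc i) (Suc j) * d2\<bar> \<le> A * (A * ?h)"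
    unfolding abs_mult using a_le[of "Suc i" "Suc j"] assms alpha_pos d2 A_pos by (intro mult_mono) auto
  moreover have "A * ?k \<le> A * (A * ?k)"
    using A_ge st by (intro mult_left_mono) auto
  ultimately have "\<bar>d1 + am (Suc i) (Suc j) * d2\<bar> \<le> A^2 * (?h + ?k)"
    using d1 by (simp add: power2_eq_square algebra_simps)
  also have "\<dots> \<le> A^2 * (2 * (L + T) * \<mu>)" using hk_le(1)[OF assms] by (intro mult_left_mono) auto
  also have "\<dots> = \<alpha> * consist_const" using alpha_pos by (simp add: consist_const_def)
  finally show ?thesis
    by (simp add: upw_def diff_x_def diff_t_def G_def g_def d1_def d2_def algebra_simps)
qed

lemma D_scheme:
  assumes ij: "i < N" "j < M"
  shows "\<bar>upw aF bm xs ts D i j - f (xs (Suc i)) (ts (Suc j))\<bar>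
    \<le> \<alpha> * consist_const + (if Suc i = n2 then (\<kappa> - 1) * am (Suc i) (Suc j) * (A + r * A) else 0)"
proof -
  let ?g = "\<lambda>i j. g (xs i) (ts j)"
  let ?Z = "\<lambda>i j. g (xs i) (ts j) + Y i j"
  have st: "xs i < xs (Suc i)" using xs_step ij by auto
  have "D = (\<lambda>i j. U i j - ?Z i j)" by (simp add: D_def fun_eq_iff)
  then have "upw aF bm xs ts D i j = f (xs (Suc i)) (ts (Suc j)) - upw aF bm xs ts ?Z i j"
    using U_scheme[OF ij] by (simp add: upw_diff)
  moreover have "upw am bm xs ts ?Z i j = upw am bm xs ts ?g i j - G (xs (Suc i)) (ts (Suc j))"
  proof -
    have "upw am bm xs ts ?Z i j = upw am bm xs ts ?g i j + upw am bm xs ts Y i j"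
      by (simp add: upw_def diff_x_add diff_t_add algebra_simps)
    then show ?thesis using regular.W_scheme[OF ij] by simp
  qed
  moreover have "\<bar>(\<kappa> - 1) * am (Suc i) (Suc j) * diff_x xs ?Z i (Suc j)\<bar> \<le> (\<kappa> - 1) * am (Suc i) (Suc j) * (A + r * A)"
  proof -
    have "\<bar>\<phi> (xs (Suc i)) - \<phi> (xs i)\<bar> \<le> A * \<bar>xs (Suc i) - xs i\<bar>"
      using phi_lip xs_range ij by simp
    then have "\<bar>diff_x xs ?g i (Suc j)\<bar> \<le> A" using st by (simp add: diff_x_def g_def field_simps)
    moreover have "\<bar>diff_x xs Y i (Suc j)\<bar> \<le> r * A"
      using regular.diff_x_W_bound[of i "Suc j"] mult_right_mono[OF const_r(4) less_imp_le[OF A_pos]] ij by simp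
    ultimately have "\<bar>diff_x xs ?Z i (Suc j)\<bar> \<le> A + r * A" unfolding diff_x_add by linarith
    then show ?thesis unfolding abs_mult[of "(\<kappa> - 1) * am (Suc i) (Suc j)"]
      using kappa a_le[of "Suc i" "Suc j"] ij alpha_pos by (auto simp: abs_mult intro!: mult_left_mono)
  qed
  moreover have "upw aF bm xs ts ?Z i j = upw am bm xs ts ?Z i j
     + (if Suc i = n2 then (\<kappa> - 1) * am (Suc i) (Suc j) * diff_x xs ?Z i (Suc j) else 0)" by (rule upw_aF)
  ultimately show ?thesis
    using g_consistency[OF ij] by (cases "Suc i = n2") (simp_all only: if_True if_False simp_thms, linarith+)
qed

lemma D_boundary: "j \<le> M \<Longrightarrow> D 0 j = 0" "i \<le> N \<Longrightarrow> D i 0 = 0"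
  using U_boundary xs_points ts_points by (auto simp: D_def Y_def upwind_solution_initial)

lemma aF_ge: "i \<le> N \<Longrightarrow> j \<le> M \<Longrightarrow> \<alpha> \<le> aF i j"
proof -
  assume ij: "i \<le> N" "j \<le> M"
  then have "1 * am i j \<le> \<kappa> * am i j" using kappa a_le[OF ij] alpha_pos by (intro mult_right_mono) auto
  then show ?thesis using a_le(2)[OF ij] by (auto simp: aF_def)
qed

text \<open>
  Left of the transition point the barrier is a geometric sequence with ratio \<open>exp \<rho>\<close> that reaches \<open>K\<close>, of order
  \<open>1/N\<close>, one step before the transition point. It runs one step ahead of the bound on \<open>f\<close>, because
  \<open>\<rho> exp (-\<rho>) \<le> 1 - exp (-\<rho>)\<close> while \<open>\<rho> \<le> 1 - exp (-\<rho>)\<close> fails. At the transition point this lead is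
  used up; there the inequality \<open>\<kappa>/H \<ge> 1/\<epsilon>\<close> shows that a jump of \<open>K\<close> in the barrier pays for \<open>f\<close>,
  and a jump of order \<open>H\<close> pays for the fitting factor acting on \<open>g + Y\<close>.
\<close>

lemma D_coarse:
  assumes lay: "\<epsilon> * ln N < L / 2" and ij: "i \<le> n2" "j \<le> M"
  shows "\<bar>D i j\<bar> \<le> coarse_const * \<mu>"
proof -
  have sig: "\<sigma> = \<epsilon> * ln N" using lay by (simp add: mesh_sigma_def)
  define K where "K = C\<^sub>1 / \<alpha> / N"
  have K0: "0 \<le> K" using C1_nonneg alpha_pos by (simp add: K_def)
  define B1 where "B1 i = (if i < n2 then K * exp (- (real (n2 - 1 - i) * \<rho>)) else K + (K + (A + r * A) * H))" for i
  define B where "B i = consist_const * xs i + B1 i" for i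
  have rA: "0 \<le> A + r * A" using A_pos const_r by simp
  have B1_le: "0 \<le> B1 i" "B1 i \<le> 2 * K + (A + r * A) * H" for i
    using K0 mult_nonneg_nonneg[OF rA less_imp_le[OF H_pos]] rho_pos mult_left_mono[of "exp (- (real (n2 - 1 - i) * \<rho>))" 1 K]
    by (auto simp: B1_def intro!: add_nonneg_nonneg)
  interpret coarse: upwind_mesh aF bm xs ts n2 M \<alpha>
    by standard (use n2 xs_step ts_step alpha_pos aF_ge a_le in auto)
  have B0: "0 \<le> B i" if "i \<le> N" for i
    using consist_const_nonneg xs_range[OF that] B1_le by (simp add: B_def)
  have fexp: "\<bar>f (xs i) (ts j)\<bar> \<le> C\<^sub>1 / \<epsilon> * (1 / N * exp (- (real (n2 - i) * \<rho>)))" if "i \<le> n2" "j \<le> M" for i j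
  proof -
    have "(xs i - L) / \<epsilon> = - ln N + - (real (n2 - i) * \<rho>)"
      using xs_coarse[OF that(1)] sig eps_pos by (simp add: \<rho>_def field_simps)
    then have "exp ((xs i - L) / \<epsilon>) = exp (- ln N) * exp (- (real (n2 - i) * \<rho>))"
      by (simp only: exp_add)
    then have "exp ((xs i - L) / \<epsilon>) = 1 / N * exp (- (real (n2 - i) * \<rho>))"
      using N_pos by (simp add: exp_minus inverse_eq_divide)
    then show ?thesis using f_bound[OF xs_range ts_range, of i j] that n2 by simp
  qed
  have "\<bar>D i j\<bar> \<le> B i"
  proof (rule coarse.comparison[where B="\<lambda>i j. B i"])
    fix j assume "j \<le> M"
    then show "\<bar>D 0 j\<bar> \<le> B 0" using D_boundary(1) B0 by simp
  next
    fix i assume "i \<le> n2"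
    then show "\<bar>D i 0\<bar> \<le> B i" using D_boundary(2)[of i] B0[of i] n2 by simp
  next
    fix i j assume ij: "i < n2" "j < M"
    then have iN: "i < N" "Suc i \<le> N" using n2 by auto
    let ?a = "aF (Suc i) (Suc j)"
    have age: "\<alpha> \<le> ?a" using aF_ge iN ij by simp
    have step: "xs (Suc i) - xs i = H" using xs_coarse_step ij by simp
    have "upw aF bm xs ts (\<lambda>i j. B i) i j = ?a * ((B (Suc i) - B i) / H) + bm (Suc i) (Suc j) * B (Suc i)"
      by (simp add: upw_x_barrier step)
    moreover have "(B (Suc i) - B i) / H = consist_const + (B1 (Suc i) - B1 i) / H"
    proof -
      have "B (Suc i) - B i = consist_const * H + (B1 (Suc i) - B1 i)" by (simp add: B_def step[symmetric] algebra_simps)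
      then show ?thesis using H_pos by (simp add: add_divide_distrib)
    qed
    moreover have "0 \<le> bm (Suc i) (Suc j) * B (Suc i)" using B0[OF iN(2)] a_le[of "Suc i" "Suc j"] iN ij by simp
    ultimately have LB: "?a * consist_const + ?a * ((B1 (Suc i) - B1 i) / H) \<le> upw aF bm xs ts (\<lambda>i j. B i) i j"
      by (simp add: distrib_left)
    have ac: "\<alpha> * consist_const \<le> ?a * consist_const" using age consist_const_nonneg by (rule mult_right_mono)
    have Kq: "\<alpha> * (K / \<epsilon>) = C\<^sub>1 / \<epsilon> * (1 / N)" using alpha_pos by (simp add: K_def)
    show "\<bar>upw aF bm xs ts D i j\<bar> \<le> upw aF bm xs ts (\<lambda>i j. B i) i j"
    proof (cases "Suc i = n2")
      case False
      define q where "q = n2 - 1 - Suc i"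
      have q: "n2 - 1 - i = Suc q" "n2 - Suc i = Suc q" "Suc i < n2" using False ij by (auto simp: q_def)
      have e: "exp (- (real (Suc q) * \<rho>)) = exp (- (real q * \<rho>)) * exp (- \<rho>)"
        by (simp add: exp_add[symmetric] algebra_simps)
      have Bd: "B1 (Suc i) - B1 i = K * exp (- (real q * \<rho>)) * (1 - exp (- \<rho>))"
      proof -
        have "B1 (Suc i) = K * exp (- (real q * \<rho>))" by (simp only: B1_def q(3) if_True q_def)
        moreover have "B1 i = K * exp (- (real (Suc q) * \<rho>))" by (simp only: B1_def ij(1) if_True q(1))
        ultimately show ?thesis unfolding e by (simp add: algebra_simps)
      qed
      \<comment> \<open>the inequality for which the lead of the barrier by one step is needed\<close>
      have "(1 + \<rho>) * exp (- \<rho>) \<le> exp \<rho> * exp (- \<rho>)"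
        using exp_ge_add_one_self[of \<rho>] by (intro mult_right_mono) auto
      then have "\<rho> * exp (- \<rho>) \<le> 1 - exp (- \<rho>)" by (simp add: exp_minus algebra_simps)
      then have "exp (- \<rho>) / \<epsilon> \<le> (1 - exp (- \<rho>)) / H"
        using H_pos eps_pos by (simp add: \<rho>_def field_simps)
      then have "\<alpha> * (K * exp (- (real q * \<rho>))) * (exp (- \<rho>) / \<epsilon>) \<le> \<alpha> * (K * exp (- (real q * \<rho>))) * ((1 - exp (- \<rho>)) / H)"
        using alpha_pos K0 by (intro mult_left_mono) auto
      also have "\<dots> = \<alpha> * ((B1 (Suc i) - B1 i) / H)" by (simp add: Bd)
      also have "\<dots> \<le> ?a * ((B1 (Suc i) - B1 i) / H)"
        using age K0 H_pos rho_pos by (intro mult_right_mono) (auto simp: Bd)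
      finally have "\<alpha> * (K / \<epsilon>) * exp (- (real (Suc q) * \<rho>)) \<le> ?a * ((B1 (Suc i) - B1 i) / H)"
        unfolding e by (simp add: mult_ac)
      moreover have "\<bar>f (xs (Suc i)) (ts (Suc j))\<bar> \<le> \<alpha> * (K / \<epsilon>) * exp (- (real (Suc q) * \<rho>))"
        using fexp[of "Suc i" "Suc j"] ij q unfolding Kq by (simp add: mult_ac)
      moreover have "\<bar>upw aF bm xs ts D i j - f (xs (Suc i)) (ts (Suc j))\<bar> \<le> \<alpha> * consist_const"
        using D_scheme[OF iN(1) ij(2)] False by simp
      ultimately show ?thesis using LB ac by linarith
    next
      case True
      have Bd: "(B1 (Suc i) - B1 i) / H = K / H + (A + r * A)"
        using True ij H_pos by (auto simp: B1_def field_simps)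
      have aeq: "?a = \<kappa> * am (Suc i) (Suc j)" using True by (simp add: aF_def)
      have "\<alpha> * (K / \<epsilon>) \<le> ?a * (K / H)"
      proof -
        have "K / \<epsilon> = \<rho> * (K / H)" using H_pos by (simp add: \<rho>_def)
        also have "\<dots> \<le> \<kappa> * (K / H)" using kappa K0 H_pos by (intro mult_right_mono) auto
        finally have "\<alpha> * (K / \<epsilon>) \<le> am (Suc i) (Suc j) * (\<kappa> * (K / H))"
          using a_le(2)[of "Suc i" "Suc j"] iN ij alpha_pos K0 eps_pos by (intro mult_mono) auto
        then show ?thesis by (simp add: aeq mult_ac)
      qed
      moreover have "\<bar>f (xs (Suc i)) (ts (Suc j))\<bar> \<le> \<alpha> * (K / \<epsilon>)"
        using fexp[of "Suc i" "Suc j"] ij True unfolding Kq by simp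
      moreover have "(\<kappa> - 1) * am (Suc i) (Suc j) * (A + r * A) \<le> ?a * (A + r * A)"
        unfolding aeq using a_le(2)[of "Suc i" "Suc j"] iN ij alpha_pos rA by (intro mult_right_mono) auto
      moreover have "\<bar>upw aF bm xs ts D i j - f (xs (Suc i)) (ts (Suc j))\<bar>
          \<le> \<alpha> * consist_const + (\<kappa> - 1) * am (Suc i) (Suc j) * (A + r * A)"
        using D_scheme[OF iN(1) ij(2)] True by simp
      moreover have "?a * ((B1 (Suc i) - B1 i) / H) = ?a * (K / H) + ?a * (A + r * A)"
        unfolding Bd by (rule distrib_left)
      ultimately show ?thesis using LB ac by linarith
    qed
  qed (use ij in auto)
  also have "B i \<le> consist_const * L + (2 * K + (A + r * A) * H)"
    unfolding B_def using B1_le[of i] xs_range[of i] ij n2 consist_const_nonneg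
    by (intro add_mono mult_left_mono) auto
  also have "\<dots> \<le> coarse_const * \<mu>"
  proof -
    have "K \<le> C\<^sub>1 / \<alpha> * \<mu>"
      using mult_left_mono[OF mu_lam(4), of "C\<^sub>1 / \<alpha>"] C1_nonneg alpha_pos by (simp add: K_def)
    moreover have "(A + r * A) * H \<le> (A + r * A) * (2 * L * \<mu>)" using H_le_mu rA by (rule mult_left_mono)
    moreover have "consist_const * L = A^2 * (2 * (L + T)) / \<alpha> * L * \<mu>" by (simp add: consist_const_def)
    ultimately show ?thesis unfolding coarse_const_def distrib_right by linarith
  qed
  finally show ?thesis .
qed

lemma coarse_const_nonneg: "0 \<le> coarse_const"
  using A_pos L_pos T_pos alpha_pos C1_nonneg const_r by (simp add: coarse_const_def)

section \<open>The layer part on the mesh that resolves the layer\<close>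

text \<open>
  The region that resolves the layer starts at the index \<open>i0\<close> with abscissa \<open>p\<close> and has \<open>n'\<close> equal steps of
  width \<open>h\<close>, also when \<open>\<sigma> = L/2\<close>, as the whole mesh is then uniform. The weight \<open>E\<close> is the discrete
  exponential, whose backward quotient is exactly \<open>E / \<epsilon>\<close>.
\<close>

definition i0 :: nat where "i0 = (if \<epsilon> * ln N < L / 2 then n2 else 0)"
definition p :: real where "p = xs i0"
definition n' :: nat where "n' = N - i0"
definition h :: real where "h = 2 * \<sigma> / N"
definition y :: real where "y = h / \<epsilon>"
definition f_offset :: real where "f_offset = f p 0"
abbreviation "xs' \<equiv> \<lambda>i. xs (i0 + i)"
definition E :: "nat \<Rightarrow> real" where "E i = weight_const * (1 - y) ^ (n' - i)"
definition F :: "nat \<Rightarrow> nat \<Rightarrow> real" where "F i j = f (xs' i) (ts j) - f_offset"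
definition W :: "nat \<Rightarrow> nat \<Rightarrow> real" where
  "W = upwind_solution (\<lambda>i j. a (xs' i) (ts j)) (\<lambda>i j. b (xs' i) (ts j)) xs' ts F"

lemma sigma_cases:
  obtains (layered) "\<epsilon> * ln N < L / 2" "\<sigma> = \<epsilon> * ln N" "i0 = n2" "n' = N - n2" "p = L - \<sigma>"
  | (uniform) "\<not> \<epsilon> * ln N < L / 2" "\<sigma> = L / 2" "i0 = 0" "n' = N" "p = 0" "H = h"
proof (cases "\<epsilon> * ln N < L / 2")
  case True
  then show ?thesis using layered xs_points by (simp add: mesh_sigma_def i0_def n'_def p_def)
next
  case False
  then have "\<sigma> = L / 2" by (simp add: mesh_sigma_def)
  then show ?thesis using uniform False xs_points by (simp add: i0_def n'_def p_def H_def h_def)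
qed

lemma i0_n': "i0 + n' = N" "i0 < N" "0 < n'"
  using n2 by (auto simp: i0_def n'_def)

lemma sigma_le: "\<sigma> \<le> \<epsilon> * ln N"
  by (simp add: mesh_sigma_def)

lemma h_pos: "0 < h" and y_pos: "0 < y" and y_le: "y \<le> 2 * (ln N / N)" and y_le': "y \<le> 4 / 5"
proof -
  show "0 < h" using sigma N_pos by (simp add: h_def)
  then show "0 < y" using eps_pos by (simp add: y_def)
  have "y \<le> 2 * (\<epsilon> * ln N) / N / \<epsilon>" unfolding y_def h_def using sigma_le N_pos eps_pos
    by (intro divide_right_mono) auto
  also have "\<dots> = 2 * (ln N / N)" using eps_pos by simp
  finally show y: "y \<le> 2 * (ln N / N)" .
  have "ln N / N \<le> 2 / 5" using ln_le_two_fifths[of "real N"] N_pos by (simp add: field_simps)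
  then show "y \<le> 4 / 5" using y by linarith
qed

lemma y_square: "real k * y^2 \<le> 16" if "k \<le> N"
proof -
  have "y^2 \<le> (2 * (ln N / N))^2" using y_le y_pos by (intro power_mono) auto
  then have "real k * y^2 \<le> real N * (2 * (ln N / N))^2" using that by (intro mult_mono) auto
  also have "\<dots> = 4 * (ln N)^2 / N" using N_pos by (simp add: power2_eq_square)
  also have "\<dots> \<le> 16" using ln_square_le[of "real N"] N_pos by (simp add: field_simps)
  finally show ?thesis .
qed

lemma xs'_step: "i < n' \<Longrightarrow> xs' (Suc i) - xs' i = h"
proof (cases rule: sigma_cases)
  case layered
  then show "xs' (Suc i) - xs' i = h" using xs_fine_step[of "i0 + i"] by (simp add: h_def)
next
  case uniform
  then show "xs' (Suc i) - xs' i = h" using xs_fine_step[of i] xs_coarse_step[of i]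
    by (cases "i < n2") (auto simp: h_def)
qed

lemma xs'_eq: "i \<le> n' \<Longrightarrow> xs' i = L - real (n' - i) * h"
proof (cases rule: sigma_cases)
  case layered
  then show "i \<le> n' \<Longrightarrow> xs' i = L - real (n' - i) * h" using xs_fine[of "i0 + i"] n2 by (simp add: h_def)
next
  case uniform
  assume i: "i \<le> n'"
  show "xs' i = L - real (n' - i) * h"
  proof (cases "i \<le> n2")
    case True
    have e: "real n2 * h = L / 2"
    proof -
      have "real N = 2 * real n2" using n2(1) by (metis of_nat_mult of_nat_numeral)
      then show ?thesis using n2(2) uniform by (simp add: h_def)
    qed
    have "real (n' - i) = real n2 + real (n2 - i)" using True n2(1) uniform by (simp add: of_nat_diff)
    then have "real (n' - i) * h = L / 2 + real (n2 - i) * h" using e by (simp add: distrib_right)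
    then show ?thesis using xs_coarse[OF True] uniform by simp
  next
    case False
    then show ?thesis using xs_fine[of i] uniform i by (simp add: h_def)
  qed
qed

lemma xs'_range: "i \<le> n' \<Longrightarrow> xs' i \<in> {p..L}" "i \<le> n' \<Longrightarrow> xs' i \<in> {0..L}" "i \<le> n' \<Longrightarrow> i0 + i \<le> N"
  using xs_range[of "i0 + i"] xs_mono[of i0 "i0 + i"] xs_mono[of "i0 + i" N] xs_points i0_n' by (auto simp: p_def)

lemma p_range: "0 \<le> p" "p \<le> L"
  using xs_range[of i0] i0_n' by (auto simp: p_def)

text \<open>
  Either \<open>L - p = \<epsilon> ln N\<close> and \<open>f(p,0)\<close> is of order \<open>1/(\<epsilon> N)\<close>, or \<open>p = 0\<close> and \<open>f(p,0) = 0\<close>.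
\<close>

lemma f_offset_le: "\<bar>f_offset\<bar> * (L - p) \<le> C\<^sub>1 * rate"
proof (cases rule: sigma_cases)
  case layered
  have "(p - L) / \<epsilon> = - ln N" using layered eps_pos by simp
  then have "\<bar>f_offset\<bar> \<le> C\<^sub>1 / \<epsilon> * (1 / N)"
    using f_bound[of p 0] p_range T_pos N_pos by (simp add: f_offset_def exp_minus inverse_eq_divide)
  then have "\<bar>f_offset\<bar> * (L - p) \<le> C\<^sub>1 / \<epsilon> * (1 / N) * (\<epsilon> * ln N)"
    using layered p_range by (intro mult_mono) (auto simp: C1_nonneg eps_pos less_imp_le)
  also have "\<dots> = C\<^sub>1 * (ln N / N)" using eps_pos by simp
  also have "\<dots> \<le> C\<^sub>1 * rate" using mu_lam C1_nonneg by (intro mult_left_mono) auto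
  finally show ?thesis .
next
  case uniform
  then have "f_offset = 0" using f_corner by (simp add: f_offset_def)
  then show ?thesis using C1_nonneg mu_lam by simp
qed

lemma weight_const_pos: "0 < weight_const"
  using C1_nonneg by (simp add: weight_const_def)

lemma E_bounds:
  assumes "i \<le> n'"
  shows "(2 * C\<^sub>1 + 1) * exp ((xs' i - L) / \<epsilon>) \<le> E i" "E i \<le> weight_const * exp ((xs' i - L) / \<epsilon>)" "E i \<le> weight_const" "0 < E i"
proof -
  have e: "(xs' i - L) / \<epsilon> = - (real (n' - i) * y)" using xs'_eq[OF assms] by (simp add: y_def)
  have "n' - i \<le> N" using i0_n' by simp
  note b = one_minus_power_bounds[OF less_imp_le[OF y_pos] y_le' y_square[OF this]]
  show "E i \<le> weight_const * exp ((xs' i - L) / \<epsilon>)" unfolding E_def e using b(1) weight_const_pos by simp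
  have "(2 * C\<^sub>1 + 1) * exp ((xs' i - L) / \<epsilon>) \<le> (2 * C\<^sub>1 + 1) * (exp (5 * 16) * (1 - y) ^ (n' - i))"
    unfolding e using b(2) C1_nonneg by (intro mult_left_mono) auto
  then show "(2 * C\<^sub>1 + 1) * exp ((xs' i - L) / \<epsilon>) \<le> E i" by (simp add: E_def weight_const_def mult_ac)
  have "(1 - y) ^ (n' - i) \<le> 1" using y_pos y_le' by (intro power_le_one) auto
  then show "E i \<le> weight_const" unfolding E_def using weight_const_pos by simp
  show "0 < E i" unfolding E_def using weight_const_pos y_le' by simp
qed

lemma E_step: "i < n' \<Longrightarrow> E (Suc i) - E i = y * E (Suc i)"
proof -
  assume "i < n'"
  then have "n' - i = Suc (n' - Suc i)" by simp
  then show ?thesis by (simp add: E_def algebra_simps)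
qed

sublocale layer: zero_data_scheme "\<lambda>i j. a (xs' i) (ts j)" "\<lambda>i j. b (xs' i) (ts j)" xs' ts n' M \<alpha> A L T "1 / \<epsilon>" E F W
  unfolding W_def
proof (rule zero_data_scheme_upwind)
  note fb = layer_forcing_bounds[OF f_C2 f_layer eps_pos]
  have le: "C\<^sub>1 / \<epsilon> * exp ((xs' i - L) / \<epsilon>) \<le> 1 / \<epsilon> * E i" "C\<^sub>1 / \<epsilon>^2 * exp ((xs' i - L) / \<epsilon>) \<le> (1 / \<epsilon>)^2 * E i"
    "2 * (C\<^sub>1 / \<epsilon> * exp ((xs' i - L) / \<epsilon>)) \<le> 1 / \<epsilon> * E i"
    if "i \<le> n'" for i
  proof -
    have "C\<^sub>1 * exp ((xs' i - L) / \<epsilon>) \<le> (2 * C\<^sub>1 + 1) * exp ((xs' i - L) / \<epsilon>)"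
      "2 * C\<^sub>1 * exp ((xs' i - L) / \<epsilon>) \<le> (2 * C\<^sub>1 + 1) * exp ((xs' i - L) / \<epsilon>)"
      using C1_nonneg by (auto intro!: mult_right_mono)
    then have "C\<^sub>1 * exp ((xs' i - L) / \<epsilon>) \<le> E i" "2 * C\<^sub>1 * exp ((xs' i - L) / \<epsilon>) \<le> E i"
      using E_bounds(1)[OF that] by linarith+
    then show "C\<^sub>1 / \<epsilon> * exp ((xs' i - L) / \<epsilon>) \<le> 1 / \<epsilon> * E i"
      "C\<^sub>1 / \<epsilon>^2 * exp ((xs' i - L) / \<epsilon>) \<le> (1 / \<epsilon>)^2 * E i"
      "2 * (C\<^sub>1 / \<epsilon> * exp ((xs' i - L) / \<epsilon>)) \<le> 1 / \<epsilon> * E i"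
      using eps_pos by (simp_all add: power_one_over divide_right_mono mult_ac)
  qed
  fix i j
  show "i \<le> n' \<Longrightarrow> j \<le> M \<Longrightarrow> \<bar>F i j\<bar> \<le> 1 / \<epsilon> * E i"
  proof -
    assume ij: "i \<le> n'" "j \<le> M"
    have "\<bar>f_offset\<bar> \<le> C\<^sub>1 / \<epsilon> * exp ((p - L) / \<epsilon>)" unfolding f_offset_def using f_bound p_range T_pos by simp
    also have "\<dots> \<le> C\<^sub>1 / \<epsilon> * exp ((xs' i - L) / \<epsilon>)"
      using xs'_range(1)[OF ij(1)] C1_nonneg eps_pos by (intro mult_left_mono) (auto simp: divide_right_mono)
    finally have "\<bar>f_offset\<bar> \<le> C\<^sub>1 / \<epsilon> * exp ((xs' i - L) / \<epsilon>)" .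
    moreover have "\<bar>f (xs' i) (ts j)\<bar> \<le> C\<^sub>1 / \<epsilon> * exp ((xs' i - L) / \<epsilon>)"
      using f_bound xs'_range ts_range ij by simp
    ultimately show ?thesis using le(3)[OF ij(1)] unfolding F_def by linarith
  qed
  show "i \<le> n' \<Longrightarrow> j < M \<Longrightarrow> \<bar>diff_t ts F i j\<bar> \<le> 1 / \<epsilon> * E i"
  proof -
    assume ij: "i \<le> n'" "j < M"
    have k: "0 < ts (Suc j) - ts j" using ts_step ij by simp
    have "\<bar>f (xs' i) (ts (Suc j)) - f (xs' i) (ts j)\<bar> \<le> C\<^sub>1 / \<epsilon> * exp ((xs' i - L) / \<epsilon>) * \<bar>ts (Suc j) - ts j\<bar>"
      using fb(4)[of "xs' i" "xs' i" "ts (Suc j)" "ts j"] xs'_range(2)[OF ij(1)] ts_range ij by simp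
    then have "\<bar>diff_t ts F i j\<bar> \<le> C\<^sub>1 / \<epsilon> * exp ((xs' i - L) / \<epsilon>)"
      using k by (simp add: diff_t_def F_def pos_divide_le_eq)
    then show ?thesis using le(1)[OF ij(1)] by linarith
  qed
  show "i < n' \<Longrightarrow> j \<le> M \<Longrightarrow> \<bar>diff_x xs' F i j\<bar> \<le> (1 / \<epsilon>)^2 * E (Suc i)"
  proof -
    assume ij: "i < n'" "j \<le> M"
    have st: "xs' (Suc i) - xs' i = h" using xs'_step ij by simp
    have "\<bar>f (xs' (Suc i)) (ts j) - f (xs' i) (ts j)\<bar> \<le> C\<^sub>1 / \<epsilon>^2 * exp ((xs' (Suc i) - L) / \<epsilon>) * h"
      using fb(3)[of "xs' i" "xs' (Suc i)" "ts j" "ts j"] xs'_range(2)[of i] xs'_range(2)[of "Suc i"] ts_range ij st h_pos by simp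
    then have "\<bar>diff_x xs' F i j\<bar> \<le> C\<^sub>1 / \<epsilon>^2 * exp ((xs' (Suc i) - L) / \<epsilon>)"
      using h_pos st by (simp add: diff_x_def F_def pos_divide_le_eq)
    then show ?thesis using le(2)[of "Suc i"] ij by linarith
  qed
  show "i < n' \<Longrightarrow> j < M \<Longrightarrow> \<bar>diff_x xs' (diff_t ts F) i j\<bar> \<le> (1 / \<epsilon>)^2 * E (Suc i)"
  proof -
    assume ij: "i < n'" "j < M"
    have st: "xs' (Suc i) - xs' i = h" using xs'_step ij by simp
    define k where "k = ts (Suc j) - ts j"
    have k: "0 < k" using ts_step ij by (simp add: k_def)
    define d where "d = f (xs' (Suc i)) (ts (Suc j)) - f (xs' i) (ts (Suc j)) - f (xs' (Suc i)) (ts j) + f (xs' i) (ts j)"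
    have "\<bar>d\<bar> \<le> C\<^sub>1 / \<epsilon>^2 * exp ((xs' (Suc i) - L) / \<epsilon>) * h * k"
      using fb(5)[of "xs' i" "xs' (Suc i)" "ts (Suc j)" "ts j"] xs'_range(2)[of i] xs'_range(2)[of "Suc i"] ts_range ij st h_pos k
      by (simp add: d_def k_def)
    moreover have "diff_x xs' (diff_t ts F) i j = d / (h * k)"
      using st by (simp add: diff_x_def diff_t_def F_def k_def[symmetric] d_def diff_divide_distrib[symmetric] algebra_simps)
    ultimately have "\<bar>diff_x xs' (diff_t ts F) i j\<bar> \<le> C\<^sub>1 / \<epsilon>^2 * exp ((xs' (Suc i) - L) / \<epsilon>)"
      using h_pos k by (simp add: abs_mult pos_divide_le_eq mult_ac)
    then show ?thesis using le(2)[of "Suc i"] ij by linarith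
  qed
  show "1 \<le> 1 / \<epsilon>" using eps_pos eps_le by simp
  show "i < n' \<Longrightarrow> E i \<le> E (Suc i)"
  proof -
    assume i: "i < n'"
    then have "0 \<le> y * E (Suc i)" using y_pos E_bounds(4)[of "Suc i"] by simp
    then show ?thesis using E_step[OF i] by linarith
  qed
  show "i < n' \<Longrightarrow> xs' i < xs' (Suc i)" using xs'_step[of i] h_pos by simp
qed (use ts_step xs'_range ts_range E_bounds ts_points in \<open>auto simp: F_def f_offset_def p_def\<close>)

end


definition (in transport_data) decay_const :: real where "decay_const = 2 * C\<^sub>2 + 2 * C\<^sub>2 * exp 8"

definition (in transport_data) layer_const :: real where
  "layer_const = 4 * const_S' \<alpha> A T L + A * const_S' \<alpha> A T L * (4 * T + decay_const) + 4 * A * (L + T) * (2 * r + T) + 2 + 4 * T"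

definition (in transport_data) fine_const :: real where
  "fine_const = 8 * reg_const * (L + T) * L / \<alpha> + 2 * (C\<^sub>1 / \<alpha>) + C\<^sub>1 / \<alpha> + layer_const * weight_const * exp 1 / \<alpha>"

definition (in transport_data) error_const :: real where
  "error_const = coarse_const * 2 + split_const + 4 * A * (L + T) + fine_const"

context transport_instance
begin

abbreviation "am' \<equiv> \<lambda>i j. a (xs' i) (ts j)"
abbreviation "layer_interp \<equiv> bil xs' ts n' M W"
abbreviation "bm' \<equiv> \<lambda>i j. b (xs' i) (ts j)"

text \<open>
  The difference satisfies the fitted scheme with right-hand side \<open>f(p,0)\<close>, the consistency error, and a
  term from the fitting factor at the transition point. The first two are paid for by a linear barrier.
  The last one occurs in the interior only on the uniform mesh; there it is of order \<open>1/\<epsilon>\<close> and a jump of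
  the barrier by \<open>O(H/\<epsilon>) = O(ln N/N)\<close> pays for it.
\<close>

lemma DW_bound:
  assumes ij: "i \<le> n'" "j \<le> M"
  shows "\<bar>D (i0 + i) j - W i j\<bar> \<le> split_const * rate"
proof -
  let ?aF = "\<lambda>i j. aF (i0 + i) j"
  let ?D = "\<lambda>i j. D (i0 + i) j"
  let ?R = "A + r * A + r * weight_const / \<epsilon>"
  have R0: "0 \<le> ?R" using A_pos const_r weight_const_pos eps_pos by simp
  define J where "J = (if \<epsilon> * ln N < L / 2 then 0 else H * ?R)"
  have J0: "0 \<le> J" using H_pos R0 by (simp add: J_def)
  define c where "c = consist_const + \<bar>f_offset\<bar> / \<alpha>"
  have c0: "0 \<le> c" using consist_const_nonneg alpha_pos by (simp add: c_def)
  define B where "B i = coarse_const * \<mu> + c * (xs' i - p) + (if n2 \<le> i0 + i then J else 0)" for i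
  have B0: "coarse_const * \<mu> \<le> B i" "0 \<le> B i" if "i \<le> n'" for i
    using coarse_const_nonneg mu_lam c0 J0 xs'_range(1)[OF that] by (auto simp: B_def intro!: add_nonneg_nonneg)
  interpret shifted: upwind_mesh ?aF bm' xs' ts n' M \<alpha>
  proof
    show "i < n' \<Longrightarrow> xs' i < xs' (Suc i)" for i using xs'_step[of i] h_pos by simp
    show "i \<le> n' \<Longrightarrow> j \<le> M \<Longrightarrow> \<alpha> \<le> aF (i0 + i) j" for i j using aF_ge xs'_range(3) by simp
    show "i \<le> n' \<Longrightarrow> j \<le> M \<Longrightarrow> 0 \<le> b (xs' i) (ts j)" for i j using a_le(3)[of "i0 + i" j] xs'_range(3) by simp
  qed (use ts_step alpha_pos in auto)
  have "\<bar>D (i0 + i) j - W i j\<bar> \<le> B i"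
  proof (rule shifted.comparison[where B="\<lambda>i j. B i" and Y="\<lambda>i j. D (i0 + i) j - W i j"])
    fix j assume j: "j \<le> M"
    have "\<bar>D i0 j\<bar> \<le> coarse_const * \<mu>"
    proof (cases rule: sigma_cases)
      case layered
      then show ?thesis using D_coarse[OF layered(1), of n2 j] j by simp
    next
      case uniform
      then show ?thesis using D_boundary(1)[OF j] coarse_const_nonneg mu_lam by simp
    qed
    then show "\<bar>D (i0 + 0) j - W 0 j\<bar> \<le> B 0" using B0[of 0] layer.W_inflow[OF j] by simp
  next
    fix i assume i: "i \<le> n'"
    then show "\<bar>D (i0 + i) 0 - W i 0\<bar> \<le> B i"
      using B0[of i] layer.W_initial[OF i] D_boundary(2)[OF xs'_range(3)[OF i]] by simp
  next
    fix i j assume ij: "i < n'" "j < M"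
    let ?I = "i0 + i"
    have I: "?I < N" "Suc ?I \<le> N" using xs'_range(3)[of "Suc i"] ij by auto
    have st: "xs' (Suc i) - xs' i = h" using xs'_step ij by simp
    let ?aa = "am (Suc ?I) (Suc j)"
    let ?jump = "if Suc ?I = n2 then (\<kappa> - 1) * ?aa * ?R else 0"
    have dW: "\<bar>diff_x xs' W i (Suc j)\<bar> \<le> r * weight_const / \<epsilon>"
    proof -
      have "\<bar>diff_x xs' W i (Suc j)\<bar> \<le> const_Q \<alpha> A T * (1 / \<epsilon> * E (Suc i))"
        using layer.diff_x_W_bound[of i "Suc j"] ij by simp
      also have "\<dots> \<le> r * (1 / \<epsilon> * weight_const)"
        using const_r E_bounds(3,4)[of "Suc i"] eps_pos ij
        by (intro mult_mono) (auto simp: divide_right_mono less_imp_le)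
      finally show ?thesis by simp
    qed
    have DI: "upw ?aF bm' xs' ts ?D i j = upw aF bm xs ts D ?I j"
      by (simp add: upw_def diff_x_def diff_t_def)
    have WI: "upw ?aF bm' xs' ts W i j = upw am' bm' xs' ts W i j
        + (if Suc ?I = n2 then (\<kappa> - 1) * ?aa * diff_x xs' W i (Suc j) else 0)"
      by (auto simp: upw_def aF_def algebra_simps)
    have WF: "upw am' bm' xs' ts W i j = f (xs (Suc ?I)) (ts (Suc j)) - f_offset"
      using layer.W_scheme[OF ij] by (simp add: F_def)
    have kW: "\<bar>(\<kappa> - 1) * ?aa * diff_x xs' W i (Suc j)\<bar> \<le> (\<kappa> - 1) * ?aa * (r * weight_const / \<epsilon>)"
    proof -
      have nn: "0 \<le> (\<kappa> - 1) * ?aa" using kappa a_le(2)[OF I(2), of "Suc j"] alpha_pos ij by simp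
      show ?thesis unfolding abs_mult[of "(\<kappa> - 1) * ?aa"] abs_of_nonneg[OF nn] using dW nn by (rule mult_left_mono)
    qed
    have "\<bar>upw ?aF bm' xs' ts (\<lambda>i j. ?D i j - W i j) i j\<bar> \<le> \<alpha> * consist_const + \<bar>f_offset\<bar> + ?jump"
    proof (cases "Suc ?I = n2")
      case True
      have "(\<kappa> - 1) * ?aa * ?R = (\<kappa> - 1) * ?aa * (A + r * A) + (\<kappa> - 1) * ?aa * (r * weight_const / \<epsilon>)"
        by (rule distrib_left)
      then show ?thesis
        using D_scheme[OF I(1) ij(2)] kW unfolding upw_diff DI WI WF if_P[OF True] by linarith
    next
      case False
      then show ?thesis
        using D_scheme[OF I(1) ij(2)] unfolding upw_diff DI WI WF if_not_P[OF False] by linarith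
    qed
    moreover have "\<alpha> * consist_const + \<bar>f_offset\<bar> + ?jump \<le> upw ?aF bm' xs' ts (\<lambda>i j. B i) i j"
    proof -
      define \<Delta> where "\<Delta> = (if Suc ?I = n2 then J / h else 0)"
      have "B (Suc i) - B i = c * h + (if Suc ?I = n2 then J else 0)"
        unfolding B_def st[symmetric] by (auto simp: algebra_simps)
      then have q: "(B (Suc i) - B i) / (xs' (Suc i) - xs' i) = c + \<Delta>"
        unfolding st using h_pos by (simp add: \<Delta>_def add_divide_distrib)
      have age: "\<alpha> \<le> aF (Suc ?I) (Suc j)" using aF_ge I ij by simp
      have "\<alpha> * c \<le> aF (Suc ?I) (Suc j) * c" using age c0 by (rule mult_right_mono)
      moreover have "\<alpha> * c = \<alpha> * consist_const + \<bar>f_offset\<bar>" using alpha_pos by (simp add: c_def distrib_left)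
      moreover have "?jump \<le> aF (Suc ?I) (Suc j) * \<Delta>"
      proof (cases "Suc ?I = n2")
        case True
        have nl: "\<not> \<epsilon> * ln N < L / 2"
        proof
          assume "\<epsilon> * ln N < L / 2"
          then have "i0 = n2" by (simp add: i0_def)
          then show False using True by simp
        qed
        then have "H = h" by (cases rule: sigma_cases) auto
        then have "\<Delta> = ?R" using nl h_pos True by (simp add: \<Delta>_def J_def)
        moreover have "(\<kappa> - 1) * ?aa * ?R \<le> \<kappa> * ?aa * ?R"
          using a_le(2)[OF I(2), of "Suc j"] alpha_pos ij R0 by (intro mult_right_mono) auto
        ultimately show ?thesis using True by (simp add: aF_def)
      qed (simp add: \<Delta>_def)
      moreover have "0 \<le> bm' (Suc i) (Suc j) * B (Suc i)"
        using B0(2)[of "Suc i"] a_le(3)[OF I(2), of "Suc j"] ij by simp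
      ultimately show ?thesis unfolding upw_x_barrier q by (simp add: distrib_left)
    qed
    ultimately show "\<bar>upw ?aF bm' xs' ts (\<lambda>i j. ?D i j - W i j) i j\<bar> \<le> upw ?aF bm' xs' ts (\<lambda>i j. B i) i j"
      by linarith
  qed (use ij in auto)
  also have "B i \<le> coarse_const * \<mu> + c * (L - p) + J"
  proof -
    have "c * (xs' i - p) \<le> c * (L - p)" using c0 xs'_range(1)[OF ij(1)] by (intro mult_left_mono) auto
    then show ?thesis using J0 by (simp add: B_def)
  qed
  also have "\<dots> \<le> split_const * rate"
  proof -
    have "coarse_const * \<mu> \<le> 2 * coarse_const * rate" using mult_left_mono[OF mu_lam(2) coarse_const_nonneg] by simp
    moreover have "c * (L - p) \<le> 4 * A^2 * (L + T) * L / \<alpha> * rate + C\<^sub>1 / \<alpha> * rate"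
    proof -
      have "consist_const * (L - p) \<le> consist_const * L" using consist_const_nonneg p_range by (intro mult_left_mono) auto
      also have "\<dots> = A^2 * (2 * (L + T)) * L / \<alpha> * \<mu>" by (simp add: consist_const_def)
      also have "\<dots> \<le> A^2 * (2 * (L + T)) * L / \<alpha> * (2 * rate)"
        using mu_lam L_pos T_pos alpha_pos by (intro mult_left_mono) auto
      also have "\<dots> = 4 * A^2 * (L + T) * L / \<alpha> * rate" by (simp add: algebra_simps)
      finally have "consist_const * (L - p) \<le> 4 * A^2 * (L + T) * L / \<alpha> * rate" .
      moreover have "\<bar>f_offset\<bar> / \<alpha> * (L - p) \<le> C\<^sub>1 / \<alpha> * rate"
        using divide_right_mono[OF f_offset_le, of \<alpha>] alpha_pos by simp
      ultimately show ?thesis by (simp add: c_def distrib_right)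
    qed
    moreover have "J \<le> 4 * L * (A + r * A) * rate + 2 * (r * weight_const) * rate"
    proof (cases rule: sigma_cases)
      case layered
      then show ?thesis using L_pos A_pos const_r weight_const_pos mu_lam by (simp add: J_def)
    next
      case uniform
      have "J = H * (A + r * A) + y * (r * weight_const)"
        using uniform by (simp add: J_def y_def distrib_left)
      moreover have "H * (A + r * A) \<le> (2 * L * (2 * rate)) * (A + r * A)"
        using H_le mult_left_mono[OF mu_lam(3), of "2 * L"] L_pos A_pos const_r by (intro mult_right_mono) auto
      moreover have "y * (r * weight_const) \<le> (2 * rate) * (r * weight_const)"
        using y_le mu_lam(6) const_r weight_const_pos by (intro mult_right_mono) auto
      ultimately show ?thesis by (simp add: mult_ac)
    qed
    ultimately show ?thesis unfolding split_const_def distrib_right by linarith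
  qed
  finally show ?thesis .
qed

text \<open>
  The steps enter as \<open>h/\<epsilon>\<close>, of order \<open>ln N/N\<close>, as \<open>k\<close>, and as \<open>k \<Theta> / \<epsilon>\<close>, of order \<open>ln M/M\<close> by
  \<open>mesh_t_layer_decay\<close>. All of them are multiplied by \<open>X = E / \<epsilon>\<close>.
\<close>

lemma W_residual:
  assumes x: "x \<in> {p<..L}" and t: "t \<in> {0<..T}"
  shows "residual_le a b layer_interp (f x t)
    (layer_const * rate * (weight_const * exp 1 * (exp ((x - L) / \<epsilon>) / \<epsilon>)) + \<bar>f_offset\<bar>) x t"
proof -
  have ends: "xs' 0 = p" "xs' n' = L" using i0_n' xs_points by (auto simp: p_def)
  obtain i where i: "i < n'" "xs' i < x" "x \<le> xs' (Suc i)"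
    using mesh_cell_left_open[of xs' x n'] x ends by auto
  obtain j where j: "j < M" "ts j < t" "t \<le> ts (Suc j)"
    using mesh_cell_left_open[of ts t M] t ts_points by auto
  have st: "xs' (Suc i) - xs' i = h" using xs'_step i by simp
  define k where "k = ts (Suc j) - ts j"
  have k: "0 < k" using ts_step j by (simp add: k_def)
  \<comment> \<open>the rate \<open>1 / C\<^sub>2\<close> is below \<open>\<alpha>\<close>, and \<open>\<tau>\<close> is adapted to it\<close>
  define \<Theta> where "\<Theta> = layer_decay (1 / (C\<^sub>2 * \<epsilon>)) ts"
  have ij: "xs' i \<in> {0..L}" "xs' (Suc i) \<in> {0..L}" "ts j \<in> {0..T}" "ts (Suc j) \<in> {0..T}"
    using xs'_range[of i] xs'_range[of "Suc i"] ts_range i j by auto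
  have rpos: "0 < 1 / (C\<^sub>2 * \<epsilon>)" using C2_pos eps_pos by simp
  have Th: "0 < \<Theta> l" "\<Theta> l \<le> 1" if "l \<le> M" for l
    unfolding \<Theta>_def using layer_decay_pos[OF rpos, of l ts] ts_step that by auto
  define X where "X = 1 / \<epsilon> * E (Suc i)"
  have Xpos: "0 < X" using E_bounds(4)[of "Suc i"] eps_pos i by (simp add: X_def)
  have E_le: "E i \<le> E (Suc i)" using layer.E_mono i by simp
  let ?K = "const_S' \<alpha> A T L"
  let ?s = "?K * (X + 1 / \<epsilon> * X * \<Theta> (Suc j))"
  note cr = const_r
  have rX: "const_P \<alpha> A T * X \<le> r * X" "const_Q \<alpha> A T * X \<le> r * X"
    using cr Xpos by (auto intro: mult_right_mono)
  have PX: "const_P \<alpha> A T * (1 / \<epsilon> * E i) \<le> r * X" and WX: "T * (1 / \<epsilon> * E i) \<le> T * X"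
  proof -
    have EX: "1 / \<epsilon> * E i \<le> X" unfolding X_def using E_le eps_pos by (intro mult_left_mono) auto
    show "const_P \<alpha> A T * (1 / \<epsilon> * E i) \<le> r * X" by (rule order_trans[OF mult_left_mono[OF EX cr(1)] rX(1)])
    show "T * (1 / \<epsilon> * E i) \<le> T * X" by (rule mult_left_mono[OF EX less_imp_le[OF T_pos]])
  qed
  have bW: "residual_le a b layer_interp (F (Suc i) (Suc j))
    (((xs' (Suc i) - xs' i) + A * (ts (Suc j) - ts j)) * ?s
        + A * ((xs' (Suc i) - xs' i) + (ts (Suc j) - ts j)) * (2 * (r * X) + T * X)) x t"
  proof (rule bil_residual[where L=L and T=T and xs=xs' and ts=ts and n=n' and m=M and i=i and j=j and x=x and t=t and a=a and b=b and A=A and Y=W])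
    show "l < n' \<Longrightarrow> xs' l < xs' (Suc l)" for l using xs'_step[of l] h_pos by simp
    show "upw am' bm' xs' ts W i j = F (Suc i) (Suc j)" using layer.W_scheme i j by simp
    show "\<bar>diff_x xs' W i j\<bar> \<le> r * X" "\<bar>diff_x xs' W i (Suc j)\<bar> \<le> r * X"
      using layer.diff_x_W_bound[of i j] layer.diff_x_W_bound[of i "Suc j"] rX i j unfolding X_def by auto
    show "\<bar>diff_t ts W i j\<bar> \<le> r * X" using layer.diff_t_W_bound[of i j] PX i j by simp
    show "\<bar>diff_t ts W (Suc i) j\<bar> \<le> r * X" using layer.diff_t_W_bound[of "Suc i" j] rX i j unfolding X_def by simp
    show "\<bar>W i j\<bar> \<le> T * X" "\<bar>W i (Suc j)\<bar> \<le> T * X"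
      using layer.W_bound[of i j] layer.W_bound[of i "Suc j"] WX i j by auto
    show "\<bar>W (Suc i) j\<bar> \<le> T * X" "\<bar>W (Suc i) (Suc j)\<bar> \<le> T * X"
      using layer.W_bound[of "Suc i" j] layer.W_bound[of "Suc i" "Suc j"] i j unfolding X_def by auto
    have "\<bar>layer.S (Suc i) (Suc j)\<bar> \<le> ?K * (1 / \<epsilon> * E (Suc i) + (1 / \<epsilon>)^2 * E (Suc i) * \<Theta> (Suc j))"
    proof (rule layer.S_bound_layer[where \<beta>="1 / C\<^sub>2"])
      show "1 / \<epsilon> * E (Suc l) \<le> (E (Suc l) - E l) / (xs' (Suc l) - xs' l)" if "l < n'" for l
        using E_step[OF that] xs'_step[OF that] h_pos by (simp add: y_def)
      show "\<Theta> 0 = 1" by (simp add: \<Theta>_def layer_decay_def)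
      show "0 \<le> \<Theta> l" if "l \<le> M" for l using Th(1)[OF that] by simp
      show "1 / C\<^sub>2 \<le> \<alpha>" using C2_gt C2_pos alpha_pos by (simp add: field_simps)
      show "(\<Theta> (Suc l) - \<Theta> l) / (ts (Suc l) - ts l) = - (1 / C\<^sub>2) * (1 / \<epsilon>) * \<Theta> (Suc l)" if "l < M" for l
        unfolding \<Theta>_def using layer_decay_step[OF rpos, of ts l] ts_step[OF that] by simp
    qed (use i j in auto)
    then show "\<bar>diff_x xs' (diff_t ts W) i j\<bar> \<le> ?s"
      unfolding layer.diff_x_diff_t_W X_def by (simp add: power2_eq_square mult_ac)
  qed (use ij i j ts_step a_lip b_lip in auto)
  have kTh: "k * (1 / \<epsilon> * \<Theta> (Suc j)) \<le> decay_const * rate"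
  proof -
    have "k * (1 / \<epsilon> * \<Theta> (Suc j)) \<le> (2 * C\<^sub>2 + 2 * C\<^sub>2 * exp 8) * (ln M / M)"
      using mesh_t_layer_decay[OF T_pos C2_pos eps_pos M_even M_pos j(1)] by (simp add: k_def \<Theta>_def)
    also have "\<dots> \<le> decay_const * rate" unfolding decay_const_def using mu_lam C2_pos by (intro mult_left_mono) auto
    finally show ?thesis .
  qed
  have K0: "0 \<le> ?K"
  proof -
    have "1 \<le> const_S0 \<alpha> A T" "1 \<le> const_R \<alpha> A T" "0 \<le> const_S \<alpha> A T L" using layer.const_nonneg by auto
    then show ?thesis using A_pos alpha_pos by (simp add: const_S'_def)
  qed
  have hl: "h \<le> 4 * L * rate" and kl: "k \<le> 4 * T * rate"
  proof -
    have "h \<le> 2 * L * \<mu>" "k \<le> 2 * T * \<mu>"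
      using hk_le[of "i0 + i" j] xs'_range(3)[of "Suc i"] i j st by (auto simp: k_def)
    moreover have "2 * L * \<mu> \<le> 2 * L * (2 * rate)" "2 * T * \<mu> \<le> 2 * T * (2 * rate)"
      using mu_lam(2) L_pos T_pos by (auto intro!: mult_left_mono)
    moreover have "2 * L * (2 * rate) = 4 * L * rate" "2 * T * (2 * rate) = 4 * T * rate" by auto
    ultimately show "h \<le> 4 * L * rate" "k \<le> 4 * T * rate" by linarith+
  qed
  have y2: "y \<le> 2 * rate" using y_le mu_lam by simp
  have h_eps: "h * (1 / \<epsilon>) = y" by (simp add: y_def)
  have hX: "h \<le> y"
  proof -
    have "h * 1 \<le> h * (1 / \<epsilon>)" using eps_pos eps_le h_pos by (intro mult_left_mono) auto
    then show ?thesis by (simp add: y_def)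
  qed
  have s1: "h * ?s \<le> 4 * ?K * rate * X"
  proof -
    have "h * ?s = ?K * X * (h + y * \<Theta> (Suc j))" unfolding h_eps[symmetric] by (simp add: algebra_simps)
    also have "\<dots> \<le> ?K * X * (2 * rate + 2 * rate)"
    proof (intro mult_left_mono add_mono)
      show "h \<le> 2 * rate" using hX y2 by simp
      have "y * \<Theta> (Suc j) \<le> y * 1" using Th[of "Suc j"] j y_pos by (intro mult_left_mono) auto
      then show "y * \<Theta> (Suc j) \<le> 2 * rate" using y2 by simp
    qed (use K0 Xpos in auto)
    finally show ?thesis by (simp add: mult_ac)
  qed
  have s2: "A * k * ?s \<le> A * ?K * (4 * T + decay_const) * rate * X"
  proof -
    have "A * k * ?s = A * ?K * X * (k + k * (1 / \<epsilon> * \<Theta> (Suc j)))" by (simp add: algebra_simps)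
    also have "\<dots> \<le> A * ?K * X * (4 * T * rate + decay_const * rate)"
      using kTh kl K0 Xpos A_pos by (intro mult_left_mono add_mono) auto
    finally show ?thesis by (simp add: algebra_simps)
  qed
  have s3: "A * (h + k) * (2 * (r * X) + T * X) \<le> 4 * A * (L + T) * (2 * r + T) * rate * X"
  proof -
    have "A * (h + k) * (2 * (r * X) + T * X) = A * ((2 * r + T) * X) * (h + k)" by (simp add: algebra_simps)
    also have "\<dots> \<le> A * ((2 * r + T) * X) * (4 * L * rate + 4 * T * rate)"
      using hl kl A_pos cr T_pos Xpos by (intro mult_left_mono add_mono) auto
    finally show ?thesis by (simp add: algebra_simps)
  qed
  have xt_rect: "x \<in> {0..L}" "t \<in> {0..T}" using x t p_range by auto
  have s4: "\<bar>f (xs' (Suc i)) (ts (Suc j)) - f x t\<bar> \<le> (2 + 4 * T) * rate * X"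
  proof -
    note fb = layer_forcing_bounds[OF f_C2 f_layer eps_pos]
    let ?e = "exp ((xs' (Suc i) - L) / \<epsilon>)"
    have "C\<^sub>1 * ?e \<le> (2 * C\<^sub>1 + 1) * ?e" using C1_nonneg by (intro mult_right_mono) auto
    then have CE: "C\<^sub>1 * ?e \<le> E (Suc i)" by (rule order_trans) (rule E_bounds(1), use i in simp)
    have CX: "C\<^sub>1 / \<epsilon> * ?e \<le> X" unfolding X_def using CE eps_pos by (simp add: divide_right_mono)
    have "\<bar>f (xs' (Suc i)) (ts (Suc j)) - f x (ts (Suc j))\<bar> \<le> C\<^sub>1 / \<epsilon>^2 * ?e * (xs' (Suc i) - x)"
      using fb(3)[of x "xs' (Suc i)" "ts (Suc j)" "ts (Suc j)"] xt_rect ij i by simp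
    also have "\<dots> \<le> C\<^sub>1 / \<epsilon>^2 * ?e * h"
      using C1_nonneg i st by (intro mult_left_mono) auto
    also have "\<dots> = C\<^sub>1 / \<epsilon> * ?e * y" by (simp add: y_def power2_eq_square)
    also have "\<dots> \<le> X * (2 * rate)" using CX y2 Xpos y_pos by (intro mult_mono) auto
    finally have 1: "\<bar>f (xs' (Suc i)) (ts (Suc j)) - f x (ts (Suc j))\<bar> \<le> X * (2 * rate)" .
    have "\<bar>f x (ts (Suc j)) - f x t\<bar> \<le> C\<^sub>1 / \<epsilon> * exp ((x - L) / \<epsilon>) * \<bar>ts (Suc j) - t\<bar>"
      using fb(4)[of x x "ts (Suc j)" t] xt_rect ij by simp
    also have "\<dots> \<le> X * (4 * T * rate)"
    proof (intro mult_mono)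
      have "C\<^sub>1 / \<epsilon> * exp ((x - L) / \<epsilon>) \<le> C\<^sub>1 / \<epsilon> * ?e"
        using i C1_nonneg eps_pos by (intro mult_left_mono) (auto simp: divide_right_mono)
      then show "C\<^sub>1 / \<epsilon> * exp ((x - L) / \<epsilon>) \<le> X" using CX by simp
      show "\<bar>ts (Suc j) - t\<bar> \<le> 4 * T * rate" using j kl by (simp add: k_def)
    qed (use Xpos in auto)
    finally have "\<bar>f x (ts (Suc j)) - f x t\<bar> \<le> X * (4 * T * rate)" .
    moreover have "X * (2 * rate) + X * (4 * T * rate) = (2 + 4 * T) * rate * X" by (simp add: algebra_simps)
    ultimately show ?thesis using 1 by linarith
  qed
  have X_le: "X \<le> weight_const * exp 1 * (exp ((x - L) / \<epsilon>) / \<epsilon>)"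
  proof -
    have "(xs' (Suc i) - L) / \<epsilon> \<le> 1 + (x - L) / \<epsilon>"
    proof -
      have "(xs' (Suc i) - L) / \<epsilon> \<le> (h + (x - L)) / \<epsilon>" using i st eps_pos by (intro divide_right_mono) auto
      also have "\<dots> = y + (x - L) / \<epsilon>" by (simp add: y_def add_divide_distrib)
      also have "\<dots> \<le> 1 + (x - L) / \<epsilon>" using y_le' by simp
      finally show ?thesis .
    qed
    then have "exp ((xs' (Suc i) - L) / \<epsilon>) \<le> exp 1 * exp ((x - L) / \<epsilon>)" by (simp add: exp_add[symmetric])
    then have "weight_const * exp ((xs' (Suc i) - L) / \<epsilon>) \<le> weight_const * (exp 1 * exp ((x - L) / \<epsilon>))"
      using weight_const_pos by (intro mult_left_mono) auto
    then have "E (Suc i) \<le> weight_const * (exp 1 * exp ((x - L) / \<epsilon>))" using E_bounds(2)[of "Suc i"] i by simp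
    then show ?thesis unfolding X_def using eps_pos by (simp add: divide_right_mono mult_ac)
  qed
  have "(h + A * k) * ?s + A * (h + k) * (2 * (r * X) + T * X) + (2 + 4 * T) * rate * X \<le> layer_const * rate * X"
    using s1 s2 s3 unfolding layer_const_def distrib_right by linarith
  moreover have "layer_const * rate * X \<le> layer_const * rate * (weight_const * exp 1 * (exp ((x - L) / \<epsilon>) / \<epsilon>))"
    using X_le K0 A_pos T_pos L_pos cr C2_pos mu_lam
    by (intro mult_left_mono) (auto simp: layer_const_def decay_const_def)
  moreover have "\<bar>F (Suc i) (Suc j) - f x t\<bar> \<le> \<bar>f (xs' (Suc i)) (ts (Suc j)) - f x t\<bar> + \<bar>f_offset\<bar>"
    unfolding F_def by linarith
  ultimately show ?thesis
    using s4 by (intro residual_le_mono[OF bW]) (simp only: st k_def[symmetric])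
qed

end


context transport_instance
begin

section \<open>The error bound\<close>

lemma layer_const_nonneg: "0 \<le> layer_const"
  using regular.const_nonneg A_pos alpha_pos T_pos L_pos const_r C2_pos
  by (auto simp: layer_const_def decay_const_def const_S'_def intro!: add_nonneg_nonneg mult_nonneg_nonneg)

lemma exp_p_le: "\<epsilon> * ln N < L / 2 \<Longrightarrow> x \<le> p \<Longrightarrow> exp ((x - L) / \<epsilon>) \<le> 1 / N"
proof (cases rule: sigma_cases)
  case layered
  assume "x \<le> p"
  then have "x - L \<le> - (\<epsilon> * ln N)" using layered by simp
  then have "(x - L) / \<epsilon> \<le> - ln N" using eps_pos by (simp add: field_simps)
  then have "exp ((x - L) / \<epsilon>) \<le> exp (- ln N)" by simp
  then show ?thesis using N_pos by (simp add: exp_minus inverse_eq_divide)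
qed simp

lemma Y_error_coarse:
  assumes lay: "\<epsilon> * ln N < L / 2" and x: "0 \<le> x" "x \<le> p" and t: "t \<in> {0..T}"
  shows "\<bar>defect x t\<bar> \<le> (4 * reg_const * (L + T) * L / \<alpha> + 2 * (C\<^sub>1 / \<alpha>)) * rate"
proof -
  have xL: "x \<in> {0..L}" using x p_range by simp
  have "reg_const * (2 * (L + T) * \<mu>) / \<alpha> * x \<le> reg_const * (2 * (L + T) * (2 * rate)) / \<alpha> * L"
    using reg_const_nonneg L_pos T_pos alpha_pos mu_lam xL
    by (intro mult_mono divide_right_mono mult_left_mono) auto
  moreover have "C\<^sub>1 / \<alpha> * exp ((x - L) / \<epsilon>) \<le> C\<^sub>1 / \<alpha> * (2 * rate)"
    using exp_p_le[OF lay x(2)] mu_lam(3) C1_nonneg alpha_pos by (intro mult_left_mono) auto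
  ultimately show ?thesis using Y_error[OF xL t] by (simp add: algebra_simps)
qed

text \<open>
  Adding the layer part cancels the forcing \<open>f\<close> in the residual of the layer-free part. The barrier
  combines the error at \<open>x = p\<close>, a linear function for the uniform part of the residual and the
  exponential for its layer part.
\<close>

lemma YW_error:
  assumes x: "x \<in> {p..L}" and t: "t \<in> {0..T}"
  shows "\<bar>defect x t + layer_interp x t\<bar> \<le> fine_const * rate"
proof -
  define c where "c = (reg_const * (2 * (L + T) * \<mu>) + \<bar>f_offset\<bar>) / \<alpha>"
  define d where "d = layer_const * rate * (weight_const * exp 1) / \<alpha>"
  define c0 where "c0 = (4 * reg_const * (L + T) * L / \<alpha> + 2 * (C\<^sub>1 / \<alpha>)) * rate"
  have c: "0 \<le> c" using reg_const_nonneg L_pos T_pos mu_lam alpha_pos by (simp add: c_def)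
  have d: "0 \<le> d" using layer_const_nonneg mu_lam weight_const_pos alpha_pos by (simp add: d_def)
  have c0: "0 \<le> c0" using reg_const_nonneg L_pos T_pos mu_lam alpha_pos C1_nonneg by (simp add: c0_def)
  let ?B = "\<lambda>x. c0 + c * (x - p) + d * exp ((x - L) / \<epsilon>)"
  let ?B' = "\<lambda>x. c + d * (exp ((x - L) / \<epsilon>) / \<epsilon>)"
  let ?z = "\<lambda>x t. defect x t + layer_interp x t"
  have ends: "xs' 0 = p" "xs' n' = L" using i0_n' xs_points by (auto simp: p_def)
  have stx: "l < n' \<Longrightarrow> xs' l < xs' (Suc l)" for l using xs'_step[of l] h_pos by simp
  have sub: "{p..L} \<subseteq> {0..L}" using p_range by auto
  have "\<bar>?z x t\<bar> \<le> ?B x"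
  proof (rule transport_comparison[where z="?z" and B="?B" and B'="?B'" and a=a and b=b and \<alpha>=\<alpha> and p=p and q=L and T=T])
    have "continuous_on ({p..L} \<times> {0..T}) (\<lambda>(x, t). defect x t)"
      by (rule continuous_on_subset[OF continuous_on_defect]) (use sub in auto)
    then show "continuous_on ({p..L} \<times> {0..T}) (\<lambda>(x, t). ?z x t)"
      using continuous_on_bil[of "{p..L} \<times> {0..T}" xs' ts n' M W] unfolding case_prod_unfold
      by (rule continuous_on_add)
    show "(?B has_real_derivative ?B' x) (at x)" for x
      using eps_pos by (auto intro!: derivative_eq_intros)
    show "0 \<le> ?B x" "0 \<le> ?B' x" if "x \<in> {p..L}" for x
      using that c d c0 eps_pos by (auto intro!: add_nonneg_nonneg)
    show "\<alpha> \<le> a x t" "0 \<le> b x t" if "x \<in> {p..L}" "t \<in> {0..T}" for x t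
      using that sub a_ge b_ge by auto
  next
    fix x t assume xt: "x \<in> {p<..L}" "t \<in> {0<..T}"
    then have x0: "x \<in> {0<..L}" using p_range by auto
    have ac: "\<alpha> * c = reg_const * (2 * (L + T) * \<mu>) + \<bar>f_offset\<bar>" "\<alpha> * d = layer_const * rate * (weight_const * exp 1)"
      using alpha_pos by (auto simp: c_def d_def)
    have "\<alpha> * ?B' x = reg_const * (2 * (L + T) * \<mu>) + (layer_const * rate * (weight_const * exp 1 * (exp ((x - L) / \<epsilon>) / \<epsilon>)) + \<bar>f_offset\<bar>)"
      unfolding distrib_left mult.assoc[symmetric] ac by simp
    then show "residual_le a b (\<lambda>x t. ?z x t) 0 (\<alpha> * ?B' x) x t"
      using residual_le_add[OF Y_residual[OF x0 xt(2)] W_residual[OF xt]] by simp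
  next
    fix t assume t: "t \<in> {0..T}"
    have "layer_interp p t = 0"
      using bil_zero(1)[of n' xs' M ts W t] stx ts_step i0_n' M_pos ts_points t ends
      by (simp add: W_def)
    moreover have "\<bar>defect p t\<bar> \<le> c0"
    proof (cases rule: sigma_cases)
      case layered
      then show ?thesis unfolding c0_def using Y_error_coarse[OF layered(1) p_range(1) order_refl t] by simp
    next
      case uniform
      then show ?thesis using defect_boundary(1)[OF t] c0 by simp
    qed
    ultimately show "\<bar>?z p t\<bar> \<le> ?B p" using d by (simp add: add_increasing2)
  next
    fix x assume x: "x \<in> {p..L}"
    have "layer_interp x 0 = 0"
      using bil_zero(2)[of n' xs' M ts W x] stx ts_step i0_n' M_pos ts_points x ends
      by (simp add: W_def upwind_solution_initial)
    then show "\<bar>?z x 0\<bar> \<le> ?B x"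
      using defect_boundary(2)[of x] sub x c d c0 by (auto intro!: add_nonneg_nonneg)
  qed (use alpha_pos x t in auto)
  also have "?B x \<le> c0 + c * (L - p) + d * 1"
  proof (intro add_mono mult_left_mono order_refl)
    show "exp ((x - L) / \<epsilon>) \<le> 1" using x eps_pos by (simp add: divide_nonpos_pos)
  qed (use x c d in auto)
  also have "\<dots> \<le> fine_const * rate"
  proof -
    have "reg_const * (2 * (L + T) * \<mu>) * (L - p) \<le> reg_const * (2 * (L + T) * (2 * rate)) * L"
      using reg_const_nonneg L_pos T_pos mu_lam p_range by (intro mult_mono mult_left_mono) auto
    then have "(reg_const * (2 * (L + T) * \<mu>) + \<bar>f_offset\<bar>) * (L - p) \<le> reg_const * (2 * (L + T) * (2 * rate)) * L + C\<^sub>1 * rate"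
      using f_offset_le by (simp add: distrib_right)
    then have "(reg_const * (2 * (L + T) * \<mu>) + \<bar>f_offset\<bar>) * (L - p) / \<alpha> \<le> (reg_const * (2 * (L + T) * (2 * rate)) * L + C\<^sub>1 * rate) / \<alpha>"
      using alpha_pos by (intro divide_right_mono) auto
    moreover have "c * (L - p) = (reg_const * (2 * (L + T) * \<mu>) + \<bar>f_offset\<bar>) * (L - p) / \<alpha>" by (simp add: c_def)
    moreover have "(reg_const * (2 * (L + T) * (2 * rate)) * L + C\<^sub>1 * rate) / \<alpha>
        = (4 * reg_const * (L + T) * L / \<alpha> + C\<^sub>1 / \<alpha>) * rate"
      by (simp add: add_divide_distrib algebra_simps)
    ultimately have cL: "c * (L - p) \<le> (4 * reg_const * (L + T) * L / \<alpha> + C\<^sub>1 / \<alpha>) * rate" by simp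
    have dl: "d * 1 = layer_const * weight_const * exp 1 / \<alpha> * rate" by (simp add: d_def)
    have "fine_const * rate = c0 + (4 * reg_const * (L + T) * L / \<alpha> + C\<^sub>1 / \<alpha>) * rate + layer_const * weight_const * exp 1 / \<alpha> * rate"
      by (simp add: fine_const_def c0_def algebra_simps add_divide_distrib)
    then show ?thesis using cL dl by linarith
  qed
  finally show ?thesis .
qed

lemma corner_mean_g:
  assumes "i < N" "j < M" "xs i \<le> x" "x \<le> xs (Suc i)" "ts j \<le> t" "t \<le> ts (Suc j)" "0 \<le> v" "v \<le> 1" "0 \<le> w" "w \<le> 1"
  shows "\<bar>corner_mean v w (g (xs i) (ts j)) (g (xs (Suc i)) (ts j)) (g (xs i) (ts (Suc j))) (g (xs (Suc i)) (ts (Suc j))) - g x t\<bar>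
    \<le> 4 * A * (L + T) * rate"
proof -
  define hk where "hk = (xs (Suc i) - xs i) + (ts (Suc j) - ts j)"
  have r: "xs i \<in> {0..L}" "xs (Suc i) \<in> {0..L}" "ts j \<in> {0..T}" "ts (Suc j) \<in> {0..T}"
    using xs_range ts_range assms by auto
  then have xt: "x \<in> {0..L}" "t \<in> {0..T}" using assms by auto
  have q: "\<bar>g x' t' - g x t\<bar> \<le> A * hk" if "x' \<in> {xs i, xs (Suc i)}" "t' \<in> {ts j, ts (Suc j)}" for x' t'
  proof -
    have r': "x' \<in> {0..L}" "t' \<in> {0..T}" using that r by auto
    have "\<bar>\<phi> x' - \<phi> x\<bar> \<le> A * \<bar>x' - x\<bar>" "\<bar>\<psi> t' - \<psi> t\<bar> \<le> A * \<bar>t' - t\<bar>"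
      using phi_lip psi_lip r' xt by auto
    moreover have "\<bar>x' - x\<bar> + \<bar>t' - t\<bar> \<le> hk" using that assms by (auto simp: hk_def)
    then have "A * (\<bar>x' - x\<bar> + \<bar>t' - t\<bar>) \<le> A * hk" using A_pos by (intro mult_left_mono) auto
    ultimately show ?thesis by (simp add: g_def distrib_left)
  qed
  have "\<bar>corner_mean v w (g (xs i) (ts j) - g x t) (g (xs (Suc i)) (ts j) - g x t)
      (g (xs i) (ts (Suc j)) - g x t) (g (xs (Suc i)) (ts (Suc j)) - g x t)\<bar> \<le> A * hk"
    by (rule corner_mean_le) (use assms q in auto)
  also have "\<dots> \<le> A * (2 * (L + T) * (2 * rate))"
  proof (intro mult_left_mono)
    have "hk \<le> 2 * (L + T) * \<mu>" using hk_le(1) assms by (simp add: hk_def)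
    also have "\<dots> \<le> 2 * (L + T) * (2 * rate)" using mu_lam L_pos T_pos by (intro mult_left_mono) auto
    finally show "hk \<le> 2 * (L + T) * (2 * rate)" .
  qed (use A_pos in auto)
  also have "\<dots> = 4 * A * (L + T) * rate" by (simp add: algebra_simps)
  finally show ?thesis unfolding corner_mean_diff corner_mean_const .
qed

lemma V_cell:
  assumes "i < N" "j < M" "xs i \<le> x" "x \<le> xs (Suc i)" "ts j \<le> t" "t \<le> ts (Suc j)"
  shows "V x t = corner_mean ((x - xs i) / (xs (Suc i) - xs i)) ((t - ts j) / (ts (Suc j) - ts j))
    (U i j) (U (Suc i) j) (U i (Suc j)) (U (Suc i) (Suc j))"
proof -
  have "Suc i \<in> {1..N}" "Suc j \<in> {1..M}" using assms by auto
  then obtain d0 d1 d2 d3 where V: "\<forall>x\<in>{xs (Suc i - 1)..xs (Suc i)}. \<forall>t\<in>{ts (Suc j - 1)..ts (Suc j)}.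
      V x t = d0 + d1 * x + d2 * t + d3 * x * t"
    using V_int unfolding bilinear_interpolant_def by meson
  have n: "V (xs i) (ts j) = U i j" "V (xs (Suc i)) (ts j) = U (Suc i) j"
    "V (xs i) (ts (Suc j)) = U i (Suc j)" "V (xs (Suc i)) (ts (Suc j)) = U (Suc i) (Suc j)"
    using V_int assms unfolding bilinear_interpolant_def by auto
  have "V x t = corner_mean ((x - xs i) / (xs (Suc i) - xs i)) ((t - ts j) / (ts (Suc j) - ts j))
    (V (xs i) (ts j)) (V (xs (Suc i)) (ts j)) (V (xs i) (ts (Suc j))) (V (xs (Suc i)) (ts (Suc j)))"
    by (rule bilinear_corner_mean[where V=V and ?c0.0=d0 and ?c1.0=d1 and ?c2.0=d2 and ?c3.0=d3])
      (use V assms xs_step ts_step in auto)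
  then show ?thesis by (simp add: n)
qed

lemma split_const_nonneg: "0 \<le> split_const"
  using coarse_const_nonneg A_pos L_pos T_pos alpha_pos C1_nonneg const_r weight_const_pos by (simp add: split_const_def)

lemma fine_const_nonneg: "0 \<le> fine_const"
  using reg_const_nonneg layer_const_nonneg L_pos T_pos alpha_pos C1_nonneg weight_const_pos by (simp add: fine_const_def)

text \<open>
  In a cell, \<open>V - u\<close> is the interpolant of \<open>D\<close> (or of \<open>D - W\<close>, where the layer is resolved), plus the
  interpolation error of \<open>g\<close>, plus the error of \<open>g + Y\<close> (or of \<open>g + Y + W\<close>).
\<close>

lemma error_bound:
  assumes x: "x \<in> {0..L}" and t: "t \<in> {0..T}"
  shows "\<bar>V x t - u x t\<bar> \<le> error_const * rate"
proof -
  obtain j where j: "j < M" "ts j \<le> t" "t \<le> ts (Suc j)"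
    using mesh_cell_closed[of M ts t] ts_step ts_points M_pos t by auto
  define w where "w = (t - ts j) / (ts (Suc j) - ts j)"
  have w: "0 \<le> w" "w \<le> 1" using j ts_step[OF j(1)] by (auto simp: w_def)
  have parts: "0 \<le> coarse_const * rate" "0 \<le> split_const * rate" "0 \<le> fine_const * rate"
    using coarse_const_nonneg split_const_nonneg fine_const_nonneg mu_lam by auto
  have split: "V x t - u x t
      = corner_mean v w (D i j) (D (Suc i) j) (D i (Suc j)) (D (Suc i) (Suc j))
        + (corner_mean v w (g (xs i) (ts j)) (g (xs (Suc i)) (ts j)) (g (xs i) (ts (Suc j))) (g (xs (Suc i)) (ts (Suc j))) - g x t)
        + (defect x t)"
    if i: "i < N" "xs i \<le> x" "x \<le> xs (Suc i)" and v: "v = (x - xs i) / (xs (Suc i) - xs i)" for i v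
  proof -
    have "V x t = corner_mean v w (U i j) (U (Suc i) j) (U i (Suc j)) (U (Suc i) (Suc j))"
      unfolding v w_def by (rule V_cell[OF i(1) j(1) i(2,3) j(2,3)])
    moreover have "bil xs ts N M Y x t = corner_mean v w (Y i j) (Y (Suc i) j) (Y i (Suc j)) (Y (Suc i) (Suc j))"
      unfolding v w_def by (rule bil_cell[OF xs_step ts_step i j])
    moreover have "corner_mean v w (D i j) (D (Suc i) j) (D i (Suc j)) (D (Suc i) (Suc j))
      = corner_mean v w (U i j) (U (Suc i) j) (U i (Suc j)) (U (Suc i) (Suc j))
        - corner_mean v w (g (xs i) (ts j)) (g (xs (Suc i)) (ts j)) (g (xs i) (ts (Suc j))) (g (xs (Suc i)) (ts (Suc j)))
        - corner_mean v w (Y i j) (Y (Suc i) j) (Y i (Suc j)) (Y (Suc i) (Suc j))"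
      unfolding D_def by (simp only: corner_mean_diff)
    ultimately show ?thesis by linarith
  qed
  show ?thesis
  proof (cases "x < p")
    case True
    have lay: "\<epsilon> * ln N < L / 2" and i0: "i0 = n2"
      using sigma_cases True x by (metis atLeastAtMost_iff not_less)+
    obtain i where i: "i < n2" "xs i \<le> x" "x \<le> xs (Suc i)"
      using mesh_cell_closed[of n2 xs x] xs_step xs_points(1) n2 x True i0 by (auto simp: p_def)
    have iN: "i < N" using i n2 by simp
    define v where "v = (x - xs i) / (xs (Suc i) - xs i)"
    have v: "0 \<le> v" "v \<le> 1" using i xs_step[OF iN] by (auto simp: v_def)
    have "coarse_const * \<mu> \<le> coarse_const * 2 * rate" using mult_left_mono[OF mu_lam(2) coarse_const_nonneg] by simp
    then have Dl: "\<bar>D i' j'\<bar> \<le> coarse_const * 2 * rate" if "i' \<le> n2" "j' \<le> M" for i' j'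
      using D_coarse[OF lay that] by linarith
    have "\<bar>corner_mean v w (D i j) (D (Suc i) j) (D i (Suc j)) (D (Suc i) (Suc j))\<bar> \<le> coarse_const * 2 * rate"
      by (rule corner_mean_le) (use v w Dl i j in auto)
    moreover have "\<bar>defect x t\<bar> \<le> fine_const * rate"
    proof -
      have "4 * reg_const * (L + T) * L / \<alpha> + 2 * (C\<^sub>1 / \<alpha>) \<le> fine_const"
        unfolding fine_const_def using reg_const_nonneg layer_const_nonneg L_pos T_pos alpha_pos C1_nonneg weight_const_pos
        by (intro add_increasing2 add_mono divide_right_mono mult_right_mono) auto
      then have "(4 * reg_const * (L + T) * L / \<alpha> + 2 * (C\<^sub>1 / \<alpha>)) * rate \<le> fine_const * rate"
        using mu_lam by (intro mult_right_mono) auto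
      then show ?thesis using Y_error_coarse[OF lay _ _ t, of x] True x by simp
    qed
    moreover note corner_mean_g[OF iN j(1) i(2,3) j(2,3) v w] split[OF iN i(2,3) v_def]
    moreover have "error_const * rate = coarse_const * 2 * rate + split_const * rate + 4 * A * (L + T) * rate + fine_const * rate"
      by (simp add: error_const_def distrib_right)
    ultimately show ?thesis using parts by linarith
  next
    case False
    have ends: "xs' 0 = p" "xs' n' = L" using i0_n' xs_points by (auto simp: p_def)
    have stx: "l < n' \<Longrightarrow> xs' l < xs' (Suc l)" for l using xs'_step[of l] h_pos by simp
    obtain i where i: "i < n'" "xs' i \<le> x" "x \<le> xs' (Suc i)"
      using mesh_cell_closed[of n' xs' x] stx ends i0_n' x False by auto
    let ?I = "i0 + i"
    have I: "?I < N" "xs ?I \<le> x" "x \<le> xs (Suc ?I)" using i i0_n' by auto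
    define v where "v = (x - xs ?I) / (xs (Suc ?I) - xs ?I)"
    have v: "0 \<le> v" "v \<le> 1" using I xs_step[OF I(1)] by (auto simp: v_def)
    have W: "layer_interp x t = corner_mean v w (W i j) (W (Suc i) j) (W i (Suc j)) (W (Suc i) (Suc j))"
      unfolding w_def using bil_cell[where xs=xs' and n=n', OF stx ts_step i j, of W] by (simp add: v_def)
    have DW: "\<bar>D (i0 + i') j' - W i' j'\<bar> \<le> split_const * rate" if "i' \<le> n'" "j' \<le> M" for i' j'
      by (rule DW_bound[OF that])
    have "\<bar>corner_mean v w (D ?I j - W i j) (D (Suc ?I) j - W (Suc i) j)
        (D ?I (Suc j) - W i (Suc j)) (D (Suc ?I) (Suc j) - W (Suc i) (Suc j))\<bar> \<le> split_const * rate"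
      by (rule corner_mean_le) (use v w DW[of i] DW[of "Suc i"] i j in auto)
    then have "\<bar>corner_mean v w (D ?I j) (D (Suc ?I) j) (D ?I (Suc j)) (D (Suc ?I) (Suc j))
        - layer_interp x t\<bar> \<le> split_const * rate"
      unfolding W corner_mean_diff .
    moreover have "\<bar>defect x t + layer_interp x t\<bar> \<le> fine_const * rate"
      using YW_error[of x t] False x t by simp
    moreover note corner_mean_g[OF I(1) j(1) I(2,3) j(2,3) v w] split[OF I v_def]
    moreover have "error_const * rate = coarse_const * 2 * rate + split_const * rate + 4 * A * (L + T) * rate + fine_const * rate"
      by (simp add: error_const_def distrib_right)
    ultimately show ?thesis using parts by linarith
  qed
qed

lemma sup_norm_error: "sup_norm_rect L T (\<lambda>x t. V x t - u x t) \<le> error_const * (ln N / N + ln M / M)"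
  unfolding sup_norm_rect_def rate_def[symmetric]
  by (rule cSUP_least) (use error_bound L_pos T_pos in auto)

end

text \<open>
  The bound \<open>A\<close> is a sum of the bounds of the single data; \<open>G\<close> inherits its bound from the product rule for
  \<open>mixed_lipschitz\<close>.
\<close>

lemma transport_data_exists:
  fixes L T \<alpha> C\<^sub>1 C\<^sub>2 :: real
    and a b :: "real \<Rightarrow> real \<Rightarrow> real"
    and \<phi> \<psi> :: "real \<Rightarrow> real"
  assumes pos: "L > 0" "T > 0" "\<alpha> > 0" "C\<^sub>2 > 1 / \<alpha>"
    and ab: "Ck_rect 2 L T a" "Ck_rect 2 L T b"
    and pp: "Ck_on 2 {0..L} \<phi>" "Ck_on 2 {0..T} \<psi>"
    and ge: "\<And>x t. x \<in> {0..L} \<Longrightarrow> t \<in> {0..T} \<Longrightarrow> a x t \<ge> \<alpha>" "\<And>x t. x \<in> {0..L} \<Longrightarrow> t \<in> {0..T} \<Longrightarrow> b x t \<ge> 0"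
  obtains A where "transport_data L T \<alpha> C\<^sub>2 A a b \<phi> \<psi>"
proof -
  obtain Aa where Aa: "0 \<le> Aa" "mixed_lipschitz L T Aa a" using mixed_lipschitz_of_Ck_rect[OF ab(1)] .
  obtain Ab where Ab: "0 \<le> Ab" "mixed_lipschitz L T Ab b" using mixed_lipschitz_of_Ck_rect[OF ab(2)] .
  obtain Ap where Ap: "0 \<le> Ap" "\<And>x. x \<in> {0..L} \<Longrightarrow> \<bar>\<phi> x\<bar> \<le> Ap"
    "\<And>x y. x \<in> {0..L} \<Longrightarrow> y \<in> {0..L} \<Longrightarrow> \<bar>\<phi> x - \<phi> y\<bar> \<le> Ap * \<bar>x - y\<bar>"
    "\<And>x. x \<in> {0..L} \<Longrightarrow> \<bar>deriv_on {0..L} \<phi> x\<bar> \<le> Ap"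
    "\<And>x y. x \<in> {0..L} \<Longrightarrow> y \<in> {0..L} \<Longrightarrow> \<bar>deriv_on {0..L} \<phi> x - deriv_on {0..L} \<phi> y\<bar> \<le> Ap * \<bar>x - y\<bar>"
    using Ck_on_2_bounds[OF pp(1)] by blast
  obtain Aq where Aq: "0 \<le> Aq" "\<And>x. x \<in> {0..T} \<Longrightarrow> \<bar>\<psi> x\<bar> \<le> Aq"
    "\<And>x y. x \<in> {0..T} \<Longrightarrow> y \<in> {0..T} \<Longrightarrow> \<bar>\<psi> x - \<psi> y\<bar> \<le> Aq * \<bar>x - y\<bar>"
    "\<And>x. x \<in> {0..T} \<Longrightarrow> \<bar>deriv_on {0..T} \<psi> x\<bar> \<le> Aq"
    "\<And>x y. x \<in> {0..T} \<Longrightarrow> y \<in> {0..T} \<Longrightarrow> \<bar>deriv_on {0..T} \<psi> x - deriv_on {0..T} \<psi> y\<bar> \<le> Aq * \<bar>x - y\<bar>"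
    using Ck_on_2_bounds[OF pp(2)] by blast
  have g: "mixed_lipschitz L T (Ap + Aq + Ap) (\<lambda>x t. \<phi> x + \<psi> t - \<phi> 0)"
  proof -
    have "mixed_lipschitz L T Ap (\<lambda>x t. - \<phi> 0)"
      using Ap(1) Ap(2)[of 0] pos by (auto simp: mixed_lipschitz_def)
    from mixed_lipschitz_add[OF mixed_lipschitz_add[OF mixed_lipschitz_x[OF Ap(1-3), where T=T] mixed_lipschitz_t[OF Aq(1-3), where L=L]] this]
    show ?thesis by simp
  qed
  define Ag where "Ag = Aq + 4 * Aa * Ap + 4 * Ab * (Ap + Aq + Ap)"
  have G: "mixed_lipschitz L T Ag (\<lambda>x t. deriv_on {0..T} \<psi> t + a x t * deriv_on {0..L} \<phi> x + b x t * (\<phi> x + \<psi> t - \<phi> 0))"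
    unfolding Ag_def
    by (intro mixed_lipschitz_add mixed_lipschitz_mult g Aa Ab mixed_lipschitz_x mixed_lipschitz_t Ap Aq)
  define A where "A = 1 + Aa + Ab + Ap + Aq + Ag"
  have "0 \<le> Ag" using Aa Ab Ap Aq by (simp add: Ag_def)
  then have A: "1 \<le> A" "Aa \<le> A" "Ab \<le> A" "Ap \<le> A" "Aq \<le> A" "Ag \<le> A"
    using Aa(1) Ab(1) Ap(1) Aq(1) by (auto simp: A_def)
  have le: "\<bar>v\<bar> \<le> A * \<bar>w\<bar>" if "\<bar>v\<bar> \<le> B * \<bar>w\<bar>" "B \<le> A" for v w B
    using that mult_right_mono[OF that(2), of "\<bar>w\<bar>"] by simp
  have "transport_data L T \<alpha> C\<^sub>2 A a b \<phi> \<psi>"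
    by unfold_locales (use pos ge pp A le[OF Ap(3) A(4)] le[OF Ap(5) A(4)] le[OF Aq(3) A(5)] le[OF Aq(5) A(5)]
        mixed_lipschitz_mono[OF Aa(2) A(2)] mixed_lipschitz_mono[OF Ab(2) A(3)] mixed_lipschitz_mono[OF G A(6)] in auto)
  then show thesis by (rule that)
qed

theorem theorem2:
  fixes L T \<alpha> C\<^sub>1 C\<^sub>2 :: real
    and a b :: "real \<Rightarrow> real \<Rightarrow> real"
    and \<phi> \<psi> :: "real \<Rightarrow> real"
  assumes "L > 0" and "T > 0" and "\<alpha> > 0" and "C\<^sub>2 > 1 / \<alpha>"
    and "Ck_rect 2 L T a" and "Ck_rect 2 L T b"
    and "Ck_on 2 {0..L} \<phi>" and "Ck_on 2 {0..T} \<psi>"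
    and "\<And>x t. x \<in> {0..L} \<Longrightarrow> t \<in> {0..T} \<Longrightarrow> a x t \<ge> \<alpha>"
    and "\<And>x t. x \<in> {0..L} \<Longrightarrow> t \<in> {0..T} \<Longrightarrow> b x t \<ge> 0"
  shows "\<exists>C. \<forall>(\<epsilon>::real) (f :: real \<Rightarrow> real \<Rightarrow> real) (u :: real \<Rightarrow> real \<Rightarrow> real)
            (N::nat) (M::nat) (U :: nat \<Rightarrow> nat \<Rightarrow> real) (V :: real \<Rightarrow> real \<Rightarrow> real).
          0 < \<epsilon> \<and> \<epsilon> \<le> 1 \<and>
          Ck_rect 2 L T f \<and> layer_forcing L T C\<^sub>1 \<epsilon> f \<and> compatible L T a b f \<phi> \<psi> \<and>
          transport_solution L T a b f \<phi> \<psi> u \<and>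
          even N \<and> N > 0 \<and> even M \<and> M > 0 \<and>
          discrete_solution L T C\<^sub>2 \<epsilon> a b f u N M U \<and>
          bilinear_interpolant (mesh_x L \<epsilon> N) (mesh_t T C\<^sub>2 \<epsilon> M) N M U V \<longrightarrow>
          sup_norm_rect L T (\<lambda>x t. V x t - u x t)
            \<le> C * (ln (real N) / real N + ln (real M) / real M)"
proof -
  obtain A where "transport_data L T \<alpha> C\<^sub>2 A a b \<phi> \<psi>" using transport_data_exists[OF assms] .
  then interpret transport_data L T \<alpha> C\<^sub>1 C\<^sub>2 A a b \<phi> \<psi> .
  show ?thesis
  proof (intro exI allI impI, elim conjE)
    fix \<epsilon> :: real and f u :: "real \<Rightarrow> real \<Rightarrow> real" and N M :: nat and U :: "nat \<Rightarrow> nat \<Rightarrow> real" and V :: "real \<Rightarrow> real \<Rightarrow> real"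
    assume "0 < \<epsilon>" "\<epsilon> \<le> 1" "Ck_rect 2 L T f" "layer_forcing L T C\<^sub>1 \<epsilon> f" "compatible L T a b f \<phi> \<psi>"
      "transport_solution L T a b f \<phi> \<psi> u" "even N" "N > 0" "even M" "M > 0"
      "discrete_solution L T C\<^sub>2 \<epsilon> a b f u N M U"
      "bilinear_interpolant (mesh_x L \<epsilon> N) (mesh_t T C\<^sub>2 \<epsilon> M) N M U V"
    then interpret transport_instance L T \<alpha> C\<^sub>1 C\<^sub>2 A a b \<phi> \<psi> \<epsilon> f u N M U V
      by unfold_locales
    show "sup_norm_rect L T (\<lambda>x t. V x t - u x t) \<le> error_const * (ln (real N) / real N + ln (real M) / real M)"
      by (rule sup_norm_error)
  qed
qed

end
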